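(* Let $x\equiv 3\pmod 4$ be a large integer. Let $\Lambda^+:[x]\to\mathbb{R}$ be a function with $\Lambda^\Lambda(n)\le\Lambda^+(n)$ for every $n\in[x]$. Let $\alpha^+,\alpha^-,\eta>0$. Let $W=2\prod_{p\le w}p$ where $w=0.1\log\log x$, and $N=\lfloor x/W\rfloor$. Assume that for every residue class $b \bmod W$ with $(b,W)=1$ and $b\equiv 1\pmod 4$ the following hold: (I) for all $\gamma\in\mathbb{R}$, $\bigl|\sum_{n\le N}\Lambda^+_{W,b}(n)e(\gamma n)-\alpha^+\sum_{n\le N}e(\gamma n)\bigr|\le \alpha^+\eta N$; (II) for some $2<q<3$, $\int_0^1\bigl|\sum_{n\le N}\Lambda^\Lambda_{W,b}(n)e(\gamma n)\bigr|^q\,d\gamma\ll N^{q-1}$, where the implied constant does not depend on $W$ or $b$; (III) for each arithmetic progression $P\subset[N]$ with $|P|\ge\eta N$, $\sum_{n\in P}\Lambda^\Lambda_{W,b}(n)\ge\alpha^-|P|$. If $\alpha^+<3\alpha^-$ and $\eta$ is small enough in terms of $3\alpha^--\alpha^+$, then $x$ can be written as the sum of three Fouvry–Iwaniec primes.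
   Context: A Fouvry–Iwaniec prime is a prime $p=k^2+l^2$ with $k\in\mathbb{Z}$ and $l$ prime. $[N]=\{1,\dots,N\}$, $e(t)=e^{2\pi i t}$. $\Lambda$ is the von Mangoldt function, $\chi$ the nontrivial character modulo $4$, $\varphi$ Euler's function. $\Lambda^\Lambda(n)=\Lambda(n)\sum_{n=k^2+l^2}\Lambda(l)$ (sum over $k\in\mathbb{Z}$, positive integers $l$). $H=2\prod_p\bigl(1-\frac{\chi(p)}{(p-1)(p-\chi(p))}\bigr)$. $\psi'(q)=\prod_{p\mid q}(1-\frac{\chi(p)}{p-1})^{-1}$, $\varrho_c(q,a)=\#\{k\bmod q:k^2+c^2\equiv a\pmod q\}$, and for $(a,q)=1$, $\Xi(q,a)=\frac{\psi'(q)}{\varphi(q)}\sum_{c\bmod q,\,(c,q)=1}\varrho_c(q,a)$, $\Xi(q,a)=0$ otherwise. For $f:[x]\to\mathbb{C}$ and $b\in[W]$, the normalised $W$-tricked function is $f_{W,b}:[N]\to\mathbb{C}$, $f_{W,b}(n)=\frac{\varphi(W)}{\Xi(W,b)WH}f(Wn+b)$. *)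

theory Defs
  imports "HOL-Analysis.Analysis" "HOL-Number_Theory.Number_Theory"
begin

definition FI_prime :: "nat \<Rightarrow> bool" where
  "FI_prime p \<longleftrightarrow> prime p \<and> (\<exists>(k::int) (l::nat). prime l \<and> int p = k\<^sup>2 + (int l)\<^sup>2)"

definition chi4 :: "nat \<Rightarrow> real" where
  "chi4 n = (if n mod 4 = 1 then 1 else if n mod 4 = 3 then -1 else 0)"

definition add_char :: "real \<Rightarrow> complex" where
  "add_char t = exp (2 * of_real pi * \<i> * of_real t)"

definition Lambda_Lambda :: "nat \<Rightarrow> real" where
  "Lambda_Lambda n =
     mangoldt n * (\<Sum>(k, l) \<in> {(k::int, l::nat). l > 0 \<and> int n = k\<^sup>2 + (int l)\<^sup>2}. mangoldt l)"

definition H_const :: real where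
  "H_const = 2 * (\<Prod>p. if prime p
                       then 1 - chi4 p / ((real p - 1) * (real p - chi4 p)) else 1)"

definition psi' :: "nat \<Rightarrow> real" where
  "psi' q = (\<Prod>p \<in> prime_factors q. inverse (1 - chi4 p / (real p - 1)))"

definition rho :: "nat \<Rightarrow> nat \<Rightarrow> nat \<Rightarrow> nat" where
  "rho c q a = card {k \<in> {0..<q}. [k\<^sup>2 + c\<^sup>2 = a] (mod q)}"

definition Xi :: "nat \<Rightarrow> nat \<Rightarrow> real" where
  "Xi q a = (if coprime a q
     then psi' q / real (totient q) * (\<Sum>c \<in> {c \<in> {0..<q}. coprime c q}. real (rho c q a))
     else 0)"

definition W_of :: "nat \<Rightarrow> nat" where
  "W_of x = 2 * (\<Prod>p \<in> {p::nat. prime p \<and> real p \<le> ln (ln (real x)) / 10}. p)"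

text \<open>The argument \<open>f\<close> is a function on \<open>{1..x}\<close>. For \<open>n = x div W\<close> the point \<open>W * n + b\<close> may
  exceed \<open>x\<close>, so \<open>f\<close> is extended by zero there, whatever its values as a total function are.\<close>

definition W_trick :: "nat \<Rightarrow> nat \<Rightarrow> nat \<Rightarrow> (nat \<Rightarrow> 'a::real_vector) \<Rightarrow> nat \<Rightarrow> 'a" where
  "W_trick x W b f n =
     (real (totient W) / (Xi W b * real W * H_const)) *\<^sub>R
       (if W * n + b \<in> {1..x} then f (W * n + b) else 0)"

definition arith_prog :: "nat set \<Rightarrow> bool" where
  "arith_prog P \<longleftrightarrow> (\<exists>a d m. d > 0 \<and> P = {a + j * d | j. j < m})"

end

theory Submission
  imports Defs "HOL-Real_Asymp.Real_Asymp"
begin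

text \<open>
  The proof is a Fourier-analytic transference. Each weight \<open>f\<close>, normalised so that its majorant has
  density \<open>1\<close>, is convolved with a product of Fejer kernels in the directions of its large spectrum.
  The \<open>L\<^sup>q\<close> bound makes the number of these directions bounded, and replacing \<open>f\<close> by its smoothing
  \<open>g\<close> changes the ternary count by at most a small multiple of \<open>N\<^sup>2\<close>. The majorant gives \<open>g \<le> 1 + o(1)\<close>,
  and (III) gives \<open>g\<close> mean above \<open>1/3\<close> on long progressions. As \<open>g\<close> has a bounded almost period \<open>d\<close> and a
  long one \<open>d Q\<close>, it restricts to slowly varying functions on \<open>\<int>/Q\<int>\<close>, where a popular version of
  Kneser's inequality for connected groups holds, so densities above \<open>1/3\<close> force many solutions
  of \<open>n\<^sub>1 + n\<^sub>2 + n\<^sub>3 = M\<close>, with a constant depending only on the density.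

  Hypothesis (III) on singletons fails, so \<open>\<eta> N > 1\<close>; hence \<open>x\<close> is large in terms of
  \<open>3 \<alpha>\<^sup>- - \<alpha>\<^sup>+\<close> although the threshold \<open>x\<^sub>0\<close> does not depend on it. The integers
  carrying weight that are not Fouvry--Iwaniec primes come from proper prime powers and are too few
  to matter.
\<close>

section \<open>Exponential sums and the Fejer kernel\<close>

text \<open>Density above 1/3 in a cyclic group is not enough by itself: for an even modulus the odd
  residues have density 1/2, yet three of them never sum to an even residue. Slow variation excludes
  such subgroup obstructions; what remains is the threshold 1/3, set by three equal arcs on a
  circle. The second, long almost period is there because (III) says nothing about progressions
  shorter than \<open>\<eta> * N\<close>: only a cycle of that many terms has a known mean.

  All constants may depend only on \<open>q\<close>, \<open>K\<close> and
  \<open>\<delta> = 3 * \<alpha>m - \<alpha>p\<close>. The normalised density is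
  \<open>1/3 + \<delta> / (3 * \<alpha>p)\<close>, which would degenerate for large
  \<open>\<alpha>p\<close>; the L^q bound near frequency 0 caps \<open>\<alpha>m\<close>, and so
  \<open>\<alpha>p\<close>, in terms of \<open>K\<close>. In the other direction, comparing total
  masses gives \<open>\<alpha>p \<ge> \<delta> / 6\<close>, which keeps the L^q constant bounded
  after normalisation.\<close>

lemma add_char_cis: "add_char t = cis (2 * pi * t)"
  by (simp add: add_char_def cis_conv_exp mult_ac)

lemma add_char_0 [simp]: "add_char 0 = 1"
  by (simp add: add_char_cis)

lemma add_char_add: "add_char (s + t) = add_char s * add_char t"
  by (simp add: add_char_cis cis_mult distrib_left)

lemma norm_add_char [simp]: "cmod (add_char t) = 1"
  by (simp add: add_char_cis)

lemma cnj_add_char: "cnj (add_char t) = add_char (- t)"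
  by (simp add: add_char_cis cis_cnj)

lemma add_char_of_int [simp]: "add_char (of_int m) = 1"
  by (simp add: add_char_cis)

lemma add_char_power: "add_char t ^ n = add_char (real n * t)"
  by (induction n) (simp_all add: add_char_add distrib_right)

lemma norm_add_char_diff: "cmod (add_char s - add_char t) \<le> 2 * pi * \<bar>s - t\<bar>"
proof -
  have "cmod (add_char s - add_char t) = dist (cis (2 * pi * s)) (cis (2 * pi * t))"
    by (simp add: add_char_cis dist_norm)
  also have "\<dots> \<le> \<bar>2 * pi * s - 2 * pi * t\<bar>"
  proof -
    have "cmod (exp (\<i> * of_real x) - 1) \<le> \<bar>x\<bar>" for x :: real
    proof -
      have "cmod (exp (\<i> * of_real x) - 1) = 2 * \<bar>sin (x / 2)\<bar>"
        by (rule dist_exp_i_1)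
      also have "\<dots> \<le> 2 * \<bar>x / 2\<bar>" by (intro mult_left_mono abs_sin_x_le_abs_x) auto
      finally show ?thesis by simp
    qed
    then have *: "cmod (cis x - 1) \<le> \<bar>x\<bar>" for x by (simp add: cis_conv_exp)
    have "cis x - cis y = cis y * (cis (x - y) - 1)" for x y
      by (simp add: cis_mult right_diff_distrib)
    then have "cmod (cis x - cis y) \<le> \<bar>x - y\<bar>" for x y
      using *[of "x - y"] by (simp add: norm_mult)
    then show ?thesis by (simp add: dist_norm)
  qed
  also have "\<dots> = 2 * pi * \<bar>s - t\<bar>" by (simp add: right_diff_distrib[symmetric] abs_mult)
  finally show ?thesis .
qed

lemma continuous_on_add_char [continuous_intros]:
  "continuous_on S f \<Longrightarrow> continuous_on S (\<lambda>x. add_char (f x))"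
  unfolding add_char_def by (intro continuous_intros)

lemma add_char_has_integral:
  "((\<lambda>t. add_char (t * of_int m)) has_integral (if m = 0 then 1 else 0)) {0..1}"
proof (cases "m = 0")
  case True
  then show ?thesis using has_integral_const_real[of "1::complex" 0 1] by simp
next
  case False
  let ?c = "2 * of_real pi * \<i> * of_int m :: complex"
  have c: "?c \<noteq> 0" using False by simp
  have "((\<lambda>t. add_char (t * of_int m)) has_integral (exp (?c * of_real 1) / ?c - exp (?c * of_real 0) / ?c)) {0..1}"
  proof (rule fundamental_theorem_of_calculus)
    fix x :: real
    have "((\<lambda>z. exp (?c * z) / ?c) has_field_derivative exp (?c * of_real x)) (at (of_real x))"
      using c by (auto intro!: derivative_eq_intros)
    then have "((\<lambda>x. exp (?c * of_real x) / ?c) has_vector_derivative exp (?c * of_real x)) (at x within {0..1})"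
      by (rule has_vector_derivative_real_field)
    then show "((\<lambda>x. exp (?c * of_real x) / ?c) has_vector_derivative add_char (x * of_int m)) (at x within {0..1})"
      by (simp add: add_char_def mult_ac)
  qed simp
  moreover have "exp (?c * of_real 1) = 1"
    using add_char_of_int[of m] by (simp add: add_char_def)
  ultimately show ?thesis using False by simp
qed

section \<open>Fourier transform and convolution of finitely supported functions on the
  integers\<close>

definition ft :: "(int \<Rightarrow> real) \<Rightarrow> real \<Rightarrow> complex" where
  "ft u \<gamma> = (\<Sum>n | u n \<noteq> 0. of_real (u n) * add_char (\<gamma> * of_int n))"

abbreviation fsupp :: "(int \<Rightarrow> real) \<Rightarrow> bool" where
  "fsupp u \<equiv> finite {n. u n \<noteq> 0}"

lemma fsuppI: "finite S \<Longrightarrow> (\<And>n. n \<notin> S \<Longrightarrow> u n = 0) \<Longrightarrow> fsupp u"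
  by (rule finite_subset[of _ S]) auto

lemma ft_eq_sum:
  assumes "finite S" "\<And>n. n \<notin> S \<Longrightarrow> u n = 0"
  shows "ft u \<gamma> = (\<Sum>n\<in>S. of_real (u n) * add_char (\<gamma> * of_int n))"
  unfolding ft_def using assms by (intro sum.mono_neutral_left) auto

lemma continuous_on_ft [continuous_intros]:
  "continuous_on S f \<Longrightarrow> continuous_on S (\<lambda>x. ft u (f x))"
  unfolding ft_def by (intro continuous_intros)

lemma ft_diff:
  assumes "fsupp u" "fsupp v"
  shows "ft (\<lambda>n. u n - v n) \<gamma> = ft u \<gamma> - ft v \<gamma>"
proof -
  let ?S = "{n. u n \<noteq> 0} \<union> {n. v n \<noteq> 0}"
  have fin: "finite ?S" using assms by simp
  have "ft u \<gamma> = (\<Sum>n\<in>?S. of_real (u n) * add_char (\<gamma> * of_int n))"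
    "ft v \<gamma> = (\<Sum>n\<in>?S. of_real (v n) * add_char (\<gamma> * of_int n))"
    "ft (\<lambda>n. u n - v n) \<gamma> = (\<Sum>n\<in>?S. of_real (u n - v n) * add_char (\<gamma> * of_int n))"
    by (rule ft_eq_sum[OF fin]; auto)+
  then show ?thesis by (simp add: sum_subtractf left_diff_distrib)
qed

lemma ft_cmult: "ft (\<lambda>n. c * u n) \<gamma> = of_real c * ft u \<gamma>"
  by (cases "c = 0") (auto simp: ft_def sum_distrib_left mult_ac)

lemma norm_ft_le:
  assumes "finite S" "\<And>n. n \<notin> S \<Longrightarrow> u n = 0" "\<And>n. u n \<ge> 0"
  shows "cmod (ft u \<gamma>) \<le> (\<Sum>n\<in>S. u n)"
proof -
  have "cmod (ft u \<gamma>) \<le> (\<Sum>n\<in>S. cmod (of_real (u n) * add_char (\<gamma> * of_int n)))"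
    by (subst ft_eq_sum[of S u]) (use assms(1,2) in \<open>auto intro: norm_sum\<close>)
  then show ?thesis using assms(3) by (simp add: norm_mult)
qed

text \<open>Frequencies matter only at scale \<open>1 / R\<close>. This is used twice: a large value
  of the transform persists on a whole grid cell, and the multiplier of the smoothing stays near 1
  around a selected frequency.\<close>

lemma ft_lipschitz:
  fixes R :: real
  assumes S: "finite S" "\<And>n. n \<notin> S \<Longrightarrow> u n = 0" and u: "\<And>n. u n \<ge> 0"
    and R: "\<And>n. n \<in> S \<Longrightarrow> \<bar>real_of_int n\<bar> \<le> R"
  shows "cmod (ft u \<gamma> - ft u \<theta>) \<le> 2 * pi * R * \<bar>\<gamma> - \<theta>\<bar> * (\<Sum>n\<in>S. u n)"
proof -
  have e: "ft u \<gamma> = (\<Sum>n\<in>S. of_real (u n) * add_char (\<gamma> * of_int n))" for \<gamma>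
    by (rule ft_eq_sum) (auto simp: S)
  have "ft u \<gamma> - ft u \<theta> = (\<Sum>n\<in>S. of_real (u n) * (add_char (\<gamma> * of_int n) - add_char (\<theta> * of_int n)))"
    unfolding e by (simp add: sum_subtractf right_diff_distrib)
  also have "cmod \<dots> \<le> (\<Sum>n\<in>S. u n * (2 * pi * R * \<bar>\<gamma> - \<theta>\<bar>))"
  proof (rule order_trans[OF norm_sum], rule sum_mono)
    fix n assume n: "n \<in> S"
    have "cmod (add_char (\<gamma> * of_int n) - add_char (\<theta> * of_int n)) \<le> 2 * pi * \<bar>\<gamma> * of_int n - \<theta> * of_int n\<bar>"
      by (rule norm_add_char_diff)
    also have "\<bar>\<gamma> * of_int n - \<theta> * of_int n\<bar> = \<bar>of_int n\<bar> * \<bar>\<gamma> - \<theta>\<bar>"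
      by (simp add: left_diff_distrib[symmetric] abs_mult)
    also have "2 * pi * \<dots> \<le> 2 * pi * (R * \<bar>\<gamma> - \<theta>\<bar>)"
      using R[OF n] by (intro mult_left_mono mult_right_mono) auto
    finally have "cmod (add_char (\<gamma> * of_int n) - add_char (\<theta> * of_int n)) \<le> 2 * pi * R * \<bar>\<gamma> - \<theta>\<bar>"
      by (simp add: mult.assoc)
    then show "cmod (of_real (u n) * (add_char (\<gamma> * of_int n) - add_char (\<theta> * of_int n)))
        \<le> u n * (2 * pi * R * \<bar>\<gamma> - \<theta>\<bar>)"
      using u by (simp add: norm_mult mult_left_mono)
  qed
  also have "\<dots> = 2 * pi * R * \<bar>\<gamma> - \<theta>\<bar> * (\<Sum>n\<in>S. u n)"
    by (subst sum_distrib_right[symmetric]) (rule mult.commute)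
  finally show ?thesis .
qed

lemma ft_inversion:
  assumes "fsupp u"
  shows "((\<lambda>t. ft u t * add_char (- (t * of_int n))) has_integral of_real (u n)) {0..1}"
proof -
  have "((\<lambda>t. \<Sum>m | u m \<noteq> 0. of_real (u m) * add_char (t * of_int (m - n)))
      has_integral (\<Sum>m | u m \<noteq> 0. of_real (u m) * (if m - n = 0 then 1 else 0))) {0..1}"
    using assms by (intro has_integral_sum has_integral_mult_right add_char_has_integral)
  moreover have "(\<Sum>m | u m \<noteq> 0. of_real (u m) * (if m - n = 0 then 1 else 0)) = (of_real (u n) :: complex)"
    using assms by (simp add: sum.delta' if_distrib cong: if_cong)
  moreover have "ft u t * add_char (- (t * of_int n))
      = (\<Sum>m | u m \<noteq> 0. of_real (u m) * add_char (t * of_int (m - n)))" for t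
    unfolding ft_def sum_distrib_right
    by (intro sum.cong) (auto simp: mult.assoc add_char_add[symmetric] algebra_simps)
  ultimately show ?thesis by simp
qed

text \<open>For finitely supported \<open>u\<close> this is a finite sum whatever \<open>v\<close>
  is. \<open>conv u (conv v w) M\<close> is the weighted number of ways to write \<open>M\<close> as
  a sum of three integers.\<close>

definition conv :: "(int \<Rightarrow> real) \<Rightarrow> (int \<Rightarrow> real) \<Rightarrow> int \<Rightarrow> real" where
  "conv u v n = (\<Sum>h | u h \<noteq> 0. u h * v (n - h))"

lemma conv_eq_sum:
  assumes "finite S" "\<And>n. n \<notin> S \<Longrightarrow> u n = 0"
  shows "conv u v n = (\<Sum>h\<in>S. u h * v (n - h))"
  unfolding conv_def using assms by (intro sum.mono_neutral_left) auto

lemma conv_support: "{n. conv u v n \<noteq> 0} \<subseteq> (\<lambda>(a, b). a + b) ` ({n. u n \<noteq> 0} \<times> {n. v n \<noteq> 0})"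
proof
  fix n assume "n \<in> {n. conv u v n \<noteq> 0}"
  then have "(\<Sum>h | u h \<noteq> 0. u h * v (n - h)) \<noteq> 0" by (simp add: conv_def)
  then obtain h where "u h \<noteq> 0" "u h * v (n - h) \<noteq> 0" by (rule sum.not_neutral_contains_not_neutral) auto
  then show "n \<in> (\<lambda>(a, b). a + b) ` ({n. u n \<noteq> 0} \<times> {n. v n \<noteq> 0})"
    by (intro image_eqI[of _ _ "(h, n - h)"]) auto
qed

lemma fsupp_conv: "fsupp u \<Longrightarrow> fsupp v \<Longrightarrow> fsupp (conv u v)"
  by (rule finite_subset[OF conv_support]) simp

lemma ft_conv:
  assumes "fsupp u" "fsupp v"
  shows "ft (conv u v) \<gamma> = ft u \<gamma> * ft v \<gamma>"
proof -
  let ?S = "(\<lambda>(a, b). a + b) ` ({n. u n \<noteq> 0} \<times> {n. v n \<noteq> 0})"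
  have fin: "finite ?S" using assms by simp
  have "ft (conv u v) \<gamma> = (\<Sum>n\<in>?S. of_real (conv u v n) * add_char (\<gamma> * of_int n))"
    using conv_support[of u v] by (intro ft_eq_sum fin) blast
  also have "\<dots> = (\<Sum>n\<in>?S. \<Sum>h | u h \<noteq> 0. of_real (u h) * of_real (v (n - h)) * add_char (\<gamma> * of_int n))"
    by (simp add: conv_def sum_distrib_right)
  also have "\<dots> = (\<Sum>h | u h \<noteq> 0. \<Sum>n\<in>?S. of_real (u h) * of_real (v (n - h)) * add_char (\<gamma> * of_int n))"
    by (rule sum.swap)
  also have "\<dots> = (\<Sum>h | u h \<noteq> 0. of_real (u h) * add_char (\<gamma> * of_int h) * ft v \<gamma>)"
  proof (rule sum.cong)
    fix h assume h: "h \<in> {h. u h \<noteq> 0}"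
    have sub: "v m = 0" if "m \<notin> (\<lambda>n. n - h) ` ?S" for m
    proof (rule ccontr)
      assume "v m \<noteq> 0"
      then have "h + m \<in> ?S" using h by (intro image_eqI[of _ _ "(h, m)"]) auto
      then have "m \<in> (\<lambda>n. n - h) ` ?S" by (intro image_eqI[of _ _ "h + m"]) auto
      then show False using that by simp
    qed
    have "ft v \<gamma> = (\<Sum>m\<in>(\<lambda>n. n - h) ` ?S. of_real (v m) * add_char (\<gamma> * of_int m))"
      using fin by (intro ft_eq_sum sub) auto
    also have "\<dots> = (\<Sum>n\<in>?S. of_real (v (n - h)) * add_char (\<gamma> * of_int (n - h)))"
      by (subst sum.reindex) (auto simp: inj_on_def)
    finally have "of_real (u h) * add_char (\<gamma> * of_int h) * ft v \<gamma>
        = (\<Sum>n\<in>?S. of_real (u h) * add_char (\<gamma> * of_int h) * (of_real (v (n - h)) * add_char (\<gamma> * of_int (n - h))))"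
      by (simp only: sum_distrib_left)
    also have "\<dots> = (\<Sum>n\<in>?S. of_real (u h) * of_real (v (n - h)) * add_char (\<gamma> * of_int n))"
    proof (rule sum.cong)
      fix n
      have "add_char (\<gamma> * of_int n) = add_char (\<gamma> * of_int h) * add_char (\<gamma> * of_int (n - h))"
        by (simp add: add_char_add[symmetric] algebra_simps)
      then show "of_real (u h) * add_char (\<gamma> * of_int h) * (of_real (v (n - h)) * add_char (\<gamma> * of_int (n - h)))
          = of_real (u h) * of_real (v (n - h)) * add_char (\<gamma> * of_int n)" by simp
    qed simp
    finally show "(\<Sum>n\<in>?S. of_real (u h) * of_real (v (n - h)) * add_char (\<gamma> * of_int n))
        = of_real (u h) * add_char (\<gamma> * of_int h) * ft v \<gamma>" by simp
  qed simp
  finally show ?thesis by (simp add: ft_def sum_distrib_right)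
qed

section \<open>Tent functions, Fejer kernels and their products\<close>

definition tent :: "nat \<Rightarrow> int \<Rightarrow> real" where
  "tent D i = max 0 (1 - \<bar>of_int i\<bar> / real D)"

definition fejer :: "nat \<Rightarrow> real \<Rightarrow> real" where
  "fejer D t = (cmod (\<Sum>j<D. add_char (t * real j)))\<^sup>2 / real D"

lemma tent_nonneg [simp]: "tent D i \<ge> 0" by (simp add: tent_def)

lemma tent_le_1: "tent D i \<le> 1" by (simp add: tent_def)

lemma tent_0 [simp]: "tent D 0 = 1" by (simp add: tent_def)

lemma tent_outside: "D > 0 \<Longrightarrow> i \<notin> {- int D..int D} \<Longrightarrow> tent D i = 0"
  by (auto simp: tent_def max_def field_simps)

lemma tent_lipschitz: "D > 0 \<Longrightarrow> \<bar>tent D (i + h) - tent D i\<bar> \<le> \<bar>of_int h\<bar> / real D"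
proof -
  assume D: "D > 0"
  have *: "\<bar>max 0 x - max 0 y\<bar> \<le> \<bar>x - y\<bar>" for x y :: real by (auto simp: max_def)
  have "\<bar>tent D (i + h) - tent D i\<bar> \<le> \<bar>(\<bar>of_int i\<bar> - \<bar>of_int (i + h)\<bar>) / real D\<bar>"
    unfolding tent_def by (rule order_trans[OF *]) (simp add: diff_divide_distrib)
  also have "\<dots> = \<bar>\<bar>of_int i\<bar> - \<bar>of_int (i + h) :: real\<bar>\<bar> / real D" by (simp add: abs_divide)
  also have "\<dots> \<le> \<bar>of_int h\<bar> / real D" using D by (intro divide_right_mono) auto
  finally show ?thesis .
qed

lemma fejer_nonneg [simp]: "fejer D t \<ge> 0" by (simp add: fejer_def)

lemma fejer_0 [simp]: "fejer D 0 = real D" by (simp add: fejer_def power2_eq_square)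

text \<open>Up to the factor \<open>D\<close> the tent is the correlation of the interval
  \<open>{0..<D}\<close> with itself, so its transform is a squared modulus.\<close>

lemma ft_tent:
  assumes D: "D > 0"
  shows "ft (tent D) t = of_real (fejer D t)"
proof -
  define p where "p n = (if n \<in> {0..<int D} then 1 else 0 :: real)" for n
  define q where "q n = (if n \<in> {- int D<..0} then 1 else 0 :: real)" for n
  have fp: "fsupp p" by (rule fsuppI[of "{0..<int D}"]) (auto simp: p_def)
  have fq: "fsupp q" by (rule fsuppI[of "{- int D<..0}"]) (auto simp: q_def)
  have ftp: "ft p t = (\<Sum>j<D. add_char (t * real j))"
  proof -
    have "ft p t = (\<Sum>n\<in>{0..<int D}. add_char (t * of_int n))"
      by (subst ft_eq_sum[of "{0..<int D}"]) (auto simp: p_def)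
    also have "\<dots> = (\<Sum>j<D. add_char (t * real j))"
      by (rule sum.reindex_bij_witness[of _ int nat]) auto
    finally show ?thesis .
  qed
  have ftq: "ft q t = cnj (ft p t)"
  proof -
    have "ft q t = (\<Sum>n\<in>{- int D<..0}. add_char (t * of_int n))"
      by (subst ft_eq_sum[of "{- int D<..0}"]) (auto simp: q_def)
    also have "\<dots> = (\<Sum>j<D. add_char (- (t * real j)))"
      by (rule sum.reindex_bij_witness[of _ "\<lambda>j. - int j" "\<lambda>n. nat (- n)"]) auto
    finally show ?thesis by (simp add: ftp cnj_add_char)
  qed
  have cv: "conv p q n = real D * tent D n" for n
  proof -
    have "conv p q n = (\<Sum>h\<in>{0..<int D}. p h * q (n - h))"
      by (rule conv_eq_sum) (auto simp: p_def)
    also have "\<dots> = (\<Sum>h\<in>{0..<int D}. if h \<in> {n..<n + int D} then 1 else 0)"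
      by (rule sum.cong) (auto simp: p_def q_def)
    also have "\<dots> = real (card ({0..<int D} \<inter> {n..<n + int D}))"
      by (subst sum.inter_restrict[symmetric]) (simp, simp only: sum_constant mult_1_right)
    also have "{0..<int D} \<inter> {n..<n + int D} = {max 0 n..<min (int D) (n + int D)}" by auto
    also have "real (card \<dots>) = real D * tent D n"
      using D by (auto simp: tent_def max_def min_def field_simps)
    finally show ?thesis .
  qed
  have "ft (conv p q) t = ft p t * cnj (ft p t)"
    by (simp add: ft_conv[OF fp fq] ftq)
  also have "\<dots> = of_real ((cmod (ft p t))\<^sup>2)" by (simp only: complex_norm_square)
  finally have "of_real (real D) * ft (tent D) t = of_real ((cmod (ft p t))\<^sup>2)"
    by (subst ft_cmult[symmetric]) (simp only: cv[symmetric])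
  then have "ft (tent D) t = of_real ((cmod (ft p t))\<^sup>2) / of_real (real D)"
    using D by (simp add: field_simps)
  then show ?thesis by (simp add: fejer_def ftp)
qed

lemma fejer_expand:
  assumes D: "D > 0"
  shows "of_real (fejer D t) = (\<Sum>i\<in>{- int D..int D}. of_real (tent D i) * add_char (t * of_int i))"
  using ft_tent[OF D, of t] tent_outside[OF D] by (subst (asm) ft_eq_sum[of "{- int D..int D}"]) auto

lemma sum_tent: "D > 0 \<Longrightarrow> (\<Sum>i\<in>{- int D..int D}. tent D i) = real D"
proof -
  assume D: "D > 0"
  have "complex_of_real (real D) = of_real (\<Sum>i\<in>{- int D..int D}. tent D i)"
    using fejer_expand[OF D, of 0] by simp
  then show ?thesis by (simp only: of_real_eq_iff)
qed

lemma fejer_le: "D > 0 \<Longrightarrow> fejer D t \<le> real D"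
proof -
  assume D: "D > 0"
  have "cmod (of_real (fejer D t)) \<le> (\<Sum>i\<in>{- int D..int D}. tent D i)"
    unfolding fejer_expand[OF D] by (rule order_trans[OF norm_sum]) (simp add: norm_mult)
  then show ?thesis using sum_tent[OF D] by simp
qed

text \<open>Integer shifts cost nothing, as \<open>fejer D\<close> has period 1. The three-term
  argument matches what Dirichlet approximation supplies: \<open>u * \<theta>\<close> is an integer
  plus a small error.\<close>

lemma fejer_lipschitz_int:
  assumes D: "D > 0"
  shows "\<bar>fejer D (s + of_int k + \<epsilon>) - fejer D s\<bar> \<le> 2 * pi * (real D)\<^sup>2 * \<bar>\<epsilon>\<bar>"
proof -
  have per: "add_char ((s + of_int k + \<epsilon>) * of_int i) = add_char ((s + \<epsilon>) * of_int i)" for i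
  proof -
    have "(s + of_int k + \<epsilon>) * of_int i = (s + \<epsilon>) * of_int i + of_int (k * i)" by (simp add: algebra_simps)
    then show ?thesis by (simp only: add_char_add add_char_of_int mult_1_right)
  qed
  have "\<bar>fejer D (s + of_int k + \<epsilon>) - fejer D s\<bar> = cmod (of_real (fejer D (s + of_int k + \<epsilon>)) - of_real (fejer D s))"
    by (metis norm_of_real of_real_diff)
  also have "\<dots> = cmod (\<Sum>i\<in>{- int D..int D}. of_real (tent D i) *
      (add_char ((s + \<epsilon>) * of_int i) - add_char (s * of_int i)))"
    unfolding fejer_expand[OF D] per by (simp add: sum_subtractf right_diff_distrib)
  also have "\<dots> \<le> (\<Sum>i\<in>{- int D..int D}. tent D i * (2 * pi * (\<bar>\<epsilon>\<bar> * real D)))"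
  proof (rule order_trans[OF norm_sum], rule sum_mono)
    fix i assume i: "i \<in> {- int D..int D}"
    have "cmod (add_char ((s + \<epsilon>) * of_int i) - add_char (s * of_int i)) \<le> 2 * pi * \<bar>(s + \<epsilon>) * of_int i - s * of_int i\<bar>"
      by (rule norm_add_char_diff)
    also have "\<bar>(s + \<epsilon>) * of_int i - s * of_int i\<bar> = \<bar>\<epsilon>\<bar> * \<bar>of_int i\<bar>"
      by (simp add: algebra_simps abs_mult)
    also have "2 * pi * \<dots> \<le> 2 * pi * (\<bar>\<epsilon>\<bar> * real D)" using i by (intro mult_left_mono) auto
    finally show "cmod (of_real (tent D i) * (add_char ((s + \<epsilon>) * of_int i) - add_char (s * of_int i)))
        \<le> tent D i * (2 * pi * (\<bar>\<epsilon>\<bar> * real D))"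
      by (simp add: norm_mult mult_left_mono)
  qed
  also have "\<dots> = 2 * pi * (real D)\<^sup>2 * \<bar>\<epsilon>\<bar>"
    by (subst sum_distrib_right[symmetric]) (simp only: sum_tent[OF D] power2_eq_square mult_ac)
  finally show ?thesis .
qed

text \<open>Multiplying the geometric sum by \<open>1 - add_char t\<close> telescopes it to modulus
  at most 2, while \<open>1 - Re (add_char t)\<close> is half the square of
  \<open>cmod (1 - add_char t)\<close>.\<close>

lemma fejer_concentrated:
  assumes D: "D > 0"
  shows "fejer D t * (1 - Re (add_char t)) \<le> 2 / real D"
proof -
  let ?z = "add_char t" and ?G = "\<Sum>j<D. add_char (t * real j)"
  have "(1 - ?z) * ?G = 1 - ?z ^ D"
    using one_diff_power_eq[of ?z D] by (simp add: add_char_power mult.commute)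
  then have "cmod (1 - ?z) * cmod ?G \<le> 2"
    by (metis norm_mult norm_triangle_ineq4 norm_one norm_power norm_add_char power_one one_add_one)
  then have "(cmod (1 - ?z) * cmod ?G)\<^sup>2 \<le> 2\<^sup>2"
    by (intro power_mono) auto
  moreover have "(cmod (1 - ?z))\<^sup>2 = 2 * (1 - Re ?z)"
  proof -
    have "(cmod ?z)\<^sup>2 = 1" by simp
    then have "(Re ?z)\<^sup>2 + (Im ?z)\<^sup>2 = 1" by (simp only: cmod_power2)
    then show ?thesis unfolding cmod_power2 by (simp add: power2_eq_square algebra_simps)
  qed
  ultimately have "2 * ((1 - Re ?z) * (cmod ?G)\<^sup>2) \<le> 2 * 2"
    unfolding power_mult_distrib by (simp only: mult.assoc) simp
  then have "(1 - Re ?z) * (cmod ?G)\<^sup>2 \<le> 2" by linarith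
  then have "(1 - Re ?z) * (cmod ?G)\<^sup>2 / real D \<le> 2 / real D" by (intro divide_right_mono) auto
  then show ?thesis by (simp add: fejer_def mult.commute)
qed

text \<open>A smooth weight on a Bohr set: it favours \<open>h\<close> of size at most
  \<open>L\<close> for which all \<open>h * \<theta>\<close> are close to integers. Fejer factors,
  unlike an indicator function, keep the transform of the kernel nonnegative.\<close>

definition kern :: "nat \<Rightarrow> nat \<Rightarrow> real set \<Rightarrow> int \<Rightarrow> real" where
  "kern D L \<Theta> h = tent L h * (\<Prod>\<theta>\<in>\<Theta>. fejer D (of_int h * \<theta>))"

definition kmass :: "nat \<Rightarrow> nat \<Rightarrow> real set \<Rightarrow> real" where
  "kmass D L \<Theta> = (\<Sum>h\<in>{- int L..int L}. kern D L \<Theta> h)"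

lemma kern_nonneg [simp]: "kern D L \<Theta> h \<ge> 0"
  by (simp add: kern_def prod_nonneg)

lemma kern_0: "kern D L \<Theta> 0 = real D ^ card \<Theta>"
  by (simp add: kern_def)

lemma kern_outside: "L > 0 \<Longrightarrow> h \<notin> {- int L..int L} \<Longrightarrow> kern D L \<Theta> h = 0"
  using tent_outside[of L h] by (auto simp: kern_def)

lemma fsupp_kern: "L > 0 \<Longrightarrow> fsupp (kern D L \<Theta>)"
  by (rule fsuppI[of "{- int L..int L}"]) (auto intro: kern_outside)

lemma ft_kern_eq:
  "L > 0 \<Longrightarrow> ft (kern D L \<Theta>) \<gamma> = (\<Sum>h\<in>{- int L..int L}. of_real (kern D L \<Theta> h) * add_char (\<gamma> * of_int h))"
  by (rule ft_eq_sum) (auto intro: kern_outside)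

lemma Re_ft_kern_0: "L > 0 \<Longrightarrow> Re (ft (kern D L \<Theta>) 0) = kmass D L \<Theta>"
  by (simp add: ft_kern_eq kmass_def)

lemma kern_insert:
  "finite \<Theta> \<Longrightarrow> \<theta> \<notin> \<Theta> \<Longrightarrow> kern D L (insert \<theta> \<Theta>) h = kern D L \<Theta> h * fejer D (of_int h * \<theta>)"
  by (simp add: kern_def mult_ac)

text \<open>Expanding the new Fejer factor turns multiplication into a combination of translates of
  the transform with nonnegative coefficients. Positivity of the transform and monotonicity of the
  mass are both read off from this.\<close>

lemma ft_kern_insert:
  assumes D: "D > 0" and L: "L > 0" and \<Theta>: "finite \<Theta>" "\<theta> \<notin> \<Theta>"
  shows "ft (kern D L (insert \<theta> \<Theta>)) \<gamma>
       = (\<Sum>i\<in>{- int D..int D}. of_real (tent D i) * ft (kern D L \<Theta>) (\<gamma> + of_int i * \<theta>))"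
proof -
  have "ft (kern D L (insert \<theta> \<Theta>)) \<gamma> = (\<Sum>h\<in>{- int L..int L}. of_real (kern D L \<Theta> h) *
      (\<Sum>i\<in>{- int D..int D}. of_real (tent D i) * add_char (of_int h * \<theta> * of_int i)) * add_char (\<gamma> * of_int h))"
    by (simp only: ft_kern_eq[OF L] kern_insert[OF \<Theta>] fejer_expand[OF D, symmetric] of_real_mult)
  also have "\<dots> = (\<Sum>h\<in>{- int L..int L}. \<Sum>i\<in>{- int D..int D}.
      of_real (tent D i) * (of_real (kern D L \<Theta> h) * add_char ((\<gamma> + of_int i * \<theta>) * of_int h)))"
    unfolding sum_distrib_left sum_distrib_right
  proof (intro sum.cong refl)
    fix h i :: int
    have "add_char ((\<gamma> + of_int i * \<theta>) * of_int h) = add_char (of_int h * \<theta> * of_int i) * add_char (\<gamma> * of_int h)"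
      by (simp add: add_char_add[symmetric] algebra_simps)
    then show "of_real (kern D L \<Theta> h) * (of_real (tent D i) * add_char (of_int h * \<theta> * of_int i)) * add_char (\<gamma> * of_int h)
      = of_real (tent D i) * (of_real (kern D L \<Theta> h) * add_char ((\<gamma> + of_int i * \<theta>) * of_int h))"
      by simp
  qed
  also have "\<dots> = (\<Sum>i\<in>{- int D..int D}. of_real (tent D i) * ft (kern D L \<Theta>) (\<gamma> + of_int i * \<theta>))"
    unfolding ft_kern_eq[OF L] sum_distrib_left by (rule sum.swap)
  finally show ?thesis .
qed

lemma ft_kern_nonneg:
  assumes D: "D > 0" and L: "L > 0" and \<Theta>: "finite \<Theta>"
  shows "Im (ft (kern D L \<Theta>) \<gamma>) = 0 \<and> Re (ft (kern D L \<Theta>) \<gamma>) \<ge> 0"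
  using \<Theta>
proof (induction \<Theta> arbitrary: \<gamma>)
  case empty
  have "kern D L {} = tent L" by (auto simp: kern_def)
  then show ?case by (simp add: ft_tent[OF L])
next
  case (insert \<theta> \<Theta>)
  show ?case unfolding ft_kern_insert[OF D L insert(1,2)]
    using insert.IH by (auto intro!: sum_nonneg)
qed

text \<open>In the expansion at frequency 0 the term \<open>i = 0\<close> is the old mass and the
  others are nonnegative. This is why the mass never drops below \<open>L\<close>, uniformly in
  \<open>D\<close> and \<open>\<Theta>\<close>.\<close>

lemma kmass_insert:
  assumes D: "D > 0" and L: "L > 0" and \<Theta>: "finite \<Theta>" "\<theta> \<notin> \<Theta>"
  shows "kmass D L \<Theta> \<le> kmass D L (insert \<theta> \<Theta>)"
proof -
  have "Re (ft (kern D L (insert \<theta> \<Theta>)) 0)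
       = (\<Sum>i\<in>{- int D..int D}. tent D i * Re (ft (kern D L \<Theta>) (of_int i * \<theta>)))"
    by (simp add: ft_kern_insert[OF assms])
  also have "\<dots> \<ge> (\<Sum>i\<in>{0}. tent D i * Re (ft (kern D L \<Theta>) (of_int i * \<theta>)))"
    using ft_kern_nonneg[OF D L \<Theta>(1)] by (intro sum_mono2) auto
  finally show ?thesis using L by (simp add: Re_ft_kern_0)
qed

lemma kmass_ge:
  assumes D: "D > 0" and L: "L > 0" and \<Theta>: "finite \<Theta>"
  shows "kmass D L \<Theta> \<ge> real L"
  using \<Theta>
proof (induction \<Theta>)
  case empty
  show ?case using sum_tent[OF L] by (simp add: kmass_def kern_def)
next
  case (insert \<theta> \<Theta>)
  then show ?case using kmass_insert[OF D L insert(1,2)] by linarith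
qed

text \<open>Split off the Fejer factor of \<open>\<theta>\<close>: it pays pointwise for
  \<open>1 - Re (add_char (h * \<theta>))\<close> with a loss \<open>2 / D\<close>, and the mass of
  the remaining kernel is at most that of the full one.\<close>

lemma kern_concentrated:
  assumes D: "D > 0" and L: "L > 0" and \<Theta>: "finite \<Theta>" "\<theta> \<in> \<Theta>"
  shows "kmass D L \<Theta> - Re (ft (kern D L \<Theta>) \<theta>) \<le> 2 / real D * kmass D L \<Theta>"
proof -
  define \<Theta>' where "\<Theta>' = \<Theta> - {\<theta>}"
  have \<Theta>': "\<Theta> = insert \<theta> \<Theta>'" "finite \<Theta>'" "\<theta> \<notin> \<Theta>'" using \<Theta> by (auto simp: \<Theta>'_def)
  have "kmass D L \<Theta> - Re (ft (kern D L \<Theta>) \<theta>)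
      = (\<Sum>h\<in>{- int L..int L}. kern D L \<Theta> h * (1 - Re (add_char (of_int h * \<theta>))))"
    unfolding ft_kern_eq[OF L] kmass_def by (simp add: sum_subtractf right_diff_distrib mult.commute)
  also have "\<dots> \<le> (\<Sum>h\<in>{- int L..int L}. kern D L \<Theta>' h * (2 / real D))"
    unfolding \<Theta>'(1) kern_insert[OF \<Theta>'(2,3)] mult.assoc
    by (intro sum_mono mult_left_mono fejer_concentrated D) auto
  also have "\<dots> = 2 / real D * kmass D L \<Theta>'"
    unfolding kmass_def by (subst sum_distrib_right[symmetric]) (rule mult.commute)
  also have "\<dots> \<le> 2 / real D * kmass D L \<Theta>"
    unfolding \<Theta>'(1) by (intro mult_left_mono kmass_insert D L \<Theta>') auto
  finally show ?thesis .
qed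

text \<open>The Fourier transform of the kernel is nonnegative, so its \<open>L\<^sup>1\<close> norm is the value of the kernel at \<open>0\<close>.\<close>

lemma conv_kern_bound:
  assumes D: "D > 0" and L: "L > 0" and \<Theta>: "finite \<Theta>" and \<phi>: "fsupp \<phi>"
    and E: "\<And>t. cmod (ft \<phi> t) \<le> E"
  shows "\<bar>conv (kern D L \<Theta>) \<phi> n\<bar> \<le> E * real D ^ card \<Theta>"
proof -
  let ?K = "kern D L \<Theta>"
  have E0: "E \<ge> 0" using order_trans[OF norm_ge_zero E] .
  have fk: "fsupp ?K" by (rule fsupp_kern[OF L])
  have i1: "((\<lambda>t. ft (conv ?K \<phi>) t * add_char (- (t * of_int n))) has_integral of_real (conv ?K \<phi> n)) {0..1}"
    by (rule ft_inversion[OF fsupp_conv[OF fk \<phi>]])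
  have i2: "((\<lambda>t. ft ?K t * add_char (- (t * of_int 0))) has_integral of_real (?K 0)) {0..1}"
    by (rule ft_inversion[OF fk])
  have i3: "((\<lambda>t. E * Re (ft ?K t)) has_integral E * ?K 0) {0..1}"
    using has_integral_Re[OF i2] by (intro has_integral_mult_right) auto
  have "norm (integral {0..1} (\<lambda>t. ft (conv ?K \<phi>) t * add_char (- (t * of_int n))))
      \<le> integral {0..1} (\<lambda>t. E * Re (ft ?K t))"
  proof (rule integral_norm_bound_integral)
    fix t :: real
    have "ft ?K t = of_real (Re (ft ?K t))" "Re (ft ?K t) \<ge> 0"
      using ft_kern_nonneg[OF D L \<Theta>, of t] by (auto simp: complex_eq_iff)
    then have "cmod (ft ?K t) = Re (ft ?K t)" by (metis abs_of_nonneg norm_of_real)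
    then show "norm (ft (conv ?K \<phi>) t * add_char (- (t * of_int n))) \<le> E * Re (ft ?K t)"
      using E[of t] \<open>Re (ft ?K t) \<ge> 0\<close> E0
      by (simp add: ft_conv[OF fk \<phi>] norm_mult mult.commute mult_right_mono)
  qed (use i1 i3 in \<open>auto simp: has_integral_integrable\<close>)
  then show ?thesis
    unfolding integral_unique[OF i1] integral_unique[OF i3] by (simp add: kern_0)
qed

text \<open>The tent moves by at most \<open>\<bar>u\<bar> / L\<close>, and each Fejer factor,
  relative to its maximum \<open>D\<close>, by \<open>2 * pi * D * \<rho>\<close>.\<close>

lemma kern_almost_period:
  assumes D: "D > 0" and L: "L > 0" and \<Theta>: "finite \<Theta>"
    and u: "\<And>\<theta>. \<theta> \<in> \<Theta> \<Longrightarrow> \<exists>k::int. \<bar>of_int u * \<theta> - of_int k\<bar> \<le> \<rho>"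
  shows "\<bar>kern D L \<Theta> (h + u) - kern D L \<Theta> h\<bar>
    \<le> real D ^ card \<Theta> * (\<bar>of_int u\<bar> / real L + 2 * pi * real D * real (card \<Theta>) * \<rho>)"
proof -
  \<comment> \<open>Scaled to lie between 0 and 1, the factors allow the difference of two products
    to be bounded by the sum of the differences.\<close>
  define P where "P h = (\<Prod>\<theta>\<in>\<Theta>. fejer D (of_int h * \<theta>) / real D)" for h :: int
  have PD: "(\<Prod>\<theta>\<in>\<Theta>. fejer D (of_int h * \<theta>)) = real D ^ card \<Theta> * P h" for h :: int
    using D by (simp add: P_def prod_dividef)
  have F1: "fejer D t / real D \<le> 1" "0 \<le> fejer D t / real D" for t
    using fejer_le[OF D, of t] D by auto
  have P01: "0 \<le> P h" "P h \<le> 1" for h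
    unfolding P_def using F1 by (auto intro!: prod_nonneg prod_le_1)
  have dP: "\<bar>P (h + u) - P h\<bar> \<le> 2 * pi * real D * real (card \<Theta>) * \<rho>"
  proof -
    have "\<bar>P (h + u) - P h\<bar> \<le> (\<Sum>\<theta>\<in>\<Theta>. \<bar>fejer D (of_int (h + u) * \<theta>) / real D - fejer D (of_int h * \<theta>) / real D\<bar>)"
      using norm_prod_diff[of \<Theta> "\<lambda>\<theta>. fejer D (of_int (h + u) * \<theta>) / real D" "\<lambda>\<theta>. fejer D (of_int h * \<theta>) / real D"] F1
      by (simp add: P_def)
    also have "\<dots> \<le> (\<Sum>\<theta>\<in>\<Theta>. 2 * pi * real D * \<rho>)"
    proof (rule sum_mono)
      fix \<theta> assume "\<theta> \<in> \<Theta>"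
      then obtain k :: int where k: "\<bar>of_int u * \<theta> - of_int k\<bar> \<le> \<rho>" using u by blast
      have "of_int (h + u) * \<theta> = of_int h * \<theta> + of_int k + (of_int u * \<theta> - of_int k)" by (simp add: algebra_simps)
      then have "\<bar>fejer D (of_int (h + u) * \<theta>) - fejer D (of_int h * \<theta>)\<bar> \<le> 2 * pi * (real D)\<^sup>2 * \<bar>of_int u * \<theta> - of_int k\<bar>"
        using fejer_lipschitz_int[OF D, of "of_int h * \<theta>" k] by metis
      also have "\<dots> \<le> 2 * pi * (real D)\<^sup>2 * \<rho>" using k by (intro mult_left_mono) auto
      finally have "\<bar>fejer D (of_int (h + u) * \<theta>) - fejer D (of_int h * \<theta>)\<bar> / real D \<le> 2 * pi * (real D)\<^sup>2 * \<rho> / real D"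
        by (intro divide_right_mono) auto
      then show "\<bar>fejer D (of_int (h + u) * \<theta>) / real D - fejer D (of_int h * \<theta>) / real D\<bar> \<le> 2 * pi * real D * \<rho>"
        using D by (simp add: diff_divide_distrib[symmetric] abs_divide power2_eq_square)
    qed
    finally show ?thesis by (simp add: mult_ac)
  qed
  have "kern D L \<Theta> (h + u) - kern D L \<Theta> h
      = real D ^ card \<Theta> * ((tent L (h + u) - tent L h) * P (h + u) + tent L h * (P (h + u) - P h))"
    unfolding kern_def PD by (simp add: algebra_simps)
  also have "\<bar>\<dots>\<bar> \<le> real D ^ card \<Theta> * (\<bar>tent L (h + u) - tent L h\<bar> * 1 + 1 * \<bar>P (h + u) - P h\<bar>)"
  proof -
    have "\<bar>(tent L (h + u) - tent L h) * P (h + u) + tent L h * (P (h + u) - P h)\<bar>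
      \<le> \<bar>tent L (h + u) - tent L h\<bar> * P (h + u) + tent L h * \<bar>P (h + u) - P h\<bar>"
      using P01[of "h + u"] by (intro order_trans[OF abs_triangle_ineq]) (simp add: abs_mult)
    also have "\<dots> \<le> \<bar>tent L (h + u) - tent L h\<bar> * 1 + 1 * \<bar>P (h + u) - P h\<bar>"
      using P01 tent_le_1 by (intro add_mono mult_left_mono mult_right_mono) auto
    finally show ?thesis by (simp add: abs_mult mult_left_mono)
  qed
  also have "\<dots> \<le> real D ^ card \<Theta> * (\<bar>of_int u\<bar> / real L + 2 * pi * real D * real (card \<Theta>) * \<rho>)"
    using tent_lipschitz[OF L, of h u] dP by (intro mult_left_mono) auto
  finally show ?thesis .
qed

section \<open>Smoothing by an almost periodic kernel\<close>

definition smooth :: "nat \<Rightarrow> nat \<Rightarrow> real set \<Rightarrow> (int \<Rightarrow> real) \<Rightarrow> int \<Rightarrow> real" where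
  "smooth D L \<Theta> f n = conv (kern D L \<Theta>) f n / kmass D L \<Theta>"

lemma smooth_eq_sum:
  "L > 0 \<Longrightarrow> smooth D L \<Theta> f n = (\<Sum>h\<in>{- int L..int L}. kern D L \<Theta> h * f (n - h)) / kmass D L \<Theta>"
  unfolding smooth_def by (subst conv_eq_sum[of "{- int L..int L}"]) (auto intro: kern_outside)

lemma kmass_pos: "D > 0 \<Longrightarrow> L > 0 \<Longrightarrow> finite \<Theta> \<Longrightarrow> kmass D L \<Theta> > 0"
  using kmass_ge[of D L \<Theta>] by simp

lemma smooth_mono:
  assumes "D > 0" "L > 0" "finite \<Theta>" and "\<And>n. f n \<le> g n"
  shows "smooth D L \<Theta> f n \<le> smooth D L \<Theta> g n"
  unfolding smooth_eq_sum[OF assms(2)] using kmass_pos[OF assms(1-3)] assms(4)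
  by (intro divide_right_mono sum_mono mult_left_mono) auto

lemma smooth_const: "D > 0 \<Longrightarrow> L > 0 \<Longrightarrow> finite \<Theta> \<Longrightarrow> smooth D L \<Theta> (\<lambda>_. c) n = c"
  using kmass_pos[of D L \<Theta>] by (simp add: smooth_eq_sum sum_distrib_right[symmetric] kmass_def[symmetric])

lemma smooth_nonneg:
  assumes "D > 0" "L > 0" "finite \<Theta>" and "\<And>n. f n \<ge> 0"
  shows "smooth D L \<Theta> f n \<ge> 0"
  using smooth_mono[OF assms(1-3), of "\<lambda>_. 0" f n] assms by (simp add: smooth_const)

lemma smooth_add:
  "L > 0 \<Longrightarrow> smooth D L \<Theta> (\<lambda>n. f n + g n) n = smooth D L \<Theta> f n + smooth D L \<Theta> g n"
  by (simp add: smooth_eq_sum distrib_left sum.distrib add_divide_distrib)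

lemma fsupp_smooth: "L > 0 \<Longrightarrow> fsupp f \<Longrightarrow> fsupp (smooth D L \<Theta> f)"
  using fsupp_conv[OF fsupp_kern, of L f D \<Theta>] unfolding smooth_def
  by (rule_tac finite_subset[of _ "{n. conv (kern D L \<Theta>) f n \<noteq> 0}"]) auto

text \<open>The Fourier multiplier of the smoothing. Taking the real part loses nothing: the
  transform of the kernel is real by \<open>ft_kern_nonneg\<close>.\<close>

definition kmult :: "nat \<Rightarrow> nat \<Rightarrow> real set \<Rightarrow> real \<Rightarrow> real" where
  "kmult D L \<Theta> \<gamma> = Re (ft (kern D L \<Theta>) \<gamma>) / kmass D L \<Theta>"

lemma ft_smooth:
  assumes "D > 0" "L > 0" "finite \<Theta>" "fsupp f"
  shows "ft (smooth D L \<Theta> f) \<gamma> = of_real (kmult D L \<Theta> \<gamma>) * ft f \<gamma>"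
proof -
  have "ft (kern D L \<Theta>) \<gamma> = of_real (Re (ft (kern D L \<Theta>) \<gamma>))"
    using ft_kern_nonneg[OF assms(1-3), of \<gamma>] by (simp add: complex_eq_iff)
  moreover have "smooth D L \<Theta> f = (\<lambda>n. inverse (kmass D L \<Theta>) * conv (kern D L \<Theta>) f n)"
    by (auto simp: smooth_def divide_inverse)
  ultimately show ?thesis
    using ft_conv[OF fsupp_kern[OF assms(2)] assms(4), of D \<Theta> \<gamma>]
    by (simp add: ft_cmult kmult_def divide_inverse mult_ac)
qed

lemma kmult_01:
  assumes "D > 0" "L > 0" "finite \<Theta>"
  shows "0 \<le> kmult D L \<Theta> \<gamma>" "kmult D L \<Theta> \<gamma> \<le> 1"
proof -
  note m = kmass_pos[OF assms]
  show "0 \<le> kmult D L \<Theta> \<gamma>" using ft_kern_nonneg[OF assms, of \<gamma>] m by (simp add: kmult_def)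
  have "cmod (ft (kern D L \<Theta>) \<gamma>) \<le> kmass D L \<Theta>"
    unfolding kmass_def by (rule norm_ft_le) (auto intro: kern_outside[OF assms(2)])
  then have "Re (ft (kern D L \<Theta>) \<gamma>) \<le> kmass D L \<Theta>" using complex_Re_le_cmod order_trans by blast
  then show "kmult D L \<Theta> \<gamma> \<le> 1" using m by (simp add: kmult_def)
qed

lemma norm_ft_smooth_le:
  assumes "D > 0" "L > 0" "finite \<Theta>" "fsupp f"
  shows "cmod (ft (smooth D L \<Theta> f) \<gamma>) \<le> cmod (ft f \<gamma>)"
    and "cmod (ft f \<gamma> - ft (smooth D L \<Theta> f) \<gamma>) \<le> cmod (ft f \<gamma>)"
    and "cmod (ft f \<gamma> - ft (smooth D L \<Theta> f) \<gamma>) = (1 - kmult D L \<Theta> \<gamma>) * cmod (ft f \<gamma>)"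
proof -
  note k = kmult_01[OF assms(1-3), of \<gamma>]
  show "cmod (ft (smooth D L \<Theta> f) \<gamma>) \<le> cmod (ft f \<gamma>)"
    using k by (simp add: ft_smooth[OF assms] norm_mult mult_left_le_one_le)
  have "ft f \<gamma> - ft (smooth D L \<Theta> f) \<gamma> = of_real (1 - kmult D L \<Theta> \<gamma>) * ft f \<gamma>"
    by (simp add: ft_smooth[OF assms] left_diff_distrib)
  then show *: "cmod (ft f \<gamma> - ft (smooth D L \<Theta> f) \<gamma>) = (1 - kmult D L \<Theta> \<gamma>) * cmod (ft f \<gamma>)"
    using k by (simp only: norm_mult norm_of_real abs_of_nonneg diff_ge_0_iff_ge)
  show "cmod (ft f \<gamma> - ft (smooth D L \<Theta> f) \<gamma>) \<le> cmod (ft f \<gamma>)"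
    unfolding * using k by (simp add: mult_left_le_one_le)
qed

text \<open>\<open>kern_concentrated\<close> puts the multiplier within \<open>2 / D\<close> of 1 at
  a selected frequency, and the Lipschitz bound carries this to its neighbours. Thus the smoothing
  hardly changes the large spectrum.\<close>

lemma kmult_near:
  assumes DL: "D > 0" "L > 0" "finite \<Theta>" and \<theta>: "\<theta> \<in> \<Theta>"
  shows "1 - kmult D L \<Theta> \<gamma> \<le> 2 / real D + 2 * pi * real L * \<bar>\<gamma> - \<theta>\<bar>"
proof -
  let ?m = "kmass D L \<Theta>" and ?F = "ft (kern D L \<Theta>)"
  note m = kmass_pos[OF DL]
  have "?m - Re (?F \<theta>) \<le> 2 / real D * ?m" by (rule kern_concentrated[OF DL \<theta>])
  moreover have "Re (?F \<theta>) - Re (?F \<gamma>) \<le> 2 * pi * real L * \<bar>\<gamma> - \<theta>\<bar> * ?m"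
  proof -
    have "Re (?F \<theta>) - Re (?F \<gamma>) \<le> cmod (?F \<theta> - ?F \<gamma>)"
      using complex_Re_le_cmod[of "?F \<theta> - ?F \<gamma>"] by simp
    also have "\<dots> = cmod (?F \<gamma> - ?F \<theta>)" by (rule norm_minus_commute)
    also have "\<dots> \<le> 2 * pi * real L * \<bar>\<gamma> - \<theta>\<bar> * ?m"
      unfolding kmass_def by (rule ft_lipschitz) (auto simp: abs_le_iff intro: kern_outside[OF DL(2)])
    finally show ?thesis .
  qed
  ultimately have "?m - Re (?F \<gamma>) \<le> (2 / real D + 2 * pi * real L * \<bar>\<gamma> - \<theta>\<bar>) * ?m"
    unfolding distrib_right by linarith
  then have "(?m - Re (?F \<gamma>)) / ?m \<le> 2 / real D + 2 * pi * real L * \<bar>\<gamma> - \<theta>\<bar>"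
    using m by (simp add: pos_divide_le_eq)
  then show ?thesis using m by (simp add: kmult_def diff_divide_distrib)
qed

definition ind :: "nat \<Rightarrow> int \<Rightarrow> real" where
  "ind N n = (if n \<in> {1..int N} then 1 else 0)"

text \<open>Write the majorant as the indicator plus \<open>\<phi>\<close>. The transform of
  \<open>\<phi>\<close> is uniformly small, and averaging against the kernel turns this into a
  pointwise bound, since the kernel has nonnegative transform and mass at least
  \<open>L\<close>.\<close>

lemma smooth_upper:
  assumes DL: "D > 0" "L > 0" "finite \<Theta>"
    and \<nu>: "\<And>n. n \<notin> {1..int N} \<Longrightarrow> \<nu> n = 0" and f: "\<And>n. f n \<le> \<nu> n"
    and E: "\<And>t. cmod (ft \<nu> t - ft (ind N) t) \<le> E"
  shows "smooth D L \<Theta> f n \<le> 1 + E * real D ^ card \<Theta> / real L"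
proof -
  define \<phi> where "\<phi> n = \<nu> n - ind N n" for n
  have fs: "fsupp \<nu>" "fsupp (ind N)" "fsupp \<phi>"
    by (rule fsuppI[of "{1..int N}"]; auto simp: \<nu> ind_def \<phi>_def)+
  have E0: "E \<ge> 0" using order_trans[OF norm_ge_zero E] .
  have "cmod (ft \<phi> t) \<le> E" for t
    using ft_diff[OF fs(1,2), of t] E[of t] by (simp add: \<phi>_def[abs_def])
  then have "\<bar>conv (kern D L \<Theta>) \<phi> n\<bar> \<le> E * real D ^ card \<Theta>"
    by (rule conv_kern_bound[OF DL fs(3)])
  then have "smooth D L \<Theta> \<phi> n \<le> E * real D ^ card \<Theta> / kmass D L \<Theta>"
    unfolding smooth_def using kmass_pos[OF DL] by (intro divide_right_mono) auto
  also have "\<dots> \<le> E * real D ^ card \<Theta> / real L"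
    using kmass_ge[OF DL] DL E0 by (intro divide_left_mono) (auto intro!: mult_pos_pos kmass_pos)
  finally have 1: "smooth D L \<Theta> \<phi> n \<le> E * real D ^ card \<Theta> / real L" .
  have 2: "smooth D L \<Theta> (ind N) n \<le> 1"
    using smooth_mono[OF DL, of "ind N" "\<lambda>_. 1" n] smooth_const[OF DL] by (simp add: ind_def)
  have "smooth D L \<Theta> f n \<le> smooth D L \<Theta> (\<lambda>n. ind N n + \<phi> n) n"
    by (rule smooth_mono[OF DL]) (simp add: f \<phi>_def)
  then show ?thesis using 1 2 smooth_add[OF DL(2), of D \<Theta> "ind N" \<phi> n] by linarith
qed

text \<open>The smoothing is a weighted average of shifts of \<open>f\<close> by \<open>h\<close>
  with \<open>\<bar>h\<bar> \<le> L\<close>, so a lower bound valid for every such shift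
  survives.\<close>

lemma smooth_average:
  assumes DL: "D > 0" "L > 0" "finite \<Theta>"
    and A: "\<And>h. h \<in> {- int L..int L} \<Longrightarrow> (\<Sum>n\<in>P. f (p n - h)) \<ge> A"
  shows "(\<Sum>n\<in>P. smooth D L \<Theta> f (p n)) \<ge> A"
proof -
  have "A * kmass D L \<Theta> = (\<Sum>h\<in>{- int L..int L}. kern D L \<Theta> h * A)"
    unfolding kmass_def by (subst sum_distrib_right[symmetric]) (rule mult.commute)
  also have "\<dots> \<le> (\<Sum>h\<in>{- int L..int L}. kern D L \<Theta> h * (\<Sum>n\<in>P. f (p n - h)))"
    by (intro sum_mono mult_left_mono A) auto
  also have "\<dots> = (\<Sum>n\<in>P. \<Sum>h\<in>{- int L..int L}. kern D L \<Theta> h * f (p n - h))"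
    unfolding sum_distrib_left by (rule sum.swap)
  finally have "A \<le> (\<Sum>n\<in>P. \<Sum>h\<in>{- int L..int L}. kern D L \<Theta> h * f (p n - h)) / kmass D L \<Theta>"
    using kmass_pos[OF DL] by (simp add: pos_le_divide_eq)
  then show ?thesis by (simp add: smooth_eq_sum[OF DL(2)] sum_divide_distrib)
qed

text \<open>Moves the shift from \<open>f\<close> to the kernel, so that the almost periods of the
  smoothing come from the kernel.\<close>

lemma conv_flip:
  assumes "finite S" "\<And>n. n \<notin> S \<Longrightarrow> f n = 0" "fsupp u"
  shows "conv u f n = (\<Sum>m\<in>S. f m * u (n - m))"
proof -
  have "conv u f n = (\<Sum>h\<in>{h. u h \<noteq> 0} \<union> (\<lambda>m. n - m) ` S. u h * f (n - h))"
    using assms by (intro conv_eq_sum) auto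
  also have "\<dots> = (\<Sum>h\<in>(\<lambda>m. n - m) ` S. u h * f (n - h))"
  proof (intro sum.mono_neutral_right)
    show "\<forall>h\<in>{h. u h \<noteq> 0} \<union> (\<lambda>m. n - m) ` S - (\<lambda>m. n - m) ` S. u h * f (n - h) = 0"
    proof
      fix h assume "h \<in> {h. u h \<noteq> 0} \<union> (\<lambda>m. n - m) ` S - (\<lambda>m. n - m) ` S"
      then have "n - h \<notin> S" by (auto simp: image_iff)
      then show "u h * f (n - h) = 0" using assms by simp
    qed
  qed (use assms in auto)
  also have "\<dots> = (\<Sum>m\<in>S. f m * u (n - m))"
    by (subst sum.reindex) (auto simp: inj_on_def mult.commute)
  finally show ?thesis .
qed

lemma smooth_almost_period:
  assumes DL: "D > 0" "L > 0" "finite \<Theta>"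
    and S: "finite S" "\<And>n. n \<notin> S \<Longrightarrow> f n = 0" and f: "\<And>n. f n \<ge> 0"
    and u: "\<And>\<theta>. \<theta> \<in> \<Theta> \<Longrightarrow> \<exists>k::int. \<bar>of_int u * \<theta> - of_int k\<bar> \<le> \<rho>"
  shows "\<bar>smooth D L \<Theta> f (n + u) - smooth D L \<Theta> f n\<bar>
    \<le> (\<Sum>m\<in>S. f m) * real D ^ card \<Theta> * (\<bar>of_int u\<bar> / real L + 2 * pi * real D * real (card \<Theta>) * \<rho>) / real L"
proof -
  let ?B = "real D ^ card \<Theta> * (\<bar>of_int u\<bar> / real L + 2 * pi * real D * real (card \<Theta>) * \<rho>)"
  have B0: "?B \<ge> 0" using order_trans[OF abs_ge_zero kern_almost_period[OF DL u]] by blast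
  have c: "conv (kern D L \<Theta>) f n = (\<Sum>m\<in>S. f m * kern D L \<Theta> (n - m))" for n
    by (rule conv_flip[OF S fsupp_kern[OF DL(2)]])
  have "\<bar>conv (kern D L \<Theta>) f (n + u) - conv (kern D L \<Theta>) f n\<bar>
      = \<bar>\<Sum>m\<in>S. f m * (kern D L \<Theta> ((n - m) + u) - kern D L \<Theta> (n - m))\<bar>"
    unfolding c by (simp add: sum_subtractf right_diff_distrib algebra_simps)
  also have "\<dots> \<le> (\<Sum>m\<in>S. f m * ?B)"
  proof (rule order_trans[OF sum_abs], rule sum_mono)
    fix m
    show "\<bar>f m * (kern D L \<Theta> ((n - m) + u) - kern D L \<Theta> (n - m))\<bar> \<le> f m * ?B"
      unfolding abs_mult using f[of m] kern_almost_period[OF DL u, of "n - m"]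
      by (simp add: mult_left_mono)
  qed
  also have "\<dots> = (\<Sum>m\<in>S. f m) * ?B" by (rule sum_distrib_right[symmetric])
  finally have "\<bar>smooth D L \<Theta> f (n + u) - smooth D L \<Theta> f n\<bar> \<le> (\<Sum>m\<in>S. f m) * ?B / kmass D L \<Theta>"
    unfolding smooth_def diff_divide_distrib[symmetric] abs_divide
    using kmass_pos[OF DL] by (simp add: divide_right_mono)
  also have "\<dots> \<le> (\<Sum>m\<in>S. f m) * ?B / real L"
    using kmass_ge[OF DL] DL kmass_pos[OF DL]
    by (intro divide_left_mono mult_nonneg_nonneg[OF sum_nonneg B0] mult_pos_pos f) auto
  finally show ?thesis by (simp add: mult.assoc)
qed

section \<open>The large spectrum and the comparison of ternary counts\<close>

lemma sum_integral_cells: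
  fixes \<phi> :: "real \<Rightarrow> real" and T :: nat
  assumes T: "T > 0" and \<phi>: "continuous_on UNIV \<phi>"
  shows "(\<Sum>j<T. integral {real j / T..real (Suc j) / T} \<phi>) = integral {0..1} \<phi>"
proof -
  have "(\<Sum>j<m. integral {real j / T..real (Suc j) / T} \<phi>) = integral {0..real m / T} \<phi>" for m
  proof (induction m)
    case (Suc m)
    have "integral {0..real m / T} \<phi> + integral {real m / T..real (Suc m) / T} \<phi> = integral {0..real (Suc m) / T} \<phi>"
      using T by (intro Henstock_Kurzweil_Integration.integral_combine integrable_continuous_real continuous_on_subset[OF \<phi>])
        (auto intro!: divide_right_mono)
    then show ?case using Suc by simp
  qed simp
  from this[of T] show ?thesis using T by simp
qed

text \<open>A finite net for the large spectrum: at most one frequency per cell of length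
  \<open>1 / T\<close>, so that the number of frequencies entering the kernel can be bounded by an
  integral.\<close>

definition spectrum_grid :: "nat \<Rightarrow> real \<Rightarrow> (int \<Rightarrow> real) \<Rightarrow> real set" where
  "spectrum_grid T e f = (\<lambda>j. real j / T) ` {j. j < T \<and> (\<exists>\<gamma>\<in>{real j / T..real (Suc j) / T}. cmod (ft f \<gamma>) > e)}"

lemma finite_spectrum_grid [simp]: "finite (spectrum_grid T e f)"
  by (simp add: spectrum_grid_def)

lemma spectrum_grid_near:
  assumes T: "T > 0" and \<gamma>: "\<gamma> \<in> {0..1}" "cmod (ft f \<gamma>) > e"
  obtains \<theta> where "\<theta> \<in> spectrum_grid T e f" "\<bar>\<gamma> - \<theta>\<bar> \<le> 1 / T"
proof -
  \<comment> \<open>\<open>\<gamma> = 1\<close> belongs to the last closed cell, where the floor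
    would give the index \<open>T\<close>.\<close>
  define j where "j = (if \<gamma> = 1 then T - 1 else nat \<lfloor>\<gamma> * T\<rfloor>)"
  have j: "j < T" "real j / T \<le> \<gamma>" "\<gamma> \<le> real (Suc j) / T"
  proof -
    have "j < T \<and> real j \<le> \<gamma> * T \<and> \<gamma> * T \<le> real (Suc j)"
    proof (cases "\<gamma> = 1")
      case True
      then show ?thesis using T by (auto simp: j_def of_nat_diff)
    next
      case False
      then have g: "0 \<le> \<gamma> * T" "\<gamma> * T < T" using \<gamma> T by auto
      then have "\<lfloor>\<gamma> * T\<rfloor> < int T" "0 \<le> \<lfloor>\<gamma> * T\<rfloor>" by (simp_all add: floor_less_iff)
      then have "real j = of_int \<lfloor>\<gamma> * T\<rfloor>" "j < T" using False by (simp_all add: j_def nat_less_iff)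
      then show ?thesis by linarith
    qed
    then show "j < T" "real j / T \<le> \<gamma>" "\<gamma> \<le> real (Suc j) / T" using T by (auto simp: field_simps)
  qed
  have "real j / T \<in> spectrum_grid T e f"
    unfolding spectrum_grid_def using j \<gamma> by (intro imageI) auto
  moreover have "\<bar>\<gamma> - real j / T\<bar> \<le> 1 / T" using j by (simp add: add_divide_distrib)
  ultimately show ?thesis using that by blast
qed

text \<open>Across a cell the transform varies by at most
  \<open>2 * pi * N * (1 / T) * (2 * N)\<close>, which the condition on \<open>T\<close> makes at
  most \<open>\<epsilon> * N / 2\<close>. So every selected cell contributes at least
  \<open>(\<epsilon> * N / 2) powr q / T\<close> to the integral; with \<open>T\<close> proportional
  to \<open>N\<close> their number is bounded independently of \<open>N\<close>.\<close>

lemma card_spectrum_grid: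
  fixes q K \<epsilon> :: real
  assumes f: "\<And>n. n \<notin> {1..int N} \<Longrightarrow> f n = 0" "\<And>n. f n \<ge> 0"
    and mass: "(\<Sum>n\<in>{1..int N}. f n) \<le> 2 * N" and q: "q > 0" and \<epsilon>: "\<epsilon> > 0" and N: "N > 0"
    and T: "T > 0" "real T \<ge> 8 * pi * N / \<epsilon>"
    and Lq: "integral {0..1} (\<lambda>\<gamma>. cmod (ft f \<gamma>) powr q) \<le> K * N powr (q - 1)"
  shows "card (spectrum_grid T (\<epsilon> * N) f) \<le> K * (2 / \<epsilon>) powr q * (T / N)"
proof -
  define J where "J = {j. j < T \<and> (\<exists>\<gamma>\<in>{real j / T..real (Suc j) / T}. cmod (ft f \<gamma>) > \<epsilon> * N)}"
  let ?\<phi> = "\<lambda>\<gamma>. cmod (ft f \<gamma>) powr q"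
  have cont: "continuous_on UNIV ?\<phi>"
    using q by (intro continuous_intros continuous_on_powr') auto
  have cell: "integral {real j / T..real (Suc j) / T} ?\<phi> \<ge> 1 / T * (\<epsilon> * N / 2) powr q" if j: "j \<in> J" for j
  proof -
    obtain \<gamma>0 where g0: "\<gamma>0 \<in> {real j / T..real (Suc j) / T}" "cmod (ft f \<gamma>0) > \<epsilon> * N"
      using j by (auto simp: J_def)
    have big: "cmod (ft f \<gamma>) \<ge> \<epsilon> * N / 2" if g: "\<gamma> \<in> {real j / T..real (Suc j) / T}" for \<gamma>
    proof -
      have d: "\<bar>\<gamma>0 - \<gamma>\<bar> \<le> 1 / T" using g g0 by (auto simp: add_divide_distrib abs_le_iff)
      have "cmod (ft f \<gamma>0 - ft f \<gamma>) \<le> 2 * pi * real N * \<bar>\<gamma>0 - \<gamma>\<bar> * (\<Sum>n\<in>{1..int N}. f n)"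
        by (rule ft_lipschitz) (auto simp: f)
      also have "\<dots> \<le> 2 * pi * real N * (1 / T) * (2 * N)"
        using d mass f by (intro mult_mono sum_nonneg) auto
      also have "\<dots> = (8 * pi * N / \<epsilon>) * (\<epsilon> * N / 2) / T" using \<epsilon> by (simp add: field_simps)
      also have "\<dots> \<le> T * (\<epsilon> * N / 2) / T"
        using T \<epsilon> by (intro divide_right_mono mult_right_mono) auto
      also have "\<dots> = \<epsilon> * N / 2" using T by simp
      finally show ?thesis using g0(2) norm_triangle_ineq2[of "ft f \<gamma>0" "ft f \<gamma>"] by simp
    qed
    have "integral {real j / T..real (Suc j) / T} (\<lambda>_. (\<epsilon> * N / 2) powr q) \<le> integral {real j / T..real (Suc j) / T} ?\<phi>"
      using big q \<epsilon> by (intro integral_le powr_mono2 integrable_continuous_real continuous_on_subset[OF cont]) auto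
    moreover have "integral {real j / T..real (Suc j) / T} (\<lambda>_. (\<epsilon> * N / 2) powr q) = 1 / T * (\<epsilon> * N / 2) powr q"
      using T by (simp add: divide_right_mono add_divide_distrib)
    ultimately show ?thesis by linarith
  qed
  have fin: "finite J" by (simp add: J_def)
  have "card J * (1 / T * (\<epsilon> * N / 2) powr q) \<le> (\<Sum>j\<in>J. integral {real j / T..real (Suc j) / T} ?\<phi>)"
    using sum_mono[of J "\<lambda>_. 1 / T * (\<epsilon> * N / 2) powr q", OF cell] by simp
  also have "\<dots> \<le> (\<Sum>j<T. integral {real j / T..real (Suc j) / T} ?\<phi>)"
  proof (intro sum_mono2)
    show "J \<subseteq> {..<T}" by (auto simp: J_def)
    fix j
    show "0 \<le> integral {real j / T..real (Suc j) / T} ?\<phi>"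
      by (intro integral_nonneg integrable_continuous_real continuous_on_subset[OF cont]) auto
  qed auto
  also have "\<dots> = integral {0..1} ?\<phi>" by (rule sum_integral_cells[OF T(1) cont])
  also have "\<dots> \<le> K * N powr (q - 1)" by (rule Lq)
  finally have main: "card J * (1 / T * (\<epsilon> * N / 2) powr q) \<le> K * N powr (q - 1)" .
  have e: "(\<epsilon> * N / 2) powr q = (N powr (q - 1) * N) / (2 / \<epsilon>) powr q"
  proof -
    have "(\<epsilon> * N / 2) powr q = (N / (2 / \<epsilon>)) powr q" by (simp add: mult.commute)
    also have "\<dots> = N powr q / (2 / \<epsilon>) powr q" using \<epsilon> by (intro powr_divide)
    also have "N powr q = N powr (q - 1) * N" using N by (simp add: powr_diff)
    finally show ?thesis .
  qed
  have "card J \<le> K * (2 / \<epsilon>) powr q * (T / N)"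
  proof -
    have pos: "N powr (q - 1) > 0" "(2 / \<epsilon>) powr q > 0" "real T > 0" "real N > 0" using N \<epsilon> T by auto
    have "card J * N * N powr (q - 1) = card J * (1 / T * (\<epsilon> * N / 2) powr q) * ((2 / \<epsilon>) powr q * T)"
      unfolding e using pos by (simp add: field_simps)
    also have "\<dots> \<le> K * N powr (q - 1) * ((2 / \<epsilon>) powr q * T)"
      using main pos by (intro mult_right_mono) auto
    finally have "(card J * N) * N powr (q - 1) \<le> (K * (2 / \<epsilon>) powr q * T) * N powr (q - 1)" by (simp add: mult_ac)
    then have "card J * N \<le> K * (2 / \<epsilon>) powr q * T" using pos by (subst (asm) mult_le_cancel_right) auto
    then show ?thesis using pos by (simp add: pos_le_divide_eq)
  qed
  moreover have "card (spectrum_grid T (\<epsilon> * N) f) \<le> card J"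
    unfolding spectrum_grid_def J_def[symmetric] by (rule card_image_le[OF fin])
  ultimately show ?thesis by (meson of_nat_le_iff order_trans)
qed

text \<open>Split \<open>x\<close> as \<open>x powr (3 - q) * x powr (q - 2)\<close>: the first
  factor is at most \<open>e powr (3 - q)\<close>, and the rest has total degree \<open>q\<close> in
  quantities at most \<open>max a (max b c)\<close>. Here \<open>q < 3\<close> makes the small bound
  help, and \<open>q > 2\<close> leaves a positive power of \<open>x\<close>.\<close>

lemma powr_triple_bound:
  fixes q e x a b c :: real
  assumes q: "2 < q" "q < 3" and x: "0 \<le> x" "x \<le> e" "x \<le> a" and b: "0 \<le> b" and c: "0 \<le> c"
  shows "x * b * c \<le> e powr (3 - q) * (a powr q + b powr q + c powr q)"
proof (cases "x = 0")
  case True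
  then show ?thesis using x b c by simp
next
  case False
  then have x0: "x > 0" using x by simp
  define m where "m = max a (max b c)"
  have m0: "m > 0" and mx: "x \<le> m" "b \<le> m" "c \<le> m" using x0 x by (auto simp: m_def)
  have "x * b * c = x powr (3 - q) * (x powr (q - 2) * b * c)"
    using x0 by (simp add: powr_add[symmetric] mult.assoc[symmetric])
  also have "\<dots> \<le> e powr (3 - q) * (m powr (q - 2) * m * m)"
    using x0 x mx q b c m0 by (intro mult_mono powr_mono2) auto
  also have "m powr (q - 2) * m * m = m powr q"
    using m0 by (simp add: powr_diff powr_numeral power2_eq_square)
  also have "m powr q \<le> a powr q + b powr q + c powr q"
    by (auto simp: m_def max_def)
  finally show ?thesis by (simp add: mult_left_mono)
qed

text \<open>The difference of the two products of transforms telescopes into three terms, each with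
  one factor \<open>ft (f i) - ft (g i)\<close> bounded both by \<open>e\<close> and by the
  transform of \<open>f i\<close>. Each term costs three integrals of size \<open>K\<close>, whence
  the 9.\<close>

lemma conv3_diff_bound:
  fixes q K e :: real
  assumes q: "2 < q" "q < 3"
    and fs: "\<And>i. i \<in> {1,2,3::nat} \<Longrightarrow> fsupp (f i)" "\<And>i. i \<in> {1,2,3} \<Longrightarrow> fsupp (g i)"
    and gf: "\<And>i \<gamma>. i \<in> {1,2,3} \<Longrightarrow> cmod (ft (g i) \<gamma>) \<le> cmod (ft (f i) \<gamma>)"
    and hf: "\<And>i \<gamma>. i \<in> {1,2,3} \<Longrightarrow> cmod (ft (f i) \<gamma> - ft (g i) \<gamma>) \<le> cmod (ft (f i) \<gamma>)"
    and he: "\<And>i \<gamma>. i \<in> {1,2,3} \<Longrightarrow> \<gamma> \<in> {0..1} \<Longrightarrow> cmod (ft (f i) \<gamma> - ft (g i) \<gamma>) \<le> e"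
    and Lq: "\<And>i. i \<in> {1,2,3} \<Longrightarrow> integral {0..1} (\<lambda>\<gamma>. cmod (ft (f i) \<gamma>) powr q) \<le> K"
  shows "\<bar>conv (f 1) (conv (f 2) (f 3)) M - conv (g 1) (conv (g 2) (g 3)) M\<bar> \<le> 9 * K * e powr (3 - q)"
proof -
  let ?F = "\<lambda>i \<gamma>. cmod (ft (f i) \<gamma>)"
  define B where "B \<gamma> = e powr (3 - q) * (?F 1 \<gamma> powr q + ?F 2 \<gamma> powr q + ?F 3 \<gamma> powr q)" for \<gamma>
  have I: "((\<lambda>t. ft (conv (u 1) (conv (u 2) (u 3))) t * add_char (- (t * of_int M)))
      has_integral of_real (conv (u 1) (conv (u 2) (u 3)) M)) {0..1}"
    if "\<And>i. i \<in> {1,2,3::nat} \<Longrightarrow> fsupp (u i)" for u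
    using that by (intro ft_inversion fsupp_conv) auto
  have D: "((\<lambda>t. ft (conv (f 1) (conv (f 2) (f 3))) t * add_char (- (t * of_int M))
      - ft (conv (g 1) (conv (g 2) (g 3))) t * add_char (- (t * of_int M)))
      has_integral (of_real (conv (f 1) (conv (f 2) (f 3)) M) - of_real (conv (g 1) (conv (g 2) (g 3)) M))) {0..1}"
    by (intro has_integral_diff I fs)
  have contq: "continuous_on {0..1} (\<lambda>\<gamma>. ?F i \<gamma> powr q)" for i
    using q by (intro continuous_intros continuous_on_powr') auto
  have Bint: "B integrable_on {0..1}"
    unfolding B_def by (intro integrable_continuous_real continuous_intros contq)
  have bound: "cmod (ft (conv (f 1) (conv (f 2) (f 3))) t * add_char (- (t * of_int M))
      - ft (conv (g 1) (conv (g 2) (g 3))) t * add_char (- (t * of_int M))) \<le> 3 * B t" if t: "t \<in> {0..1}" for t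
  proof -
    let ?f = "\<lambda>i. ft (f i) t" and ?g = "\<lambda>i. ft (g i) t"
    have "ft (conv (f 1) (conv (f 2) (f 3))) t = ?f 1 * (?f 2 * ?f 3)"
      "ft (conv (g 1) (conv (g 2) (g 3))) t = ?g 1 * (?g 2 * ?g 3)"
      using fs by (simp_all add: ft_conv fsupp_conv)
    then have "cmod (ft (conv (f 1) (conv (f 2) (f 3))) t * add_char (- (t * of_int M))
      - ft (conv (g 1) (conv (g 2) (g 3))) t * add_char (- (t * of_int M)))
      = cmod (?f 1 * (?f 2 * ?f 3) - ?g 1 * (?g 2 * ?g 3))"
      by (simp add: left_diff_distrib[symmetric] norm_mult)
    also have "?f 1 * (?f 2 * ?f 3) - ?g 1 * (?g 2 * ?g 3)
        = (?f 1 - ?g 1) * ?f 2 * ?f 3 + (?f 2 - ?g 2) * ?g 1 * ?f 3 + (?f 3 - ?g 3) * ?g 1 * ?g 2"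
      by (simp add: algebra_simps)
    also have "cmod \<dots> \<le> cmod (?f 1 - ?g 1) * cmod (?f 2) * cmod (?f 3)
        + cmod (?f 2 - ?g 2) * cmod (?g 1) * cmod (?f 3) + cmod (?f 3 - ?g 3) * cmod (?g 1) * cmod (?g 2)"
      by (intro order_trans[OF norm_triangle_ineq] add_mono) (simp_all add: norm_mult)
    also have "\<dots> \<le> cmod (?f 1 - ?g 1) * cmod (?f 2) * cmod (?f 3)
        + cmod (?f 2 - ?g 2) * cmod (?f 1) * cmod (?f 3) + cmod (?f 3 - ?g 3) * cmod (?f 1) * cmod (?f 2)"
      using gf[of 1 t] gf[of 2 t] by (intro add_mono mult_mono) auto
    also have "\<dots> \<le> B t + B t + B t"
    proof (intro add_mono)
      show "cmod (?f 1 - ?g 1) * cmod (?f 2) * cmod (?f 3) \<le> B t"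
        unfolding B_def using he[of 1 t] hf[of 1 t] t by (intro powr_triple_bound q) auto
      have "cmod (?f 2 - ?g 2) * cmod (?f 1) * cmod (?f 3)
          \<le> e powr (3 - q) * (?F 2 t powr q + ?F 1 t powr q + ?F 3 t powr q)"
        using he[of 2 t] hf[of 2 t] t by (intro powr_triple_bound q) auto
      then show "cmod (?f 2 - ?g 2) * cmod (?f 1) * cmod (?f 3) \<le> B t" by (simp add: B_def algebra_simps)
      have "cmod (?f 3 - ?g 3) * cmod (?f 1) * cmod (?f 2)
          \<le> e powr (3 - q) * (?F 3 t powr q + ?F 1 t powr q + ?F 2 t powr q)"
        using he[of 3 t] hf[of 3 t] t by (intro powr_triple_bound q) auto
      then show "cmod (?f 3 - ?g 3) * cmod (?f 1) * cmod (?f 2) \<le> B t" by (simp add: B_def algebra_simps)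
    qed
    finally show ?thesis by simp
  qed
  have "\<bar>conv (f 1) (conv (f 2) (f 3)) M - conv (g 1) (conv (g 2) (g 3)) M\<bar>
      = cmod (of_real (conv (f 1) (conv (f 2) (f 3)) M) - of_real (conv (g 1) (conv (g 2) (g 3)) M))"
    by (metis norm_of_real of_real_diff)
  also have "\<dots> \<le> integral {0..1} (\<lambda>t. 3 * B t)"
    unfolding integral_unique[OF D, symmetric]
    using bound D Bint by (intro integral_norm_bound_integral) (auto simp: has_integral_integrable)
  also have "\<dots> = 3 * (e powr (3 - q) * (integral {0..1} (\<lambda>\<gamma>. ?F 1 \<gamma> powr q)
      + integral {0..1} (\<lambda>\<gamma>. ?F 2 \<gamma> powr q) + integral {0..1} (\<lambda>\<gamma>. ?F 3 \<gamma> powr q)))"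
    unfolding B_def integral_mult_right
    by (simp add: integral_add integrable_add integrable_continuous_real contq)
  also have "\<dots> \<le> 3 * (e powr (3 - q) * (K + K + K))"
    by (intro mult_left_mono add_mono Lq) auto
  finally show ?thesis by (simp add: algebra_simps)
qed

section \<open>A sumset inequality for slowly varying functions\<close>

lemma periodic_mod:
  fixes u :: "int \<Rightarrow> 'a" and Q :: int
  assumes per: "\<And>m. u (m + Q) = u m"
  shows "u (m mod Q) = u m"
proof -
  have pern: "u (m + int n * Q) = u m" for m n
  proof (induction n)
    case (Suc n)
    have "u (m + int (Suc n) * Q) = u ((m + int n * Q) + Q)" by (simp add: algebra_simps)
    then show ?case using per Suc by simp
  qed simp
  show ?thesis
  proof (cases "m div Q \<ge> 0")
    case True
    then show ?thesis using pern[of "m mod Q" "nat (m div Q)"] by simp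
  next
    case False
    then have "m + int (nat (- (m div Q))) * Q = m mod Q"
      by (simp add: minus_div_mult_eq_mod[symmetric] algebra_simps)
    then show ?thesis using pern[of m "nat (- (m div Q))"] by metis
  qed
qed

lemma sum_periodic_shift:
  fixes u :: "int \<Rightarrow> real" and Q j :: int
  assumes per: "\<And>m. u (m + Q) = u m" and Q: "Q > 0"
  shows "(\<Sum>m\<in>{0..<Q}. u (m + j)) = (\<Sum>m\<in>{0..<Q}. u m)"
proof -
  have "(\<Sum>m\<in>{0..<Q}. u (m + j)) = (\<Sum>m\<in>{0..<Q}. u ((m + j) mod Q))"
    by (simp add: periodic_mod[of u Q, OF per])
  also have "\<dots> = (\<Sum>m\<in>{0..<Q}. u m)"
    by (rule sum.reindex_bij_witness[of _ "\<lambda>m. (m - j) mod Q" "\<lambda>m. (m + j) mod Q"])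
       (use Q in \<open>auto simp: mod_simps\<close>)
  finally show ?thesis .
qed

lemma sum_periodic_reflect:
  fixes u :: "int \<Rightarrow> real" and Q j :: int
  assumes per: "\<And>m. u (m + Q) = u m" and Q: "Q > 0"
  shows "(\<Sum>m\<in>{0..<Q}. u (j - m)) = (\<Sum>m\<in>{0..<Q}. u m)"
proof -
  have "(\<Sum>m\<in>{0..<Q}. u (j - m)) = (\<Sum>m\<in>{0..<Q}. u (m + (j - Q + 1)))"
    by (rule sum.reindex_bij_witness[of _ "\<lambda>m. Q - 1 - m" "\<lambda>m. Q - 1 - m"])
       (use Q in \<open>auto simp: algebra_simps\<close>)
  then show ?thesis using sum_periodic_shift[of u Q, OF per Q] by simp
qed

text \<open>Convolution on the integers modulo \<open>Q\<close>: a periodic \<open>b\<close>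
  represents a function on residues, while \<open>a\<close> is read on the single period
  \<open>{0..<Q}\<close>.\<close>

definition cyc_conv :: "int \<Rightarrow> (int \<Rightarrow> real) \<Rightarrow> (int \<Rightarrow> real) \<Rightarrow> int \<Rightarrow> real" where
  "cyc_conv Q a b s = (\<Sum>m\<in>{0..<Q}. a m * b (s - m))"

lemma sum_cyc_conv:
  assumes "\<And>m. b (m + Q) = b m" and "Q > 0"
  shows "(\<Sum>s\<in>{0..<Q}. cyc_conv Q a b s) = (\<Sum>m\<in>{0..<Q}. a m) * (\<Sum>m\<in>{0..<Q}. b m)"
proof -
  have "(\<Sum>s\<in>{0..<Q}. cyc_conv Q a b s) = (\<Sum>m\<in>{0..<Q}. \<Sum>s\<in>{0..<Q}. a m * b (s - m))"
    unfolding cyc_conv_def by (rule sum.swap)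
  also have "\<dots> = (\<Sum>m\<in>{0..<Q}. a m * (\<Sum>s\<in>{0..<Q}. b s))"
    using sum_periodic_shift[of b Q "- m" for m] assms by (simp add: sum_distrib_left[symmetric])
  finally show ?thesis by (simp add: sum_distrib_right)
qed

text \<open>Pigeonhole in weighted form: \<open>(1 - x) * (1 - y) \<ge> 0\<close> gives
  \<open>x * y \<ge> x + y - 1\<close> termwise.\<close>

lemma cyc_conv_ge:
  assumes "\<And>m. a m \<le> 1" "\<And>m. b m \<le> 1" and per: "\<And>m. b (m + Q) = b m" and Q: "Q > 0"
  shows "cyc_conv Q a b s \<ge> (\<Sum>m\<in>{0..<Q}. a m) + (\<Sum>m\<in>{0..<Q}. b m) - of_int Q"
proof -
  have "0 \<le> (1 - x) * (1 - y)" if "x \<le> 1" "y \<le> 1" for x y :: real using that by simp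
  then have xy: "x * y \<ge> x + y - 1" if "x \<le> 1" "y \<le> 1" for x y :: real
    using that by (simp add: algebra_simps)
  have "cyc_conv Q a b s \<ge> (\<Sum>m\<in>{0..<Q}. a m + b (s - m) - 1)"
    unfolding cyc_conv_def using assms(1,2) xy by (intro sum_mono) auto
  then show ?thesis
    using sum_periodic_reflect[of b Q s] per Q by (simp add: sum.distrib sum_subtractf)
qed

text \<open>The functional of Pollard-type sumset inequalities: a sum \<open>s\<close> represented
  more than \<open>T\<close> times counts only \<open>T\<close>. Divided by \<open>T\<close> it
  plays the role of the size of the sumset.\<close>

definition trunc_sum :: "int \<Rightarrow> (int \<Rightarrow> real) \<Rightarrow> real \<Rightarrow> (int \<Rightarrow> real) \<Rightarrow> real" where
  "trunc_sum Q a T b = (\<Sum>s\<in>{0..<Q}. min (cyc_conv Q a b s) T)"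

text \<open>The convolutions with the maximum and the minimum have the same total as those with
  \<open>b\<close> and \<open>b'\<close> but lie further apart, because \<open>a \<ge> 0\<close>; a
  concave function such as the minimum with \<open>T\<close> can only lose from this
  spreading.\<close>

lemma trunc_sum_submodular:
  assumes "\<And>m. a m \<ge> 0"
  shows "trunc_sum Q a T (\<lambda>m. max (b m) (b' m)) + trunc_sum Q a T (\<lambda>m. min (b m) (b' m))
         \<le> trunc_sum Q a T b + trunc_sum Q a T b'"
proof -
  have *: "min (cyc_conv Q a (\<lambda>m. max (b m) (b' m)) s) T + min (cyc_conv Q a (\<lambda>m. min (b m) (b' m)) s) T
        \<le> min (cyc_conv Q a b s) T + min (cyc_conv Q a b' s) T" for s
  proof -
    have "cyc_conv Q a (\<lambda>m. max (b m) (b' m)) s + cyc_conv Q a (\<lambda>m. min (b m) (b' m)) s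
        = cyc_conv Q a b s + cyc_conv Q a b' s"
      unfolding cyc_conv_def sum.distrib[symmetric]
      by (rule sum.cong) (auto simp: max_def min_def)
    moreover have "cyc_conv Q a (\<lambda>m. min (b m) (b' m)) s \<le> cyc_conv Q a b s"
      "cyc_conv Q a (\<lambda>m. min (b m) (b' m)) s \<le> cyc_conv Q a b' s"
      unfolding cyc_conv_def by (intro sum_mono mult_left_mono assms; simp)+
    ultimately show ?thesis by (auto simp: min_def)
  qed
  show ?thesis unfolding trunc_sum_def sum.distrib[symmetric] by (rule sum_mono) (rule *)
qed

lemma trunc_sum_shift:
  assumes "\<And>m. b (m + Q) = b m" and "Q > 0"
  shows "trunc_sum Q a T (\<lambda>m. b (m + 1)) = trunc_sum Q a T b"
proof -
  have "cyc_conv Q a b (s + Q) = cyc_conv Q a b s" for s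
    unfolding cyc_conv_def using assms(1)[of "s - m" for m] by (simp add: algebra_simps)
  moreover have "cyc_conv Q a (\<lambda>m. b (m + 1)) s = cyc_conv Q a b (s + 1)" for s
    unfolding cyc_conv_def by (simp add: algebra_simps)
  ultimately show ?thesis
    unfolding trunc_sum_def
    using sum_periodic_shift[of "\<lambda>s. min (cyc_conv Q a b s) T" Q 1] assms(2) by simp
qed

text \<open>Values restricted to multiples of \<open>1 / J\<close> make this class finite, so
  minimisers exist. Consecutive values differ by at most one grid step, the discrete form of
  connectedness.\<close>

definition slow_grid :: "int \<Rightarrow> nat \<Rightarrow> (int \<Rightarrow> real) set" where
  "slow_grid Q J = {b. (\<forall>m. b (m + Q) = b m) \<and> (\<forall>m. b m \<in> (\<lambda>i. real i / real J) ` {0..J})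
      \<and> (\<forall>m. \<bar>b (m + 1) - b m\<bar> \<le> 1 / real J)}"

lemma finite_slow_grid:
  assumes "Q > 0"
  shows "finite (slow_grid Q J)"
proof -
  let ?V = "(\<lambda>i. real i / real J) ` {0..J}"
  let ?F = "PiE {0..<Q} (\<lambda>_. ?V)"
  have "slow_grid Q J \<subseteq> (\<lambda>f m. f (m mod Q)) ` ?F"
  proof
    fix b assume b: "b \<in> slow_grid Q J"
    then have per: "\<And>m. b (m + Q) = b m" by (auto simp: slow_grid_def)
    have pmod: "b (m mod Q) = b m" for m by (rule periodic_mod[of b Q, OF per])
    have "b = (\<lambda>m. restrict b {0..<Q} (m mod Q))"
      using assms pmod by (auto simp: fun_eq_iff)
    moreover have "restrict b {0..<Q} \<in> ?F" using b by (auto simp: slow_grid_def)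
    ultimately show "b \<in> (\<lambda>f m. f (m mod Q)) ` ?F" by blast
  qed
  then show ?thesis by (rule finite_subset) (intro finite_imageI finite_PiE; simp)
qed

lemma slow_grid_max_min:
  assumes "b \<in> slow_grid Q J" "b' \<in> slow_grid Q J"
  shows "(\<lambda>m. max (b m) (b' m)) \<in> slow_grid Q J" "(\<lambda>m. min (b m) (b' m)) \<in> slow_grid Q J"
proof -
  have s: "\<bar>b (m + 1) - b m\<bar> \<le> 1 / real J" "\<bar>b' (m + 1) - b' m\<bar> \<le> 1 / real J" for m
    using assms by (auto simp: slow_grid_def)
  have "\<bar>max (b (m + 1)) (b' (m + 1)) - max (b m) (b' m)\<bar> \<le> 1 / real J"
       "\<bar>min (b (m + 1)) (b' (m + 1)) - min (b m) (b' m)\<bar> \<le> 1 / real J" for m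
    using s[of m] by (auto simp: max_def min_def abs_le_iff)
  then show "(\<lambda>m. max (b m) (b' m)) \<in> slow_grid Q J" "(\<lambda>m. min (b m) (b' m)) \<in> slow_grid Q J"
    using assms by (auto simp: slow_grid_def max_def min_def)
qed

lemma slow_grid_shift: "b \<in> slow_grid Q J \<Longrightarrow> (\<lambda>m. b (m + 1)) \<in> slow_grid Q J"
proof -
  assume b: "b \<in> slow_grid Q J"
  then have "b (m + 1 + Q) = b (m + 1)" for m unfolding slow_grid_def by blast
  then have "b (m + Q + 1) = b (m + 1)" for m by (metis add.commute add.left_commute)
  moreover have "\<bar>b (m + 1 + 1) - b (m + 1)\<bar> \<le> 1 / real J" for m
    using b unfolding slow_grid_def by blast
  ultimately show ?thesis using b by (auto simp: slow_grid_def)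
qed

lemma slow_grid_bounds:
  assumes "b \<in> slow_grid Q J"
  shows "0 \<le> b m" "b m \<le> 1"
proof -
  obtain i where "i \<le> J" "b m = real i / real J" using assms unfolding slow_grid_def by fastforce
  then show "0 \<le> b m" "b m \<le> 1" by (auto simp: divide_le_eq_1)
qed

text \<open>Submodularity makes the infimum of \<open>trunc_sum\<close> (minus a linear term) over functions of given
  mean essentially a concave function of that mean: a nonconstant slowly varying function can be
  traded, via its translate by one, for a pair of functions whose means are slightly smaller and
  slightly larger. So the infimum is controlled by constants and by the two ends of the range.\<close>

lemma trunc_sum_lower_mid:
  fixes a b :: "int \<Rightarrow> real" and Q :: int and t \<alpha> :: real and J :: nat
  assumes Q: "Q > 0" and J: "J > 0"
    and a01: "\<And>m. 0 \<le> a m" "\<And>m. a m \<le> 1"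
    and al: "(\<Sum>m\<in>{0..<Q}. a m) = \<alpha> * Q"
    and t: "0 < t" "t \<le> \<alpha>"
    and b: "b \<in> slow_grid Q J"
    and be: "(\<Sum>m\<in>{0..<Q}. b m) \<ge> t * Q" "(\<Sum>m\<in>{0..<Q}. b m) \<le> (1 + t - \<alpha>) * Q"
  shows "trunc_sum Q a (t * Q) b - t * Q * (\<Sum>m\<in>{0..<Q}. b m) \<ge> (t * (\<alpha> - t) - 1 / J) * Q\<^sup>2"
proof -
  define S where "S b = (\<Sum>m\<in>{0..<Q}. b m)" for b :: "int \<Rightarrow> real"
  define \<Phi> where "\<Phi> b = trunc_sum Q a (t * Q) b - t * Q * S b" for b
  define X where "X = {b \<in> slow_grid Q J. t * Q \<le> S b \<and> S b \<le> (1 + t - \<alpha>) * Q}"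
  have finX: "finite X" unfolding X_def using finite_slow_grid[OF Q] by auto
  have bX: "b \<in> X" using b be by (auto simp: X_def S_def)
  then have "X \<noteq> {}" by auto
  then obtain b0 where b0: "b0 \<in> X" "\<And>c. c \<in> X \<Longrightarrow> \<Phi> b0 \<le> \<Phi> c"
    using ex_is_arg_min_if_finite[OF finX, of \<Phi>] by (auto simp: is_arg_min_linorder)
  \<comment> \<open>Among the minimisers take one of least mean. When both lattice combinations with
    its translate stay in \<open>X\<close>, the minimum is again a minimiser, hence has the same
    mean; then \<open>b1\<close> is nondecreasing and, being periodic, constant.\<close>
  define Y where "Y = {c \<in> X. \<Phi> c = \<Phi> b0}"
  have "finite Y" "Y \<noteq> {}" using finX b0 by (auto simp: Y_def)
  then obtain b1 where b1: "b1 \<in> Y" "\<And>c. c \<in> Y \<Longrightarrow> S b1 \<le> S c"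
    using ex_is_arg_min_if_finite[of Y S] by (auto simp: is_arg_min_linorder)
  have b1X: "b1 \<in> X" and m1: "\<And>c. c \<in> X \<Longrightarrow> \<Phi> b1 \<le> \<Phi> c"
    using b1(1) b0 by (auto simp: Y_def)
  have g1: "b1 \<in> slow_grid Q J" and S1: "t * Q \<le> S b1" "S b1 \<le> (1 + t - \<alpha>) * Q"
    using b1X by (auto simp: X_def)
  have per: "b1 (m + Q) = b1 m" for m using g1 by (auto simp: slow_grid_def)
  have slow: "\<bar>b1 (m + 1) - b1 m\<bar> \<le> 1 / J" for m using g1 by (auto simp: slow_grid_def)
  note bnd = slow_grid_bounds[OF g1]
  have Qr: "real_of_int Q > 0" using Q by simp
  define \<beta> where "\<beta> = S b1 / Q"
  have Sb: "S b1 = \<beta> * Q" using Qr by (simp add: \<beta>_def)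
  have \<beta>: "t \<le> \<beta>" "\<beta> \<le> 1 + t - \<alpha>"
    using S1 Qr unfolding Sb by (auto simp: mult_le_cancel_right)
  have tot: "(\<Sum>s\<in>{0..<Q}. cyc_conv Q a b1 s) = \<alpha> * \<beta> * Q\<^sup>2"
    using sum_cyc_conv[of b1 Q a] per Q al Sb by (simp add: S_def power2_eq_square)
  have cardQ: "(\<Sum>s\<in>{0..<Q}. c) = c * Q" for c :: real using Q by simp
  have key: "\<Phi> b1 \<ge> (t * (\<alpha> - t) - 1 / J) * Q\<^sup>2"
  proof -
    \<comment> \<open>Taking the minimum or maximum with the translate moves the total by at most
      \<open>Q / J\<close>. So either both stay in \<open>X\<close>, or \<open>b1\<close> is close
      to an end of the range, where the convolution exceeds the truncation level everywhere by less
      than \<open>Q / J\<close>, or falls short of it everywhere by less than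
      \<open>Q / J\<close>.\<close>
    consider (low) "S b1 - Q / J < t * Q" | (high) "S b1 + Q / J > (1 + t - \<alpha>) * Q"
      | (mid) "S b1 - Q / J \<ge> t * Q" "S b1 + Q / J \<le> (1 + t - \<alpha>) * Q" by linarith
    then show ?thesis
    proof cases
      case low
      have cb: "cyc_conv Q a b1 s \<le> S b1" for s
      proof -
        have "cyc_conv Q a b1 s \<le> (\<Sum>m\<in>{0..<Q}. b1 (s - m))"
          unfolding cyc_conv_def using a01 bnd by (intro sum_mono) (simp add: mult_left_le_one_le)
        then show ?thesis using sum_periodic_reflect[of b1 Q s] per Q by (simp add: S_def)
      qed
      have "min (cyc_conv Q a b1 s) (t * Q) \<ge> cyc_conv Q a b1 s - Q / J" for s
        using cb[of s] low J Qr by (auto simp: min_def)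
      then have "trunc_sum Q a (t * Q) b1 \<ge> (\<Sum>s\<in>{0..<Q}. cyc_conv Q a b1 s - Q / J)"
        unfolding trunc_sum_def by (intro sum_mono)
      also have "(\<Sum>s\<in>{0..<Q}. cyc_conv Q a b1 s - Q / J) = (\<alpha> * \<beta> - 1 / J) * Q\<^sup>2"
        using tot Q by (simp add: sum_subtractf power2_eq_square algebra_simps)
      finally have "\<Phi> b1 \<ge> (\<beta> * (\<alpha> - t) - 1 / J) * Q\<^sup>2"
        by (simp add: \<Phi>_def Sb power2_eq_square algebra_simps)
      moreover have "(\<beta> * (\<alpha> - t) - 1 / J) * Q\<^sup>2 \<ge> (t * (\<alpha> - t) - 1 / J) * Q\<^sup>2"
        using \<beta> t by (intro mult_right_mono diff_right_mono) auto
      ultimately show ?thesis by linarith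
    next
      case high
      have cb: "cyc_conv Q a b1 s \<ge> S b1 + \<alpha> * Q - Q" for s
        using cyc_conv_ge[of a b1 Q s, OF a01(2) bnd(2) per Q] al by (simp add: S_def)
      have "min (cyc_conv Q a b1 s) (t * Q) \<ge> t * Q - Q / J" for s
        using cb[of s] high J Qr by (auto simp: min_def algebra_simps)
      then have "trunc_sum Q a (t * Q) b1 \<ge> (\<Sum>s\<in>{0..<Q}. t * Q - Q / J)"
        unfolding trunc_sum_def by (intro sum_mono)
      also have "(\<Sum>s\<in>{0..<Q}. t * Q - Q / J) = (t - 1 / J) * Q\<^sup>2"
        using Q by (simp add: power2_eq_square algebra_simps)
      finally have "\<Phi> b1 \<ge> (t * (1 - \<beta>) - 1 / J) * Q\<^sup>2"
        by (simp add: \<Phi>_def Sb power2_eq_square algebra_simps)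
      moreover have "(t * (1 - \<beta>) - 1 / J) * Q\<^sup>2 \<ge> (t * (\<alpha> - t) - 1 / J) * Q\<^sup>2"
        using \<beta> t by (intro mult_right_mono diff_right_mono mult_left_mono) auto
      ultimately show ?thesis by linarith
    next
      case mid
      let ?b' = "\<lambda>m. b1 (m + 1)"
      have g2: "?b' \<in> slow_grid Q J" by (rule slow_grid_shift[OF g1])
      let ?mx = "\<lambda>m. max (b1 m) (?b' m)" and ?mn = "\<lambda>m. min (b1 m) (?b' m)"
      have gm: "?mx \<in> slow_grid Q J" "?mn \<in> slow_grid Q J"
        using slow_grid_max_min[OF g1 g2] by auto
      have S': "S ?b' = S b1" unfolding S_def by (rule sum_periodic_shift) (use per Q in auto)
      have Ssum: "S ?mx + S ?mn = 2 * S b1"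
      proof -
        have "S ?mx + S ?mn = S b1 + S ?b'"
          unfolding S_def sum.distrib[symmetric] by (rule sum.cong) (auto simp: max_def min_def)
        then show ?thesis using S' by simp
      qed
      have mnge: "S ?mn \<ge> S b1 - Q / J"
      proof -
        have "S ?mn \<ge> (\<Sum>m\<in>{0..<Q}. b1 m - 1 / J)"
          unfolding S_def
        proof (intro sum_mono)
          fix m show "b1 m - 1 / J \<le> ?mn m" using slow[of m] J by (auto simp: min_def abs_le_iff)
        qed
        then show ?thesis using Q by (simp add: S_def sum_subtractf)
      qed
      have mnle: "S ?mn \<le> S b1" unfolding S_def by (intro sum_mono) auto
      have inX: "?mx \<in> X" "?mn \<in> X" using gm mid Ssum mnge mnle S1 by (auto simp: X_def)
      have "\<Phi> ?mx + \<Phi> ?mn \<le> 2 * \<Phi> b1"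
      proof -
        have 1: "trunc_sum Q a (t * Q) ?mx + trunc_sum Q a (t * Q) ?mn \<le> 2 * trunc_sum Q a (t * Q) b1"
          using trunc_sum_submodular[of a Q "t * Q" b1 ?b'] a01 trunc_sum_shift[of b1 Q a "t * Q"] per Q
          by simp
        have 2: "t * Q * S ?mx + t * Q * S ?mn = 2 * (t * Q * S b1)"
          using Ssum by (metis distrib_left mult.left_commute)
        have arith: "A - x + (B - y) \<le> 2 * (C - z)" if "A + B \<le> 2 * C" "x + y = 2 * z" for A B C x y z :: real
          using that by (simp add: algebra_simps)
        show ?thesis unfolding \<Phi>_def by (rule arith[OF 1 2])
      qed
      then have "\<Phi> ?mn = \<Phi> b1" using m1[OF inX(1)] m1[OF inX(2)] by linarith
      then have "?mn \<in> Y" using inX b1(1) by (auto simp: Y_def)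
      then have "S ?mn = S b1" using b1(2) mnle by force
      then have "(\<Sum>m\<in>{0..<Q}. b1 m - ?mn m) = 0" by (simp add: S_def sum_subtractf)
      then have "\<forall>m\<in>{0..<Q}. b1 m - ?mn m = 0"
        by (subst (asm) sum_nonneg_eq_0_iff) auto
      then have le: "b1 m \<le> b1 (m + 1)" if "0 \<le> m" "m < Q" for m using that by (auto simp: min_def split: if_splits)
      have mono: "int i \<le> int n \<Longrightarrow> int n \<le> Q \<Longrightarrow> b1 (int i) \<le> b1 (int n)" for i n
      proof (induction n)
        case (Suc n)
        show ?case
        proof (cases "i = Suc n")
          case False
          then have "b1 (int i) \<le> b1 (int n)" using Suc by auto
          also have "b1 (int n) \<le> b1 (int (Suc n))"
            using le[of "int n"] Suc.prems by (simp add: add.commute)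
          finally show ?thesis .
        qed simp
      qed simp
      have const: "b1 m = b1 0" if "0 \<le> m" "m < Q" for m
      proof -
        have "b1 m \<le> b1 Q" using mono[of "nat m" "nat Q"] that by simp
        moreover have "b1 Q = b1 0" using per[of 0] by simp
        moreover have "b1 0 \<le> b1 m" using mono[of 0 "nat m"] that by simp
        ultimately show ?thesis by simp
      qed
      have "S b1 = (\<Sum>m\<in>{0..<Q}. b1 0)" unfolding S_def by (intro sum.cong refl const) auto
      then have b10: "b1 0 = \<beta>" using Sb Q by simp
      have cv: "cyc_conv Q a b1 s = \<alpha> * \<beta> * Q" for s
      proof -
        have "b1 m = \<beta>" for m
        proof -
          have "b1 m = b1 (m mod Q)" using periodic_mod[of b1 Q, OF per] by simp
          moreover have "b1 (m mod Q) = b1 0" using Q by (intro const) auto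
          ultimately show ?thesis using b10 by simp
        qed
        then show ?thesis using al by (simp add: cyc_conv_def sum_distrib_right[symmetric])
      qed
      \<comment> \<open>The convolution is now constant; the two branches of the minimum use
        \<open>t \<le> \<beta>\<close> and \<open>\<beta> \<le> 1 + t - \<alpha>\<close>
        respectively.\<close>
      have "trunc_sum Q a (t * Q) b1 = min (\<alpha> * \<beta>) t * Q\<^sup>2"
        unfolding trunc_sum_def cv using Q Qr
        by (simp add: power2_eq_square min_def mult_le_cancel_right)
      then have "\<Phi> b1 = (min (\<alpha> * \<beta>) t - t * \<beta>) * Q\<^sup>2"
        by (simp add: \<Phi>_def Sb power2_eq_square algebra_simps)
      moreover have "min (\<alpha> * \<beta>) t - t * \<beta> \<ge> t * (\<alpha> - t) - 1 / J"
      proof (cases "\<alpha> * \<beta> \<le> t")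
        case True
        have "\<beta> * (\<alpha> - t) \<ge> t * (\<alpha> - t)" using \<beta> t by (intro mult_right_mono) auto
        moreover have "\<alpha> * \<beta> - t * \<beta> = \<beta> * (\<alpha> - t)" by (simp add: algebra_simps)
        moreover have "0 \<le> 1 / real J" by simp
        ultimately show ?thesis using True by linarith
      next
        case False
        have "t * (1 - \<beta>) \<ge> t * (\<alpha> - t)" using \<beta> t by (intro mult_left_mono) auto
        moreover have "t - t * \<beta> = t * (1 - \<beta>)" by (simp add: algebra_simps)
        moreover have "0 \<le> 1 / real J" by simp
        ultimately show ?thesis using False by linarith
      qed
      ultimately show ?thesis by (simp add: mult_right_mono)
    qed
  qed
  have "\<Phi> b1 \<le> \<Phi> b" by (rule m1[OF bX])
  then show ?thesis using key unfolding \<Phi>_def S_def by linarith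
qed


text \<open>A popular-sums analogue of the bound \<open>\<alpha> + \<beta>\<close> for sumsets in
  the circle, with \<open>1 / J\<close> lost to discretisation. Beyond
  \<open>\<beta> = 1 + t - \<alpha>\<close> pigeonhole alone lifts every convolution value to the
  level \<open>t * Q\<close>.\<close>

lemma trunc_sum_lower:
  fixes a b :: "int \<Rightarrow> real" and Q :: int and t \<alpha> \<beta> :: real and J :: nat
  assumes Q: "Q > 0" and J: "J > 0"
    and a01: "\<And>m. 0 \<le> a m" "\<And>m. a m \<le> 1"
    and al: "(\<Sum>m\<in>{0..<Q}. a m) = \<alpha> * Q"
    and t: "0 < t" "t \<le> \<alpha>"
    and b: "b \<in> slow_grid Q J"
    and be: "(\<Sum>m\<in>{0..<Q}. b m) = \<beta> * Q" "t \<le> \<beta>"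
  shows "trunc_sum Q a (t * Q) b \<ge> (t * min (\<alpha> + \<beta> - t) 1 - 1 / J) * Q\<^sup>2"
proof (cases "\<beta> \<le> 1 + t - \<alpha>")
  case True
  have Qr: "real_of_int Q > 0" using Q by simp
  have "trunc_sum Q a (t * Q) b - t * Q * (\<Sum>m\<in>{0..<Q}. b m) \<ge> (t * (\<alpha> - t) - 1 / J) * Q\<^sup>2"
    by (rule trunc_sum_lower_mid[OF Q J a01 al t b]) (use be True Qr in \<open>auto intro: mult_right_mono\<close>)
  moreover have "min (\<alpha> + \<beta> - t) 1 = \<alpha> + \<beta> - t" using True by simp
  ultimately show ?thesis unfolding be(1) by (simp add: power2_eq_square algebra_simps)
next
  case False
  have Qr: "real_of_int Q > 0" using Q by simp
  have per: "b (m + Q) = b m" for m using b by (auto simp: slow_grid_def)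
  note bnd = slow_grid_bounds[OF b]
  have cb: "cyc_conv Q a b s \<ge> t * Q" for s
  proof -
    have "cyc_conv Q a b s \<ge> (\<alpha> + \<beta> - 1) * Q"
      using cyc_conv_ge[of a b Q s, OF a01(2) bnd(2) per Q] al be by (simp add: algebra_simps)
    moreover have "(\<alpha> + \<beta> - 1) * Q \<ge> t * Q" using False Qr by (intro mult_right_mono) auto
    ultimately show ?thesis by linarith
  qed
  then have "trunc_sum Q a (t * Q) b = t * Q\<^sup>2"
    using Q by (simp add: trunc_sum_def min_absorb2 power2_eq_square)
  moreover have "min (\<alpha> + \<beta> - t) 1 = 1" using False by simp
  ultimately show ?thesis by (simp add: algebra_simps)
qed

text \<open>Truncated at \<open>\<sigma> * Q\<close>, the popular sums of \<open>a\<close> and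
  \<open>b\<close> fill more than 2/3 of the cycle and \<open>c\<close> fills more than 1/3, so they
  overlap: \<open>\<sigma> * (1/3 + 2 * \<sigma>) + \<sigma> * (2/3 + \<sigma>) - \<sigma> = 3 *
  \<sigma>\<^sup>2\<close>, before the loss \<open>1 / J\<close>. Here \<open>c\<close> is evaluated
  at the sum \<open>m + n\<close>; the application reflects the third variable.\<close>

lemma cyclic_triple_count:
  fixes a b c :: "int \<Rightarrow> real" and Q :: int and \<sigma> :: real and J :: nat
  assumes Q: "Q > 0" and \<sigma>: "\<sigma> > 0" and J: "real J \<ge> 2 / \<sigma>\<^sup>2"
    and per: "\<And>m. b (m + Q) = b m" "\<And>m. c (m + Q) = c m"
    and a01: "\<And>m. 0 \<le> a m" "\<And>m. a m \<le> 1"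
    and b01: "\<And>m. 0 \<le> b m" "\<And>m. b m \<le> 1"
    and c01: "\<And>m. 0 \<le> c m" "\<And>m. c m \<le> 1"
    and slow: "\<And>m. \<bar>b (m + 1) - b m\<bar> \<le> 1 / J"
    and mean: "(\<Sum>m\<in>{0..<Q}. a m) \<ge> (1/3 + 2 * \<sigma>) * Q" "(\<Sum>m\<in>{0..<Q}. b m) \<ge> (1/3 + 2 * \<sigma>) * Q"
      "(\<Sum>m\<in>{0..<Q}. c m) \<ge> (1/3 + 2 * \<sigma>) * Q"
  shows "(\<Sum>m\<in>{0..<Q}. \<Sum>n\<in>{0..<Q}. a m * b n * c (m + n)) \<ge> \<sigma>\<^sup>2 / 2 * Q\<^sup>2"
proof -
  have Qr: "real_of_int Q > 0" using Q by simp
  have "2 / \<sigma>\<^sup>2 > 0" using \<sigma> by simp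
  then have Jr: "real J > 0" using J by linarith
  then have J0: "J > 0" by simp
  have "(1/3 + 2 * \<sigma>) * Q \<le> (\<Sum>m\<in>{0..<Q}. 1)"
    using mean(1) a01(2) by (meson order_trans sum_mono)
  then have "(1/3 + 2 * \<sigma>) * real_of_int Q \<le> 1 * real_of_int Q" using Q by simp
  then have \<sigma>1: "\<sigma> \<le> 1/3" using Qr by (subst (asm) mult_le_cancel_right) auto
  have iJ: "1 / J \<le> \<sigma>\<^sup>2 / 2"
    using J Jr \<sigma> by (simp add: field_simps)
  have \<sigma>sq: "\<sigma>\<^sup>2 \<le> \<sigma>" using \<sigma> \<sigma>1 by (simp add: power2_eq_square mult_left_le)
  \<comment> \<open>Round \<open>b\<close> down to the grid. A step of \<open>b\<close> by at most
    \<open>1 / J\<close> moves the floor of \<open>J * b\<close> by at most one, so slow variation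
    survives.\<close>
  define b' where "b' m = real_of_int \<lfloor>J * b m\<rfloor> / J" for m
  have b'le: "b' m \<le> b m" "b' m \<ge> b m - 1 / J" for m
  proof -
    have "real_of_int \<lfloor>J * b m\<rfloor> / J \<le> J * b m / J" "(J * b m - 1) / J \<le> real_of_int \<lfloor>J * b m\<rfloor> / J"
      by (intro divide_right_mono; linarith)+
    then show "b' m \<le> b m" "b' m \<ge> b m - 1 / J" using Jr by (simp_all add: b'_def diff_divide_distrib)
  qed
  have fl: "\<bar>\<lfloor>x\<rfloor> - \<lfloor>y\<rfloor>\<bar> \<le> 1" if "\<bar>x - y\<bar> \<le> 1" for x y :: real
    using that by linarith
  have b'g: "b' \<in> slow_grid Q J"
  proof -
    have "b' m \<in> (\<lambda>i. real i / real J) ` {0..J}" for m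
    proof -
      have "0 \<le> J * b m" "J * b m \<le> J" using b01[of m] Jr by auto
      then have "0 \<le> \<lfloor>J * b m\<rfloor>" "\<lfloor>J * b m\<rfloor> \<le> int J" by (simp, linarith)
      then show ?thesis unfolding b'_def by (intro image_eqI[of _ _ "nat \<lfloor>J * b m\<rfloor>"]) auto
    qed
    moreover have "\<bar>b' (m + 1) - b' m\<bar> \<le> 1 / J" for m
    proof -
      have "\<bar>J * b (m + 1) - J * b m\<bar> = J * \<bar>b (m + 1) - b m\<bar>"
        using Jr by (simp add: abs_mult right_diff_distrib[symmetric])
      also have "\<dots> \<le> 1" using slow[of m] Jr by (simp add: field_simps)
      finally have "\<bar>real_of_int \<lfloor>J * b (m + 1)\<rfloor> - real_of_int \<lfloor>J * b m\<rfloor>\<bar> \<le> 1"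
        using fl by (metis of_int_1 of_int_abs of_int_diff of_int_le_iff)
      then show ?thesis using Jr by (simp add: b'_def diff_divide_distrib[symmetric] divide_right_mono)
    qed
    ultimately show ?thesis using per(1) by (auto simp: slow_grid_def b'_def)
  qed
  define \<alpha> where "\<alpha> = (\<Sum>m\<in>{0..<Q}. a m) / Q"
  define \<beta> where "\<beta> = (\<Sum>m\<in>{0..<Q}. b' m) / Q"
  have \<alpha>: "\<alpha> \<ge> 1/3 + 2 * \<sigma>" "(\<Sum>m\<in>{0..<Q}. a m) = \<alpha> * Q"
    using mean(1) Qr by (auto simp: \<alpha>_def field_simps)
  have "(\<Sum>m\<in>{0..<Q}. b' m) \<ge> (\<Sum>m\<in>{0..<Q}. b m - 1 / J)"
    by (intro sum_mono b'le)
  then have "(\<Sum>m\<in>{0..<Q}. b' m) \<ge> (1/3 + 2 * \<sigma> - 1 / J) * Q"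
    using mean(2) Q by (simp add: sum_subtractf algebra_simps)
  also have "(1/3 + 2 * \<sigma> - 1 / J) * Q \<ge> (1/3 + \<sigma>) * Q"
    using iJ \<sigma>sq \<sigma> Qr by (intro mult_right_mono) auto
  finally have \<beta>: "\<beta> \<ge> 1/3 + \<sigma>" "(\<Sum>m\<in>{0..<Q}. b' m) = \<beta> * Q"
    using Qr by (auto simp: \<beta>_def field_simps)
  have tr: "trunc_sum Q a (\<sigma> * Q) b' \<ge> (\<sigma> * min (\<alpha> + \<beta> - \<sigma>) 1 - 1 / J) * Q\<^sup>2"
    by (rule trunc_sum_lower[OF Q J0 a01 \<alpha>(2) _ _ b'g \<beta>(2)]) (use \<sigma> \<alpha> \<beta> in auto)
  define u where "u s = min (cyc_conv Q a b' s) (\<sigma> * Q)" for s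
  have cyc_nonneg: "cyc_conv Q a b' s \<ge> 0" for s
    unfolding cyc_conv_def using a01 slow_grid_bounds[OF b'g] by (intro sum_nonneg) auto
  have u: "0 \<le> u s" "u s \<le> \<sigma> * Q" for s
    using cyc_nonneg \<sigma> Qr by (auto simp: u_def)
  have "(\<Sum>m\<in>{0..<Q}. \<Sum>n\<in>{0..<Q}. a m * b n * c (m + n)) =
      (\<Sum>m\<in>{0..<Q}. \<Sum>s\<in>{0..<Q}. a m * b (s - m) * c s)"
  proof (rule sum.cong)
    fix m :: int
    show "(\<Sum>n\<in>{0..<Q}. a m * b n * c (m + n)) = (\<Sum>s\<in>{0..<Q}. a m * b (s - m) * c s)"
    proof -
      have "b (n + Q - m) = b (n - m)" for n using per(1)[of "n - m"] by (simp add: algebra_simps)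
      then show ?thesis
        using sum_periodic_shift[of "\<lambda>s. a m * b (s - m) * c s" Q m] per Q by (simp add: add.commute)
    qed
  qed simp
  also have "\<dots> = (\<Sum>s\<in>{0..<Q}. c s * cyc_conv Q a b s)"
    by (subst sum.swap) (simp add: cyc_conv_def sum_distrib_left mult_ac)
  also have "\<dots> \<ge> (\<Sum>s\<in>{0..<Q}. c s * u s)"
  proof (intro sum_mono mult_left_mono c01)
    fix s
    have "cyc_conv Q a b' s \<le> cyc_conv Q a b s"
      unfolding cyc_conv_def by (intro sum_mono mult_left_mono b'le a01)
    then show "u s \<le> cyc_conv Q a b s" by (simp add: u_def)
  qed
  \<comment> \<open>Pigeonhole again, now for \<open>c s \<le> 1\<close> against
    \<open>u s \<le> \<sigma> * Q\<close>.\<close>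
  also have "(\<Sum>s\<in>{0..<Q}. c s * u s) \<ge> (\<Sum>s\<in>{0..<Q}. \<sigma> * Q * c s + u s - \<sigma> * Q)"
  proof (intro sum_mono)
    fix s
    have "0 \<le> (1 - c s) * (\<sigma> * Q - u s)" using c01[of s] u[of s] by (intro mult_nonneg_nonneg) auto
    then show "\<sigma> * Q * c s + u s - \<sigma> * Q \<le> c s * u s" by (simp add: algebra_simps)
  qed
  also have "(\<Sum>s\<in>{0..<Q}. \<sigma> * Q * c s + u s - \<sigma> * Q)
      = \<sigma> * Q * (\<Sum>s\<in>{0..<Q}. c s) + trunc_sum Q a (\<sigma> * Q) b' - \<sigma> * Q\<^sup>2"
    using Q by (simp add: sum.distrib sum_subtractf sum_distrib_left u_def trunc_sum_def power2_eq_square)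
  also have "\<dots> \<ge> \<sigma> * Q * ((1/3 + 2 * \<sigma>) * Q) + (\<sigma> * (2/3 + \<sigma>) - 1 / J) * Q\<^sup>2 - \<sigma> * Q\<^sup>2"
  proof -
    \<comment> \<open>The densities give
      \<open>\<alpha> + \<beta> - \<sigma> \<ge> 2/3 + 2 * \<sigma>\<close>, and
      \<open>\<sigma> \<le> 1/3\<close> keeps \<open>2/3 + \<sigma>\<close> at most 1.\<close>
    have "2/3 + \<sigma> \<le> min (\<alpha> + \<beta> - \<sigma>) 1" using \<alpha> \<beta> \<sigma> \<sigma>1 by auto
    then have "(\<sigma> * (2/3 + \<sigma>) - 1 / J) * Q\<^sup>2 \<le> (\<sigma> * min (\<alpha> + \<beta> - \<sigma>) 1 - 1 / J) * Q\<^sup>2"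
      using \<sigma> by (intro mult_right_mono diff_right_mono mult_left_mono) auto
    moreover have "\<sigma> * Q * ((1/3 + 2 * \<sigma>) * Q) \<le> \<sigma> * Q * (\<Sum>s\<in>{0..<Q}. c s)"
      using mean(3) \<sigma> Qr by (intro mult_left_mono) auto
    ultimately show ?thesis using tr by linarith
  qed
  also have "\<sigma> * Q * ((1/3 + 2 * \<sigma>) * Q) + (\<sigma> * (2/3 + \<sigma>) - 1 / J) * Q\<^sup>2 - \<sigma> * Q\<^sup>2
      = (3 * \<sigma>\<^sup>2 - 1 / J) * Q\<^sup>2"
    by (simp add: power2_eq_square algebra_simps)
  also have "\<dots> \<ge> \<sigma>\<^sup>2 / 2 * Q\<^sup>2"
  proof (intro mult_right_mono)
    show "\<sigma>\<^sup>2 / 2 \<le> 3 * \<sigma>\<^sup>2 - 1 / J" using iJ zero_le_power2[of \<sigma>] by linarith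
  qed simp
  finally show ?thesis by simp
qed

section \<open>Counting with almost periodic weights\<close>

text \<open>Three progressions of length \<open>Q\<close> and difference \<open>d\<close> are glued
  into cycles. For \<open>g2\<close> the two almost periods together give slow variation also across
  the seam; for \<open>g3\<close> the long period \<open>d * Q\<close> undoes the wrap of
  \<open>m + n\<close>; \<open>g1\<close> is read on one period only.\<close>

lemma local_count:
  fixes g1 g2 g3 :: "int \<Rightarrow> real" and d Q a1 a2 a3 :: int and s \<omega> :: real
  assumes Q: "Q > 0" and s: "s > 0" "s \<le> 1" and \<omega>: "\<omega> \<le> s\<^sup>2 / 8"
    and g1: "\<And>n. 0 \<le> g1 n" "\<And>n. g1 n \<le> 1"
    and g2: "\<And>n. 0 \<le> g2 n" "\<And>n. g2 n \<le> 1"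
    and g3: "\<And>n. 0 \<le> g3 n" "\<And>n. g3 n \<le> 1"
    and d2: "\<And>n. \<bar>g2 (n + d) - g2 n\<bar> \<le> \<omega>" "\<And>n. \<bar>g2 (n + d * Q) - g2 n\<bar> \<le> \<omega>"
    and d3: "\<And>n. \<bar>g3 (n + d * Q) - g3 n\<bar> \<le> \<omega>"
    and m1: "(\<Sum>m\<in>{0..<Q}. g1 (a1 + d * m)) \<ge> (1/3 + 2 * s) * Q"
    and m2: "(\<Sum>m\<in>{0..<Q}. g2 (a2 + d * m)) \<ge> (1/3 + 2 * s) * Q"
    and m3: "(\<Sum>m\<in>{0..<Q}. g3 (a3 - d * m)) \<ge> (1/3 + 2 * s) * Q"
  shows "(\<Sum>m\<in>{0..<Q}. \<Sum>n\<in>{0..<Q}. g1 (a1 + d * m) * g2 (a2 + d * n) * g3 (a3 - d * (m + n)))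
    \<ge> s\<^sup>2 / 4 * (real_of_int Q)\<^sup>2"
proof -
  define a where "a m = g1 (a1 + d * m)" for m
  define b where "b m = g2 (a2 + d * (m mod Q))" for m
  define c where "c m = g3 (a3 - d * (m mod Q))" for m
  \<comment> \<open>The lower bound \<open>2 / s\<^sup>2\<close> on \<open>J\<close> feeds the
    cyclic count, the upper bound \<open>4 / s\<^sup>2\<close> ensures
    \<open>2 * \<omega> \<le> 1 / J\<close>.\<close>
  define J where "J = nat \<lceil>2 / s\<^sup>2\<rceil>"
  have s2: "0 < s\<^sup>2" "s\<^sup>2 \<le> 1" using s by (auto simp: power_le_one)
  have w0: "0 \<le> \<omega>" using d3[of 0] by linarith
  have J: "real J \<ge> 2 / s\<^sup>2" by (simp add: J_def)
  have J': "real J \<le> 4 / s\<^sup>2"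
  proof -
    have "real J \<le> 2 / s\<^sup>2 + 1" using s2 by (simp add: J_def)
    also have "\<dots> \<le> 4 / s\<^sup>2"
    proof -
      have "1 \<le> 1 / s\<^sup>2" using s2 by simp
      moreover have "4 / s\<^sup>2 = 2 / s\<^sup>2 + 2 * (1 / s\<^sup>2)" by simp
      ultimately show ?thesis by linarith
    qed
    finally show ?thesis .
  qed
  have Jp: "real J > 0" using J s2 by (meson divide_pos_pos less_le_trans zero_less_numeral)
  have iJ: "2 * \<omega> \<le> 1 / J"
  proof -
    have "2 * \<omega> \<le> s\<^sup>2 / 4" using \<omega> by simp
    also have "\<dots> \<le> 1 / J" using J' s2 Jp by (simp add: field_simps)
    finally show ?thesis .
  qed
  have slow: "\<bar>b (m + 1) - b m\<bar> \<le> 1 / J" for m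
  proof -
    define r where "r = m mod Q"
    have r: "0 \<le> r" "r < Q" using Q by (auto simp: r_def)
    have m1: "(m + 1) mod Q = (r + 1) mod Q" by (simp add: r_def mod_simps)
    have "\<bar>b (m + 1) - b m\<bar> \<le> 2 * \<omega>"
    proof (cases "r + 1 < Q")
      case True
      then have "b (m + 1) = g2 ((a2 + d * r) + d)" using r m1 by (simp add: b_def algebra_simps)
      then show ?thesis using d2(1)[of "a2 + d * r"] w0 by (simp add: b_def r_def[symmetric])
    next
      \<comment> \<open>At the seam one step by \<open>d\<close> reaches \<open>a2 + d * Q\<close>,
        and the long period returns to \<open>a2\<close>: two errors
        \<open>\<omega>\<close>.\<close>
      case False
      then have rQ: "r = Q - 1" using r by simp
      then have "b (m + 1) = g2 a2" using m1 by (simp add: b_def)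
      moreover have "\<bar>g2 ((a2 + d * r) + d) - g2 (a2 + d * r)\<bar> \<le> \<omega>" by (rule d2)
      moreover have "(a2 + d * r) + d = a2 + d * Q" by (simp add: rQ algebra_simps)
      moreover have "\<bar>g2 (a2 + d * Q) - g2 a2\<bar> \<le> \<omega>" by (rule d2)
      ultimately show ?thesis by (simp add: b_def r_def[symmetric])
    qed
    then show ?thesis using iJ by linarith
  qed
  have cyc: "(\<Sum>m\<in>{0..<Q}. \<Sum>n\<in>{0..<Q}. a m * b n * c (m + n)) \<ge> s\<^sup>2 / 2 * real_of_int (Q\<^sup>2)"
  proof (rule cyclic_triple_count[OF Q s(1) J])
    show "(\<Sum>m\<in>{0..<Q}. a m) \<ge> (1/3 + 2 * s) * Q" using m1 by (simp add: a_def)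
    show "(\<Sum>m\<in>{0..<Q}. b m) \<ge> (1/3 + 2 * s) * Q" using m2 by (simp add: b_def)
    show "(\<Sum>m\<in>{0..<Q}. c m) \<ge> (1/3 + 2 * s) * Q" using m3 by (simp add: c_def)
  qed (use g1 g2 g3 slow in \<open>auto simp: a_def b_def c_def\<close>)
  have "(\<Sum>m\<in>{0..<Q}. \<Sum>n\<in>{0..<Q}. a m * b n * c (m + n)) - \<omega> * (real_of_int Q)\<^sup>2
      = (\<Sum>m\<in>{0..<Q}. \<Sum>n\<in>{0..<Q}. a m * b n * c (m + n) - \<omega>)"
    using Q by (simp add: sum_subtractf power2_eq_square mult_ac)
  also have "\<dots> \<le> (\<Sum>m\<in>{0..<Q}. \<Sum>n\<in>{0..<Q}. g1 (a1 + d * m) * g2 (a2 + d * n) * g3 (a3 - d * (m + n)))"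
  proof (intro sum_mono)
    fix m n assume mn: "m \<in> {0..<Q}" "n \<in> {0..<Q}"
    have bn: "b n = g2 (a2 + d * n)" using mn by (simp add: b_def)
    \<comment> \<open>If \<open>m + n\<close> wraps, the cyclic argument is off by
      \<open>d * Q\<close>, which costs \<open>\<omega>\<close>; as
      \<open>a m * b n \<le> 1\<close>, each pair loses at most \<open>\<omega>\<close> in
      total.\<close>
    have cmn: "c (m + n) - \<omega> \<le> g3 (a3 - d * (m + n))"
    proof (cases "m + n < Q")
      case True
      then show ?thesis using mn w0 by (simp add: c_def)
    next
      case False
      then have "(m + n) mod Q = m + n - Q" using mn by (smt (verit) atLeastLessThan_iff minus_mod_self2 mod_pos_pos_trivial)
      then have "c (m + n) = g3 (a3 - d * (m + n - Q))" by (simp add: c_def)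
      also have "a3 - d * (m + n - Q) = (a3 - d * (m + n)) + d * Q" by (simp add: algebra_simps)
      finally have "c (m + n) = g3 ((a3 - d * (m + n)) + d * Q)" .
      then show ?thesis using d3[of "a3 - d * (m + n)"] by linarith
    qed
    have ab: "0 \<le> a m * b n" "a m * b n \<le> 1"
      using g1[of "a1 + d * m"] g2[of "a2 + d * n"] by (auto simp: a_def bn mult_le_one)
    have "a m * b n * c (m + n) - \<omega> \<le> a m * b n * c (m + n) - a m * b n * \<omega>"
      using ab w0 by (simp add: mult_left_le_one_le)
    also have "\<dots> = a m * b n * (c (m + n) - \<omega>)" by (simp add: algebra_simps)
    also have "\<dots> \<le> a m * b n * g3 (a3 - d * (m + n))" by (intro mult_left_mono cmn ab)
    finally show "a m * b n * c (m + n) - \<omega> \<le> g1 (a1 + d * m) * g2 (a2 + d * n) * g3 (a3 - d * (m + n))"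
      by (simp add: a_def bn)
  qed
  finally have "(s\<^sup>2 / 2 - \<omega>) * (real_of_int Q)\<^sup>2
      \<le> (\<Sum>m\<in>{0..<Q}. \<Sum>n\<in>{0..<Q}. g1 (a1 + d * m) * g2 (a2 + d * n) * g3 (a3 - d * (m + n)))"
    using cyc by (simp add: left_diff_distrib)
  moreover have "s\<^sup>2 / 4 * (real_of_int Q)\<^sup>2 \<le> (s\<^sup>2 / 2 - \<omega>) * (real_of_int Q)\<^sup>2"
    using \<omega> s2 w0 by (intro mult_right_mono) auto
  ultimately show ?thesis by linarith
qed

lemma sum_translate_le:
  fixes \<phi> :: "int \<Rightarrow> real"
  assumes "finite S" "\<And>x. x \<notin> S \<Longrightarrow> \<phi> x = 0" "\<And>x. \<phi> x \<ge> 0" "finite Y"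
  shows "(\<Sum>a\<in>Y. \<phi> (a + k)) \<le> (\<Sum>x\<in>S. \<phi> x)"
proof -
  have "(\<Sum>a\<in>Y. \<phi> (a + k)) = (\<Sum>x\<in>(\<lambda>a. a + k) ` Y. \<phi> x)"
    by (subst sum.reindex) (auto simp: inj_on_def)
  also have "\<dots> \<le> (\<Sum>x\<in>S \<union> (\<lambda>a. a + k) ` Y. \<phi> x)"
    using assms by (intro sum_mono2) auto
  also have "\<dots> = (\<Sum>x\<in>S. \<phi> x)"
    using assms by (intro sum.mono_neutral_right) auto
  finally show ?thesis .
qed

lemma conv3_eq_sum:
  assumes "finite S" "\<And>n. n \<notin> S \<Longrightarrow> u n = 0" "\<And>n. n \<notin> S \<Longrightarrow> v n = 0"
  shows "conv u (conv v w) M = (\<Sum>x\<in>S. \<Sum>y\<in>S. u x * v y * w (M - x - y))"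
  using assms by (simp add: conv_eq_sum[of S] sum_distrib_left mult.assoc)

text \<open>Sum the local count over pairs of base points in \<open>Y\<close>. For fixed
  \<open>m\<close> and \<open>n\<close> the pairs \<open>(a + d * m, a' + d * n)\<close> are
  distinct, so each of the \<open>Q\<^sup>2\<close> inner sums is at most the full count, and
  \<open>Q\<^sup>2\<close> cancels.\<close>

lemma averaged_count:
  fixes g1 g2 g3 :: "int \<Rightarrow> real" and d Q M :: int and Y :: "int set" and s \<omega> :: real
  assumes Q: "Q > 0" and s: "s > 0" "s \<le> 1" and \<omega>: "\<omega> \<le> s\<^sup>2 / 8"
    and g1: "\<And>n. 0 \<le> g1 n" "\<And>n. g1 n \<le> 1"
    and g2: "\<And>n. 0 \<le> g2 n" "\<And>n. g2 n \<le> 1"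
    and g3: "\<And>n. 0 \<le> g3 n" "\<And>n. g3 n \<le> 1"
    and d2: "\<And>n. \<bar>g2 (n + d) - g2 n\<bar> \<le> \<omega>" "\<And>n. \<bar>g2 (n + d * Q) - g2 n\<bar> \<le> \<omega>"
    and d3: "\<And>n. \<bar>g3 (n + d * Q) - g3 n\<bar> \<le> \<omega>"
    and Y: "finite Y"
    and m1: "\<And>a. a \<in> Y \<Longrightarrow> (\<Sum>m\<in>{0..<Q}. g1 (a + d * m)) \<ge> (1/3 + 2 * s) * Q"
    and m2: "\<And>a. a \<in> Y \<Longrightarrow> (\<Sum>m\<in>{0..<Q}. g2 (a + d * m)) \<ge> (1/3 + 2 * s) * Q"
    and m3: "\<And>a a'. a \<in> Y \<Longrightarrow> a' \<in> Y \<Longrightarrow> (\<Sum>m\<in>{0..<Q}. g3 (M - a - a' - d * m)) \<ge> (1/3 + 2 * s) * Q"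
    and S: "finite S" "\<And>n. n \<notin> S \<Longrightarrow> g1 n = 0" "\<And>n. n \<notin> S \<Longrightarrow> g2 n = 0"
  shows "conv g1 (conv g2 g3) M \<ge> s\<^sup>2 / 4 * (real (card Y))\<^sup>2"
proof -
  define F where "F x y = g1 x * g2 y * g3 (M - x - y)" for x y
  have F0: "F x y \<ge> 0" for x y using g1 g2 g3 by (simp add: F_def)
  have Fz: "F x y = 0" if "x \<notin> S \<or> y \<notin> S" for x y using that S by (auto simp: F_def)
  let ?T = "\<Sum>x\<in>S. \<Sum>y\<in>S. F x y"
  have inner: "(\<Sum>a\<in>Y. \<Sum>a'\<in>Y. F (a + k) (a' + l)) \<le> ?T" for k l
  proof -
    have "(\<Sum>a\<in>Y. \<Sum>a'\<in>Y. F (a + k) (a' + l)) \<le> (\<Sum>a\<in>Y. \<Sum>y\<in>S. F (a + k) y)"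
      using S Y F0 Fz by (intro sum_mono sum_translate_le) auto
    also have "\<dots> \<le> ?T"
      using S Y F0 Fz by (intro sum_translate_le[of S "\<lambda>x. \<Sum>y\<in>S. F x y"] sum_nonneg) auto
    finally show ?thesis .
  qed
  have "(real (card Y))\<^sup>2 * (s\<^sup>2 / 4 * (real_of_int Q)\<^sup>2)
      = (\<Sum>a\<in>Y. \<Sum>a'\<in>Y. s\<^sup>2 / 4 * (real_of_int Q)\<^sup>2)" by (simp add: power2_eq_square)
  also have "\<dots> \<le> (\<Sum>a\<in>Y. \<Sum>a'\<in>Y. \<Sum>m\<in>{0..<Q}. \<Sum>n\<in>{0..<Q}. F (a + d * m) (a' + d * n))"
  proof (intro sum_mono)
    fix a a' assume a: "a \<in> Y" "a' \<in> Y"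
    have "s\<^sup>2 / 4 * (real_of_int Q)\<^sup>2 \<le> (\<Sum>m\<in>{0..<Q}. \<Sum>n\<in>{0..<Q}.
        g1 (a + d * m) * g2 (a' + d * n) * g3 (M - a - a' - d * (m + n)))"
      by (rule local_count[OF Q s \<omega> g1 g2 g3 d2 d3 m1[OF a(1)] m2[OF a(2)] m3[OF a]])
    then show "s\<^sup>2 / 4 * (real_of_int Q)\<^sup>2 \<le> (\<Sum>m\<in>{0..<Q}. \<Sum>n\<in>{0..<Q}. F (a + d * m) (a' + d * n))"
      by (simp add: F_def algebra_simps)
  qed
  also have "\<dots> = (\<Sum>m\<in>{0..<Q}. \<Sum>n\<in>{0..<Q}. \<Sum>a\<in>Y. \<Sum>a'\<in>Y. F (a + d * m) (a' + d * n))"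
    by (simp only: sum.swap[of _ "{0..<Q}" Y])
  also have "\<dots> \<le> (\<Sum>m\<in>{0..<Q}. \<Sum>n\<in>{0..<Q}. ?T)"
    by (intro sum_mono inner)
  also have "\<dots> = (real_of_int Q)\<^sup>2 * ?T" using Q by (simp add: power2_eq_square)
  finally have "(s\<^sup>2 / 4 * (real (card Y))\<^sup>2) * (real_of_int Q)\<^sup>2 \<le> ?T * (real_of_int Q)\<^sup>2"
    by (simp add: mult_ac)
  then have "s\<^sup>2 / 4 * (real (card Y))\<^sup>2 \<le> ?T"
    using Q by (subst (asm) mult_le_cancel_right) auto
  then show ?thesis using S by (simp add: conv3_eq_sum[of S] F_def)
qed

text \<open>Dirichlet's theorem is applied to the \<open>\<theta>\<close>, giving \<open>d\<close>, and then to the multiples \<open>s0 \<theta>\<close> with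
  an accuracy that survives multiplication by \<open>d\<close>.\<close>

lemma almost_periods:
  fixes \<Theta> :: "real set" and k N1 :: nat and s0 :: int
  assumes fin: "finite \<Theta>" and k: "card \<Theta> \<le> k" and N1: "N1 > 0" and s0: "s0 > 0"
  obtains d Q :: int where "0 < d" "d \<le> int (N1 ^ k)" "s0 \<le> Q" "Q \<le> int ((N1 ^ k * N1) ^ k) * s0"
    "\<And>\<theta>. \<theta> \<in> \<Theta> \<Longrightarrow> \<exists>j::int. \<bar>of_int d * \<theta> - of_int j\<bar> \<le> 1 / N1"
    "\<And>\<theta>. \<theta> \<in> \<Theta> \<Longrightarrow> \<exists>j::int. \<bar>of_int (d * Q) * \<theta> - of_int j\<bar> \<le> 1 / N1"
proof -
  obtain en where en: "bij_betw en {0..<card \<Theta>} \<Theta>" using ex_bij_betw_nat_finite[OF fin] by blast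
  then have en': "\<exists>i<card \<Theta>. \<theta> = en i" if "\<theta> \<in> \<Theta>" for \<theta>
  proof -
    have "\<theta> \<in> en ` {0..<card \<Theta>}" using that en by (simp add: bij_betw_def)
    then show ?thesis by auto
  qed
  obtain d p where d: "0 < d" "d \<le> int (N1 ^ card \<Theta>)"
    and dp: "\<And>i. i < card \<Theta> \<Longrightarrow> \<bar>of_int d * en i - of_int (p i)\<bar> < 1 / N1"
    using Dirichlet_approx_simult[OF N1, of "card \<Theta>" en] by blast
  define N2 where "N2 = N1 ^ k * N1"
  have N2: "N2 > 0" using N1 by (simp add: N2_def)
  obtain e r where e: "0 < e" "e \<le> int (N2 ^ card \<Theta>)"
    and er: "\<And>i. i < card \<Theta> \<Longrightarrow> \<bar>of_int e * (of_int s0 * en i) - of_int (r i)\<bar> < 1 / N2"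
    using Dirichlet_approx_simult[OF N2, of "card \<Theta>" "\<lambda>i. of_int s0 * en i"] by blast
  have dk: "d \<le> int (N1 ^ k)"
    using d(2) power_increasing[OF k, of "int N1"] N1 by simp
  have ek: "e \<le> int (N2 ^ k)"
    using e(2) power_increasing[OF k, of "int N2"] N2 by simp
  show ?thesis
  proof (rule that[of d "e * s0"])
    show "0 < d" "d \<le> int (N1 ^ k)" by fact+
    show "s0 \<le> e * s0" using e s0 by (simp add: mult_le_cancel_right1)
    show "e * s0 \<le> int ((N1 ^ k * N1) ^ k) * s0"
      using ek s0 unfolding N2_def by (intro mult_right_mono) auto
    fix \<theta> assume "\<theta> \<in> \<Theta>"
    then obtain i where i: "i < card \<Theta>" "\<theta> = en i" using en' by blast
    show "\<exists>j::int. \<bar>of_int d * \<theta> - of_int j\<bar> \<le> 1 / N1"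
      using dp[OF i(1)] i(2) by (auto intro!: exI[of _ "p i"])
    have "\<bar>of_int (d * (e * s0)) * \<theta> - of_int (d * r i)\<bar> = d * \<bar>of_int e * (of_int s0 * \<theta>) - of_int (r i)\<bar>"
    proof -
      have "of_int (d * (e * s0)) * \<theta> - of_int (d * r i) = of_int d * (of_int e * (of_int s0 * \<theta>) - of_int (r i))"
        by (simp add: algebra_simps)
      then show ?thesis using d by (simp add: abs_mult)
    qed
    also have "\<dots> \<le> real_of_int (int (N1 ^ k)) * (1 / N2)"
      using dk er[OF i(1)] i(2) d by (intro mult_mono) (auto simp del: of_int_of_nat_eq)
    also have "\<dots> = 1 / N1" using N1 by (simp add: N2_def)
    finally show "\<exists>j::int. \<bar>of_int (d * (e * s0)) * \<theta> - of_int j\<bar> \<le> 1 / N1" by blast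
  qed
qed

section \<open>The transference principle\<close>

text \<open>The weights are normalised so that the majorant \<open>\<nu> i\<close> has density \<open>1\<close>.\<close>

definition transference_data ::
  "real \<Rightarrow> real \<Rightarrow> real \<Rightarrow> real \<Rightarrow> nat \<Rightarrow> (int \<Rightarrow> real) \<Rightarrow> (int \<Rightarrow> real) \<Rightarrow> bool" where
  "transference_data q K \<sigma> \<eta> N f \<nu> \<longleftrightarrow>
     (\<forall>n. 0 \<le> f n \<and> f n \<le> \<nu> n) \<and>
     (\<forall>n. n \<notin> {1..int N} \<longrightarrow> \<nu> n = 0) \<and>
     (\<forall>\<gamma>. cmod (ft \<nu> \<gamma> - ft (ind N) \<gamma>) \<le> \<eta> * real N) \<and>
     integral {0..1} (\<lambda>\<gamma>. cmod (ft f \<gamma>) powr q) \<le> K * real N powr (q - 1) \<and>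
     (\<forall>(a::int) (d::int) (m::nat). 0 < d \<longrightarrow> 1 \<le> a \<longrightarrow> a + d * (int m - 1) \<le> int N \<longrightarrow> real m \<ge> \<eta> * real N \<longrightarrow>
        (\<Sum>j<m. f (a + d * int j)) \<ge> (1/3 + \<sigma>) * real m)"

lemma transference_dataD:
  assumes "transference_data q K \<sigma> \<eta> N f \<nu>"
  shows "0 \<le> f n" "f n \<le> \<nu> n" "n \<notin> {1..int N} \<Longrightarrow> \<nu> n = 0"
    "cmod (ft \<nu> \<gamma> - ft (ind N) \<gamma>) \<le> \<eta> * real N"
    "integral {0..1} (\<lambda>\<gamma>. cmod (ft f \<gamma>) powr q) \<le> K * real N powr (q - 1)"
    "0 < d \<Longrightarrow> 1 \<le> a \<Longrightarrow> a + d * (int m - 1) \<le> int N \<Longrightarrow> real m \<ge> \<eta> * real N \<Longrightarrow>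
      (\<Sum>j<m. f (a + d * int j)) \<ge> (1/3 + \<sigma>) * real m"
  using assms unfolding transference_data_def by blast+

lemma transference_mass:
  assumes t: "transference_data q K \<sigma> \<eta> N f \<nu>" and \<eta>: "\<eta> \<le> 1"
  shows "(\<Sum>n\<in>{1..int N}. f n) \<le> 2 * real N"
proof -
  have "ft \<nu> 0 = (\<Sum>n\<in>{1..int N}. of_real (\<nu> n) * add_char (0 * of_int n))"
    by (rule ft_eq_sum) (use transference_dataD(3)[OF t] in auto)
  then have 1: "ft \<nu> 0 = of_real (\<Sum>n\<in>{1..int N}. \<nu> n)" by simp
  have "ft (ind N) 0 = (\<Sum>n\<in>{1..int N}. of_real (ind N n) * add_char (0 * of_int n))"
    by (rule ft_eq_sum) (auto simp: ind_def)
  then have 2: "ft (ind N) 0 = of_real (real N)" by (simp add: ind_def)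
  have "\<bar>(\<Sum>n\<in>{1..int N}. \<nu> n) - real N\<bar> \<le> \<eta> * real N"
    using transference_dataD(4)[OF t, of 0] unfolding 1 2 of_real_diff[symmetric] norm_of_real .
  moreover have "\<eta> * real N \<le> real N" using mult_right_mono[OF \<eta>, of "real N"] by simp
  moreover have "(\<Sum>n\<in>{1..int N}. f n) \<le> (\<Sum>n\<in>{1..int N}. \<nu> n)"
    using transference_dataD(2)[OF t] by (intro sum_mono) auto
  ultimately show ?thesis by linarith
qed

lemma sum_int_nat: "Q \<ge> 0 \<Longrightarrow> (\<Sum>m\<in>{0..<Q}. \<phi> m) = (\<Sum>j<nat Q. \<phi> (int j))"
  for \<phi> :: "int \<Rightarrow> real"
  by (rule sum.reindex_bij_witness[of _ int nat]) auto

text \<open>The decreasing form serves the third variable \<open>M - a - a' - d * m\<close>; it is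
  the increasing one read from its last term.\<close>

lemma transference_ap_int:
  assumes t: "transference_data q K \<sigma> \<eta> N f \<nu>" and d: "0 < d" and Q: "Q > 0" "real_of_int Q \<ge> \<eta> * real N"
  shows "1 \<le> a \<Longrightarrow> a + d * (Q - 1) \<le> int N \<Longrightarrow> (\<Sum>m\<in>{0..<Q}. f (a + d * m)) \<ge> (1/3 + \<sigma>) * Q"
    and "1 \<le> a - d * (Q - 1) \<Longrightarrow> a \<le> int N \<Longrightarrow> (\<Sum>m\<in>{0..<Q}. f (a - d * m)) \<ge> (1/3 + \<sigma>) * Q"
proof -
  have *: "(\<Sum>m\<in>{0..<Q}. f (a + d * m)) \<ge> (1/3 + \<sigma>) * Q" if "1 \<le> a" "a + d * (Q - 1) \<le> int N" for a
    using transference_dataD(6)[OF t d, of a "nat Q"] that Q by (simp add: sum_int_nat)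
  then show "1 \<le> a \<Longrightarrow> a + d * (Q - 1) \<le> int N \<Longrightarrow> (\<Sum>m\<in>{0..<Q}. f (a + d * m)) \<ge> (1/3 + \<sigma>) * Q" .
  assume a: "1 \<le> a - d * (Q - 1)" "a \<le> int N"
  have "(\<Sum>m\<in>{0..<Q}. f (a - d * m)) = (\<Sum>m\<in>{0..<Q}. f ((a - d * (Q - 1)) + d * m))"
    by (rule sum.reindex_bij_witness[of _ "\<lambda>m. Q - 1 - m" "\<lambda>m. Q - 1 - m"]) (auto simp: algebra_simps)
  then show "(\<Sum>m\<in>{0..<Q}. f (a - d * m)) \<ge> (1/3 + \<sigma>) * Q"
    using *[of "a - d * (Q - 1)"] a by simp
qed

text \<open>The smoothed weights may exceed 1 by \<open>s\<close>; dividing by \<open>1 + s\<close>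
  puts them in the unit interval while the surplus of the mean drops only from \<open>4 * s\<close>
  to \<open>2 * s\<close>. At least \<open>N / 20\<close> base points turn
  \<open>s\<^sup>2 / 4\<close> into \<open>s\<^sup>2 / 1600\<close>.\<close>

lemma structured_count:
  fixes f \<nu> :: "nat \<Rightarrow> int \<Rightarrow> real" and N D L k N1 d0 :: nat and M d Q :: int and \<Theta> :: "real set"
    and q K s \<eta> \<omega> :: real
  assumes t: "\<And>i. i \<in> {1,2,3} \<Longrightarrow> transference_data q K (4 * s) \<eta> N (f i) (\<nu> i)"
    and s: "0 < s" "s \<le> 1/4" and \<eta>: "\<eta> \<le> 1" and \<omega>: "\<omega> \<le> s\<^sup>2 / 8"
    and N: "N \<ge> 100" and M: "int N - 3 \<le> M" "M \<le> int N"
    and D: "D > 0" and L: "L > 0" "20 * L \<le> N" and \<Theta>: "finite \<Theta>"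
    and up: "\<eta> * real N * real D ^ card \<Theta> / real L \<le> s"
    and d: "d > 0" and Q: "Q > 0" "real_of_int Q \<ge> \<eta> * real N" "100 * (d * Q) \<le> int N"
    and ap: "\<And>i n. i \<in> {1,2,3} \<Longrightarrow> \<bar>smooth D L \<Theta> (f i) (n + d) - smooth D L \<Theta> (f i) n\<bar> \<le> \<omega>"
      "\<And>i n. i \<in> {1,2,3} \<Longrightarrow> \<bar>smooth D L \<Theta> (f i) (n + d * Q) - smooth D L \<Theta> (f i) n\<bar> \<le> \<omega>"
  shows "conv (smooth D L \<Theta> (f 1)) (conv (smooth D L \<Theta> (f 2)) (smooth D L \<Theta> (f 3))) M \<ge> s\<^sup>2 / 1600 * (real N)\<^sup>2"
proof -
  note DL = D L(1) \<Theta>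
  define g where "g i = smooth D L \<Theta> (f i)" for i
  define \<psi> where "\<psi> i n = g i n / (1 + s)" for i n
  have f0: "i \<in> {1,2,3} \<Longrightarrow> 0 \<le> f i n" for i n using transference_dataD(1)[OF t] .
  have fsup: "f i n = 0" if "i \<in> {1,2,3}" "n \<notin> {1..int N}" for i n
    using transference_dataD(1,2,3)[OF t[OF that(1)], of n] that(2) by (simp add: order_antisym)
  have g0: "0 \<le> g i n" if "i \<in> {1,2,3}" for i n
    unfolding g_def using that by (intro smooth_nonneg[OF DL] f0)
  have g1: "g i n \<le> 1 + s" if "i \<in> {1,2,3}" for i n
  proof -
    have "g i n \<le> 1 + \<eta> * real N * real D ^ card \<Theta> / real L"
      unfolding g_def using transference_dataD(2-4)[OF t[OF that]]
      by (intro smooth_upper[OF DL, where \<nu> = "\<nu> i" and N = N]) auto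
    then show ?thesis using up by linarith
  qed
  have \<psi>0: "0 \<le> \<psi> i n" and \<psi>1: "\<psi> i n \<le> 1" and \<psi>g: "\<psi> i n \<le> g i n" if "i \<in> {1,2,3}" for i n
    using g0[OF that, of n] g1[OF that, of n] s by (auto simp: \<psi>_def divide_le_eq mult_le_cancel_left1)
  have \<psi>ap: "\<bar>\<psi> i (n + u) - \<psi> i n\<bar> \<le> \<omega>" if "\<bar>g i (n + u) - g i n\<bar> \<le> \<omega>" for i n u
  proof -
    have "\<bar>\<psi> i (n + u) - \<psi> i n\<bar> = \<bar>g i (n + u) - g i n\<bar> / (1 + s)"
      using s by (simp add: \<psi>_def diff_divide_distrib[symmetric] abs_divide)
    also have "\<dots> \<le> \<bar>g i (n + u) - g i n\<bar>" using s by (simp add: divide_le_eq mult_le_cancel_left1)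
    finally show ?thesis using that by linarith
  qed
  have fin: "fsupp (g i)" if "i \<in> {1,2,3}" for i
    unfolding g_def using that by (intro fsupp_smooth L fsuppI[of "{1..int N}"]) (auto simp: fsup)
  define S where "S = {n. g 1 n \<noteq> 0} \<union> {n. g 2 n \<noteq> 0}"
  have S: "finite S" "n \<notin> S \<Longrightarrow> g 1 n = 0" "n \<notin> S \<Longrightarrow> g 2 n = 0" for n
    using fin[of 1] fin[of 2] by (auto simp: S_def)
  have mean: "(\<Sum>m\<in>{0..<Q}. \<psi> i (p m)) \<ge> (1/3 + 2 * s) * Q"
    if i: "i \<in> {1,2,3}" and h: "\<And>h. h \<in> {- int L..int L} \<Longrightarrow> (\<Sum>m\<in>{0..<Q}. f i (p m - h)) \<ge> (1/3 + 4 * s) * Q" for i p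
  proof -
    have "(1/3 + 4 * s) * Q \<le> (\<Sum>m\<in>{0..<Q}. g i (p m))"
      unfolding g_def by (rule smooth_average[OF DL h])
    moreover have "(1/3 + 2 * s) * (1 + s) * Q \<le> (1/3 + 4 * s) * Q"
    proof (intro mult_right_mono)
      have "s * s \<le> 1/4 * s" using s by (intro mult_right_mono) auto
      moreover have "(1/3 + 2 * s) * (1 + s) = 1/3 + 7/3 * s + 2 * (s * s)" by (simp add: field_simps)
      ultimately show "(1/3 + 2 * s) * (1 + s) \<le> 1/3 + 4 * s" using s by linarith
    qed (use Q in auto)
    ultimately have "(1/3 + 2 * s) * (1 + s) * Q \<le> (\<Sum>m\<in>{0..<Q}. g i (p m))" by linarith
    then show ?thesis
      using s by (simp add: \<psi>_def sum_divide_distrib[symmetric] pos_le_divide_eq mult_ac)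
  qed
  \<comment> \<open>Base points lie between about \<open>N / 5\<close> and \<open>N / 4\<close>, so
    \<open>M - a - a'\<close> lies between about \<open>N / 2\<close> and \<open>3 * N / 5\<close>.
    The shifts by \<open>h\<close> (at most \<open>N / 20\<close>) and by \<open>d * m\<close> (at
    most \<open>N / 100\<close>) then never leave \<open>{1..N}\<close>.\<close>
  define Y where "Y = {int (N div 5)..int (N div 5) + int (N div 20)}"
  have cardY: "card Y = N div 20 + 1" by (simp add: Y_def)
  have cY: "real (card Y) \<ge> real N / 20" unfolding cardY by linarith
  have Yb: "5 * a \<ge> int N - 4" "4 * a \<le> int N" if "a \<in> Y" for a
    using that unfolding Y_def by (simp_all, linarith+)
  have dQ: "0 < d * Q" "100 * (d * (Q - 1)) \<le> int N" "0 \<le> d * (Q - 1)"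
    using d Q by (auto simp: right_diff_distrib)
  have up1: "(\<Sum>m\<in>{0..<Q}. \<psi> i (a + d * m)) \<ge> (1/3 + 2 * s) * Q" if i: "i \<in> {1,2,3}" and a: "a \<in> Y" for i a
  proof (rule mean[OF i])
    fix h assume h: "h \<in> {- int L..int L}"
    have "(\<Sum>m\<in>{0..<Q}. f i ((a - h) + d * m)) \<ge> (1/3 + 4 * s) * Q"
      by (rule transference_ap_int(1)[OF t[OF i] d Q(1,2)]) (use Yb[OF a] h L N dQ in auto)
    then show "(\<Sum>m\<in>{0..<Q}. f i (a + d * m - h)) \<ge> (1/3 + 4 * s) * Q" by (simp add: algebra_simps)
  qed
  have down: "(\<Sum>m\<in>{0..<Q}. \<psi> 3 (M - a - a' - d * m)) \<ge> (1/3 + 2 * s) * Q" if a: "a \<in> Y" "a' \<in> Y" for a a'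
  proof (rule mean)
    fix h assume h: "h \<in> {- int L..int L}"
    have "(\<Sum>m\<in>{0..<Q}. f 3 ((M - a - a' - h) - d * m)) \<ge> (1/3 + 4 * s) * Q"
      by (rule transference_ap_int(2)[OF t d Q(1,2)]) (use Yb[OF a(1)] Yb[OF a(2)] h L N dQ M in auto)
    then show "(\<Sum>m\<in>{0..<Q}. f 3 (M - a - a' - d * m - h)) \<ge> (1/3 + 4 * s) * Q" by (simp add: algebra_simps)
  qed simp
  have "s\<^sup>2 / 4 * (real (card Y))\<^sup>2 \<le> conv (\<psi> 1) (conv (\<psi> 2) (\<psi> 3)) M"
  proof (rule averaged_count[where S = S and d = d and Q = Q and \<omega> = \<omega> and Y = Y])
    show "\<And>n. n \<notin> S \<Longrightarrow> \<psi> 1 n = 0" "\<And>n. n \<notin> S \<Longrightarrow> \<psi> 2 n = 0" using S by (auto simp: \<psi>_def)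
    show "\<bar>\<psi> 2 (n + d) - \<psi> 2 n\<bar> \<le> \<omega>" for n using ap(1)[of 2 n] by (intro \<psi>ap) (simp add: g_def)
    show "\<bar>\<psi> 2 (n + d * Q) - \<psi> 2 n\<bar> \<le> \<omega>" for n using ap(2)[of 2 n] by (intro \<psi>ap) (simp add: g_def)
    show "\<bar>\<psi> 3 (n + d * Q) - \<psi> 3 n\<bar> \<le> \<omega>" for n using ap(2)[of 3 n] by (intro \<psi>ap) (simp add: g_def)
    show "finite Y" by (simp add: Y_def)
  qed (use Q s \<omega> S \<psi>0 \<psi>1 up1 down in auto)
  also have "\<dots> \<le> conv (g 1) (conv (g 2) (g 3)) M"
  proof -
    have "conv (\<psi> 1) (conv (\<psi> 2) (\<psi> 3)) M = (\<Sum>x\<in>S. \<Sum>y\<in>S. \<psi> 1 x * \<psi> 2 y * \<psi> 3 (M - x - y))"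
      using S by (intro conv3_eq_sum) (auto simp: \<psi>_def)
    also have "\<dots> \<le> (\<Sum>x\<in>S. \<Sum>y\<in>S. g 1 x * g 2 y * g 3 (M - x - y))"
      using \<psi>0 \<psi>g g0 by (intro sum_mono mult_mono mult_nonneg_nonneg) auto
    also have "\<dots> = conv (g 1) (conv (g 2) (g 3)) M" using S by (intro conv3_eq_sum[symmetric]) auto
    finally show ?thesis .
  qed
  finally have "s\<^sup>2 / 4 * (real (card Y))\<^sup>2 \<le> conv (g 1) (conv (g 2) (g 3)) M" .
  moreover have "s\<^sup>2 / 4 * (real N / 20)\<^sup>2 \<le> s\<^sup>2 / 4 * (real (card Y))\<^sup>2"
    using cY by (intro mult_left_mono power_mono) auto
  ultimately show ?thesis by (simp add: g_def power_divide)
qed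

text \<open>The parameters are fixed in the order \<open>s\<close>, \<open>\<omega>\<close>,
  \<open>\<epsilon>\<close>, \<open>D\<close>, \<open>k\<close>, \<open>\<rho>\<close>,
  \<open>\<tau>\<close>, \<open>N1\<close>, \<open>E\<close>, \<open>\<mu>\<close>,
  \<open>\<eta>\<close>, \<open>N0\<close>, each depending only on earlier ones and on
  \<open>q\<close>, \<open>K\<close>, \<open>\<sigma>\<close>. This order is possible because the
  bound \<open>k\<close> on the number of frequencies precedes the accuracy demanded of the almost
  periods.\<close>

theorem transference:
  fixes q K \<sigma> :: real
  assumes q: "2 < q" "q < 3" and K: "K > 0" and \<sigma>: "\<sigma> > 0"
  shows "\<exists>\<eta> c N0. \<eta> > 0 \<and> c > 0 \<and> (\<forall>N\<ge>N0. \<forall>f \<nu> M. int N - 3 \<le> M \<longrightarrow> M \<le> int N \<longrightarrow>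
    (\<forall>i\<in>{1,2,3::nat}. transference_data q K \<sigma> \<eta> N (f i) (\<nu> i)) \<longrightarrow>
    conv (f 1) (conv (f 2) (f 3)) M \<ge> c * (real N)\<^sup>2)"
proof -
  define s where "s = min (\<sigma> / 4) (1 / 4)"
  have s: "0 < s" "s \<le> 1/4" "4 * s \<le> \<sigma>" using \<sigma> by (auto simp: s_def)
  define \<omega> where "\<omega> = s\<^sup>2 / 8"
  have \<omega>: "0 < \<omega>" "\<omega> \<le> 1" using s power_mono[of s "1/4" 2] by (auto simp: \<omega>_def power_divide)
  define c0 where "c0 = s\<^sup>2 / 1600"
  have c0: "c0 > 0" using s by (simp add: c0_def)
  \<comment> \<open>Chosen so that the smoothing error
    \<open>9 * K * \<epsilon> powr (3 - q)\<close> is exactly half of the main constant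
    \<open>c0\<close>.\<close>
  define \<epsilon> where "\<epsilon> = (c0 / (18 * K)) powr (1 / (3 - q))"
  have \<epsilon>: "\<epsilon> > 0" using c0 K by (simp add: \<epsilon>_def)
  have \<epsilon>q: "9 * K * \<epsilon> powr (3 - q) = c0 / 2"
    using c0 K q by (simp add: \<epsilon>_def powr_powr)
  \<comment> \<open>This makes the concentration loss \<open>2 / D\<close> at most
    \<open>\<epsilon> / 4\<close>.\<close>
  define D where "D = nat \<lceil>8 / \<epsilon>\<rceil>"
  have Dr: "real D \<ge> 8 / \<epsilon>" unfolding D_def by (rule real_nat_ceiling_ge)
  have "8 / \<epsilon> > 0" using \<epsilon> by simp
  then have D: "D > 0" using Dr by (cases D) auto
  have D1: "real D \<ge> 1" using D by simp
  \<comment> \<open>Bound for one spectrum, using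
    \<open>T / N \<le> 8 * pi / \<epsilon> + 1\<close>; \<open>k\<close> allows for the union of
    three.\<close>
  define B where "B = K * (2 / \<epsilon>) powr q * (8 * pi / \<epsilon> + 1)"
  define k where "k = nat \<lceil>3 * B\<rceil>"
  have k: "real k \<ge> 3 * B" unfolding k_def by (rule real_nat_ceiling_ge)
  \<comment> \<open>With \<open>L \<ge> N / 40\<close> and mass at most \<open>2 * N\<close>, the
    factor in front of the almost-period bound is at most \<open>C\<close>. Then
    \<open>\<rho>\<close> and \<open>\<tau>\<close> give a share \<open>\<omega> / 2\<close> each to
    the Fejer part and to the tent part.\<close>
  define C where "C = 80 * real D ^ k"
  have C: "C > 0" using D by (simp add: C_def)
  define \<rho> where "\<rho> = \<omega> / (2 * C * (2 * pi * real D * (real k + 1)))"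
  have \<rho>: "\<rho> > 0" using \<omega> C D by (simp add: \<rho>_def)
  define \<tau> where "\<tau> = \<omega> / (80 * C)"
  have \<tau>: "\<tau> > 0" using \<omega> C by (simp add: \<tau>_def)
  have C1: "C \<ge> 80" using one_le_power[OF D1, of k] by (simp add: C_def)
  have \<tau>1: "\<tau> \<le> 1 / 100"
  proof -
    have "\<omega> \<le> 1 / 100 * (80 * C)" using \<omega> C1 by simp
    then show ?thesis using C by (simp add: \<tau>_def pos_divide_le_eq)
  qed
  define N1 where "N1 = nat \<lceil>1 / \<rho>\<rceil>"
  have N1r: "real N1 \<ge> 1 / \<rho>" unfolding N1_def by (rule real_nat_ceiling_ge)
  have "1 / \<rho> > 0" using \<rho> by simp
  then have N1: "N1 > 0" using N1r by (cases N1) auto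
  have iN1: "1 / N1 \<le> \<rho>"
  proof -
    have "1 \<le> \<rho> * N1" using N1r \<rho> by (simp add: pos_divide_le_eq mult.commute)
    then show ?thesis using N1 by (simp add: pos_divide_le_eq)
  qed
  define d0 where "d0 = N1 ^ k"
  \<comment> \<open>Bound for \<open>d * Q / s0\<close> from Dirichlet's theorem;
    \<open>\<mu>\<close> and \<open>N0\<close> then keep \<open>d * Q\<close> below
    \<open>\<tau> * N\<close>, rounding in \<open>s0\<close> included.\<close>
  define E where "E = real (d0 * (d0 * N1) ^ k)"
  have d0: "d0 > 0" using N1 by (simp add: d0_def)
  have Ed0: "E \<ge> d0"
  proof -
    have "(d0 * N1) ^ k \<ge> 1" using d0 N1 by simp
    then have "d0 * 1 \<le> d0 * (d0 * N1) ^ k" by (intro mult_le_mono2)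
    then show ?thesis unfolding E_def by (simp only: of_nat_le_iff mult_1_right)
  qed
  have E: "E \<ge> 1" using Ed0 d0 by linarith
  define \<mu> where "\<mu> = \<tau> / (2 * E)"
  have \<mu>: "\<mu> > 0" using \<tau> E by (simp add: \<mu>_def)
  \<comment> \<open>The bound by \<open>\<mu>\<close> makes \<open>Q\<close> long enough for the
    progression condition; the one by \<open>s / (40 * D ^ k)\<close> keeps the smoothed weights
    below \<open>1 + s\<close>.\<close>
  define \<eta> where "\<eta> = min (min 1 \<mu>) (s / (40 * real D ^ k))"
  have \<eta>: "\<eta> > 0" "\<eta> \<le> 1" "\<eta> \<le> \<mu>" "\<eta> \<le> s / (40 * real D ^ k)"
    using \<mu> s D by (auto simp: \<eta>_def)
  define N0 where "N0 = nat \<lceil>2 * E / \<tau>\<rceil> + 100"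
  show ?thesis
  proof (intro exI conjI allI impI)
    show "\<eta> > 0" by fact
    show "c0 / 2 > 0" using c0 by simp
    fix N f \<nu> M
    assume N: "N0 \<le> N" and M: "int N - 3 \<le> M" "M \<le> int N"
      and td\<sigma>: "\<forall>i\<in>{1,2,3::nat}. transference_data q K \<sigma> \<eta> N (f i) (\<nu> i)"
    have N100: "N \<ge> 100" using N by (simp add: N0_def)
    have NE: "\<tau> * N \<ge> 2 * E"
    proof -
      have "2 * E / \<tau> \<le> real N" using N real_nat_ceiling_ge[of "2 * E / \<tau>"] unfolding N0_def by linarith
      then show ?thesis using \<tau> by (simp add: pos_divide_le_eq mult.commute)
    qed
    have td: "transference_data q K (4 * s) \<eta> N (f i) (\<nu> i)" if i: "i \<in> {1,2,3}" for i
      unfolding transference_data_def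
    proof (intro conjI allI impI)
      note t = transference_dataD[OF td\<sigma>[rule_format, OF i]]
      fix a d :: int and m :: nat
      assume *: "0 < d" "1 \<le> a" "a + d * (int m - 1) \<le> int N" "\<eta> * real N \<le> real m"
      have "(1/3 + 4 * s) * real m \<le> (1/3 + \<sigma>) * real m" using s by (intro mult_right_mono) auto
      then show "(1/3 + 4 * s) * real m \<le> (\<Sum>j<m. f i (a + d * int j))" using t(6)[OF *] by linarith
    qed (use transference_dataD[OF td\<sigma>[rule_format, OF i]] in auto)
    note t = transference_dataD[OF td]
    have fsup: "f i n = 0" if "i \<in> {1,2,3}" "n \<notin> {1..int N}" for i n
      using t(1-3)[OF that(1), of n] that(2) by (simp add: order_antisym)
    have ffs: "fsupp (f i)" if "i \<in> {1,2,3}" for i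
      using that by (intro fsuppI[of "{1..int N}"]) (auto simp: fsup)
    have mass: "(\<Sum>n\<in>{1..int N}. f i n) \<le> 2 * real N" if "i \<in> {1,2,3}" for i
      by (rule transference_mass[OF td[OF that] \<eta>(2)])
    define L where "L = N div 20"
    have L: "L > 0" "20 * L \<le> N" using N100 by (auto simp: L_def)
    have L40: "40 * real L \<ge> real N" using N100 unfolding L_def by linarith
    define T where "T = nat \<lceil>8 * pi * N / \<epsilon>\<rceil>"
    have Tr: "real T \<ge> 8 * pi * N / \<epsilon>" unfolding T_def by (rule real_nat_ceiling_ge)
    have posT: "8 * pi * N / \<epsilon> > 0" using \<epsilon> N100 by simp
    then have T: "T > 0" using Tr by (cases T) auto
    have Tle: "real T / N \<le> 8 * pi / \<epsilon> + 1"
    proof -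
      have "real T \<le> 8 * pi * N / \<epsilon> + 1" using posT unfolding T_def by linarith
      then have "real T / N \<le> (8 * pi * N / \<epsilon> + 1) / N" by (intro divide_right_mono) auto
      also have "\<dots> = 8 * pi / \<epsilon> + 1 / N" using N100 by (simp add: add_divide_distrib)
      also have "\<dots> \<le> 8 * pi / \<epsilon> + 1" using N100 by simp
      finally show ?thesis .
    qed
    define \<Theta>i where "\<Theta>i i = spectrum_grid T (\<epsilon> * N) (f i)" for i
    \<comment> \<open>One common set of frequencies, so that the three smoothings share the periods
      \<open>d\<close> and \<open>d * Q\<close>.\<close>
    define \<Theta> where "\<Theta> = \<Theta>i 1 \<union> \<Theta>i 2 \<union> \<Theta>i 3"
    have \<Theta>: "finite \<Theta>" by (simp add: \<Theta>_def \<Theta>i_def)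
    have \<Theta>sub: "\<Theta>i i \<subseteq> \<Theta>" if "i \<in> {1,2,3}" for i using that by (auto simp: \<Theta>_def)
    have ci: "real (card (\<Theta>i i)) \<le> B" if i: "i \<in> {1,2,3}" for i
    proof -
      have "real (card (\<Theta>i i)) \<le> K * (2 / \<epsilon>) powr q * (T / N)"
        unfolding \<Theta>i_def
        by (rule card_spectrum_grid) (use fsup[OF i] t[OF i] mass[OF i] q \<epsilon> N100 T Tr in auto)
      also have "\<dots> \<le> B"
        unfolding B_def using Tle K by (intro mult_left_mono) auto
      finally show ?thesis .
    qed
    have cardk: "card \<Theta> \<le> k"
    proof -
      have "card \<Theta> \<le> card (\<Theta>i 1) + card (\<Theta>i 2) + card (\<Theta>i 3)"
        unfolding \<Theta>_def by (intro order_trans[OF card_Un_le] add_mono order_refl)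
      then have "real (card \<Theta>) \<le> real (card (\<Theta>i 1)) + real (card (\<Theta>i 2)) + real (card (\<Theta>i 3))" by linarith
      also have "\<dots> \<le> real k" using ci[of 1] ci[of 2] ci[of 3] k by auto
      finally show ?thesis by simp
    qed
    have Dk: "real D ^ card \<Theta> \<le> real D ^ k" by (rule power_increasing[OF cardk D1])
    define s0 where "s0 = \<lceil>\<mu> * N\<rceil>"
    have s0: "s0 > 0" "of_int s0 \<ge> \<mu> * N" "of_int s0 \<le> \<mu> * N + 1"
      using \<mu> N100 by (auto simp: s0_def)
    obtain d Q :: int where d: "0 < d" "d \<le> int (N1 ^ k)" and Q: "s0 \<le> Q" "Q \<le> int ((N1 ^ k * N1) ^ k) * s0"
      and pd: "\<And>\<theta>. \<theta> \<in> \<Theta> \<Longrightarrow> \<exists>j::int. \<bar>of_int d * \<theta> - of_int j\<bar> \<le> 1 / N1"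
      and pQ: "\<And>\<theta>. \<theta> \<in> \<Theta> \<Longrightarrow> \<exists>j::int. \<bar>of_int (d * Q) * \<theta> - of_int j\<bar> \<le> 1 / N1"
      using almost_periods[OF \<Theta> cardk N1 s0(1)] by metis
    have Q0: "Q > 0" using Q(1) s0(1) by linarith
    have dle: "real_of_int d \<le> \<tau> * N"
    proof -
      have "real_of_int d \<le> real d0" using d(2) unfolding d0_def by (metis of_int_le_iff of_int_of_nat_eq)
      then show ?thesis using Ed0 NE E by linarith
    qed
    have dQle: "real_of_int (d * Q) \<le> \<tau> * N"
    proof -
      have "d * Q \<le> int (N1 ^ k) * (int ((N1 ^ k * N1) ^ k) * s0)"
        using d Q Q0 by (intro mult_mono) auto
      also have "\<dots> = int (d0 * (d0 * N1) ^ k) * s0" by (simp add: d0_def)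
      finally have "real_of_int (d * Q) \<le> real_of_int (int (d0 * (d0 * N1) ^ k) * s0)" by (simp only: of_int_le_iff)
      also have "\<dots> = E * of_int s0" by (simp add: E_def)
      also have "\<dots> \<le> E * (\<mu> * N + 1)" using s0 E by (intro mult_left_mono) auto
      also have "\<dots> = \<tau> * N / 2 + E" using E by (simp add: \<mu>_def field_simps)
      also have "\<dots> \<le> \<tau> * N" using NE by linarith
      finally show ?thesis .
    qed
    have dQ100: "100 * (d * Q) \<le> int N"
    proof -
      have "\<tau> * N \<le> 1 / 100 * N" using \<tau>1 by (intro mult_right_mono) auto
      then have "real_of_int (100 * (d * Q)) \<le> real_of_int (int N)" using dQle by simp
      then show ?thesis by (simp only: of_int_le_iff)
    qed
    have Q\<eta>: "real_of_int Q \<ge> \<eta> * N"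
    proof -
      have "\<eta> * N \<le> \<mu> * N" using \<eta> by (intro mult_right_mono) auto
      also have "\<dots> \<le> of_int s0" by (rule s0)
      also have "\<dots> \<le> of_int Q" using Q(1) by simp
      finally show ?thesis .
    qed
    have ap: "\<bar>smooth D L \<Theta> (f i) (n + u) - smooth D L \<Theta> (f i) n\<bar> \<le> \<omega>"
      if i: "i \<in> {1,2,3}" and u: "0 < u" "real_of_int u \<le> \<tau> * N"
        "\<And>\<theta>. \<theta> \<in> \<Theta> \<Longrightarrow> \<exists>j::int. \<bar>of_int u * \<theta> - of_int j\<bar> \<le> 1 / N1" for i n u
    proof -
      let ?X = "\<bar>of_int u\<bar> / real L + 2 * pi * real D * real (card \<Theta>) * (1 / N1)"
      have "\<bar>smooth D L \<Theta> (f i) (n + u) - smooth D L \<Theta> (f i) n\<bar>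
          \<le> (\<Sum>m\<in>{1..int N}. f i m) * real D ^ card \<Theta> * ?X / real L"
        by (rule smooth_almost_period[OF D L(1) \<Theta>]) (use fsup[OF i] t[OF i] u(3) in auto)
      also have "\<dots> \<le> (2 * real N) * real D ^ k * ?X / real L"
        using mass[OF i] Dk t[OF i] by (intro divide_right_mono mult_mono mult_nonneg_nonneg sum_nonneg) auto
      also have "\<dots> = 2 * (real N / real L) * real D ^ k * ?X" by simp
      also have "\<dots> \<le> 2 * 40 * real D ^ k * ?X"
        using L40 L by (intro mult_right_mono mult_left_mono) (auto simp: pos_divide_le_eq)
      also have "\<dots> = C * ?X" by (simp add: C_def)
      also have "\<dots> \<le> C * (40 * \<tau> + 2 * pi * real D * (real k + 1) * \<rho>)"
      proof (intro mult_left_mono add_mono)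
        have "\<bar>of_int u\<bar> \<le> \<tau> * N" using u by simp
        also have "\<tau> * N \<le> \<tau> * (40 * real L)" using L40 \<tau> by (intro mult_left_mono) auto
        finally show "\<bar>of_int u\<bar> / real L \<le> 40 * \<tau>" using L by (simp add: pos_divide_le_eq)
        show "2 * pi * real D * real (card \<Theta>) * (1 / N1) \<le> 2 * pi * real D * (real k + 1) * \<rho>"
          using iN1 cardk by (intro mult_mono) auto
      qed (use C in auto)
      also have "\<dots> = \<omega>"
      proof -
        have "C * (40 * \<tau>) = \<omega> / 2" using C by (simp add: \<tau>_def)
        moreover have "C * (2 * pi * real D * (real k + 1) * \<rho>) = \<omega> / 2"
        proof -
          have *: "C * (A * (\<omega> / (2 * C * A))) = \<omega> / 2" if "A \<noteq> 0" for A using C that by simp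
          show ?thesis unfolding \<rho>_def by (rule *) (use D in simp)
        qed
        ultimately show ?thesis by (simp add: distrib_left)
      qed
      finally show ?thesis .
    qed
    have main: "conv (smooth D L \<Theta> (f 1)) (conv (smooth D L \<Theta> (f 2)) (smooth D L \<Theta> (f 3))) M \<ge> c0 * (real N)\<^sup>2"
      unfolding c0_def
    proof (rule structured_count[OF td s(1,2) \<eta>(2) _ N100 M D L \<Theta> _ d(1) Q0 Q\<eta> dQ100])
      show "\<omega> \<le> s\<^sup>2 / 8" by (simp add: \<omega>_def)
      show "\<eta> * real N * real D ^ card \<Theta> / real L \<le> s"
      proof -
        have "\<eta> * real N * real D ^ card \<Theta> / real L \<le> \<eta> * (40 * real L) * real D ^ k / real L"
          using \<eta> L40 Dk by (intro divide_right_mono mult_mono) auto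
        also have "\<dots> = \<eta> * (40 * real D ^ k)" using L by simp
        also have "\<dots> \<le> s" using \<eta>(4) D by (simp add: pos_le_divide_eq)
        finally show ?thesis .
      qed
      show "\<bar>smooth D L \<Theta> (f i) (n + d) - smooth D L \<Theta> (f i) n\<bar> \<le> \<omega>" if "i \<in> {1,2,3}" for i n
        using that d(1) dle pd by (rule ap)
      show "\<bar>smooth D L \<Theta> (f i) (n + d * Q) - smooth D L \<Theta> (f i) n\<bar> \<le> \<omega>" if "i \<in> {1,2,3}" for i n
        using that _ dQle pQ by (rule ap) (use d Q0 in auto)
    qed
    \<comment> \<open>Off the large spectrum the transform itself is at most
      \<open>\<epsilon> * N\<close>; on it the multiplier is within \<open>\<epsilon> / 2\<close> of
      1 and the transform is at most \<open>2 * N\<close>.\<close>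
    have he: "cmod (ft (f i) \<gamma> - ft (smooth D L \<Theta> (f i)) \<gamma>) \<le> \<epsilon> * N" if i: "i \<in> {1,2,3}" and \<gamma>: "\<gamma> \<in> {0..1}" for i \<gamma>
    proof (cases "cmod (ft (f i) \<gamma>) > \<epsilon> * N")
      case False
      then show ?thesis using norm_ft_smooth_le(2)[OF D L(1) \<Theta> ffs[OF i], of \<gamma>] by linarith
    next
      case True
      obtain \<theta> where \<theta>: "\<theta> \<in> \<Theta>i i" "\<bar>\<gamma> - \<theta>\<bar> \<le> 1 / T"
        unfolding \<Theta>i_def by (rule spectrum_grid_near[OF T \<gamma> True])
      have "1 - kmult D L \<Theta> \<gamma> \<le> 2 / real D + 2 * pi * real L * \<bar>\<gamma> - \<theta>\<bar>"
        by (rule kmult_near[OF D L(1) \<Theta>]) (use \<theta> \<Theta>sub[OF i] in auto)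
      also have "\<dots> \<le> \<epsilon> / 4 + \<epsilon> / 4"
      proof (intro add_mono)
        show "2 / real D \<le> \<epsilon> / 4"
          using Dr \<epsilon> D by (simp add: field_simps)
        have "2 * pi * real L * \<bar>\<gamma> - \<theta>\<bar> \<le> 2 * pi * real N * (1 / T)"
          using \<theta> L by (intro mult_mono) auto
        also have "\<dots> = (8 * pi * N / \<epsilon>) * (\<epsilon> / 4) / T" using \<epsilon> by simp
        also have "\<dots> \<le> real T * (\<epsilon> / 4) / T"
          using Tr \<epsilon> by (intro divide_right_mono mult_right_mono) auto
        also have "\<dots> = \<epsilon> / 4" using T by simp
        finally show "2 * pi * real L * \<bar>\<gamma> - \<theta>\<bar> \<le> \<epsilon> / 4" .
      qed
      finally have km: "1 - kmult D L \<Theta> \<gamma> \<le> \<epsilon> / 2" by simp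
      have "cmod (ft (f i) \<gamma>) \<le> 2 * real N"
        using norm_ft_le[of "{1..int N}" "f i" \<gamma>] fsup[OF i] t[OF i] mass[OF i] by fastforce
      then have "(1 - kmult D L \<Theta> \<gamma>) * cmod (ft (f i) \<gamma>) \<le> \<epsilon> / 2 * (2 * real N)"
        using km \<epsilon> by (intro mult_mono) auto
      then show ?thesis unfolding norm_ft_smooth_le(3)[OF D L(1) \<Theta> ffs[OF i]] by simp
    qed
    have "\<bar>conv (f 1) (conv (f 2) (f 3)) M
        - conv (smooth D L \<Theta> (f 1)) (conv (smooth D L \<Theta> (f 2)) (smooth D L \<Theta> (f 3))) M\<bar>
        \<le> 9 * (K * real N powr (q - 1)) * (\<epsilon> * N) powr (3 - q)"
      by (rule conv3_diff_bound[where f = f and g = "\<lambda>i. smooth D L \<Theta> (f i)", OF q])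
        (use ffs fsupp_smooth[OF L(1)] norm_ft_smooth_le(1,2)[OF D L(1) \<Theta>] he t(5) in auto)
    also have "\<dots> = 9 * K * \<epsilon> powr (3 - q) * (real N powr (q - 1) * real N powr (3 - q))"
      using \<epsilon> by (simp add: powr_mult)
    also have "real N powr (q - 1) * real N powr (3 - q) = (real N)\<^sup>2"
      using N100 by (simp add: powr_add[symmetric])
    finally show "c0 / 2 * (real N)\<^sup>2 \<le> conv (f 1) (conv (f 2) (f 3)) M"
      using main unfolding \<epsilon>q by linarith
  qed
qed

section \<open>Prime powers as sums of two squares\<close>

definition FI_reps :: "nat \<Rightarrow> (int \<times> nat) set" where
  "FI_reps n = {(k, l). l > 0 \<and> int n = k\<^sup>2 + (int l)\<^sup>2}"

lemma FI_reps_bounds: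
  assumes "(k, l) \<in> FI_reps n"
  shows "k\<^sup>2 \<le> int n" "l\<^sup>2 \<le> n" "\<bar>k\<bar> \<le> int n" "l \<le> n" "0 < l" "int n = k\<^sup>2 + (int l)\<^sup>2"
proof -
  show 1: "0 < l" "int n = k\<^sup>2 + (int l)\<^sup>2" using assms by (auto simp: FI_reps_def)
  show k: "k\<^sup>2 \<le> int n" using 1 by simp
  have "(int l)\<^sup>2 \<le> int n" using 1 by simp
  then have "int (l\<^sup>2) \<le> int n" by simp
  then show l: "l\<^sup>2 \<le> n" by (simp only: of_nat_le_iff)
  have "l \<le> l\<^sup>2" by (simp add: power2_eq_square)
  then show "l \<le> n" using l by linarith
  have "\<bar>k\<bar> * 1 \<le> \<bar>k\<bar> * \<bar>k\<bar>" 
  proof (cases "k = 0")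
    case False
    then have "1 \<le> \<bar>k\<bar>" by linarith
    then show ?thesis by (rule mult_left_mono) simp
  qed simp
  then show "\<bar>k\<bar> \<le> int n" using k by (simp add: power2_eq_square abs_mult[symmetric])
qed

lemma finite_FI_reps: "finite (FI_reps n)"
  by (rule finite_subset[of _ "{- int n..int n} \<times> {0..n}"]) (auto dest: FI_reps_bounds(3,4) simp: abs_le_iff)

lemma Lambda_Lambda_reps: "Lambda_Lambda n = mangoldt n * (\<Sum>(k, l)\<in>FI_reps n. mangoldt l)"
  by (simp add: Lambda_Lambda_def FI_reps_def)

lemma Lambda_Lambda_nonneg: "Lambda_Lambda n \<ge> 0"
  unfolding Lambda_Lambda_reps by (intro mult_nonneg_nonneg sum_nonneg) (auto simp: mangoldt_nonneg)

lemma Lambda_Lambda_nonzeroD: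
  assumes "Lambda_Lambda n \<noteq> 0"
  obtains k l where "primepow n" "primepow l" "(k, l) \<in> FI_reps n"
proof -
  have "(mangoldt n :: real) \<noteq> 0" "(\<Sum>(k, l)\<in>FI_reps n. mangoldt l :: real) \<noteq> 0"
    using assms by (auto simp: Lambda_Lambda_reps)
  moreover from this(2) obtain x where "x \<in> FI_reps n" "(mangoldt (snd x) :: real) \<noteq> 0"
    unfolding case_prod_unfold by (rule sum.not_neutral_contains_not_neutral)
  ultimately show ?thesis using that[of "snd x" "fst x"] by (auto simp: mangoldt_def split: if_splits)
qed

text \<open>Two representations \<open>k\<^sup>2 + l\<^sup>2 = k'\<^sup>2 + l'\<^sup>2 = p ^ j\<close> with \<open>p\<close> odd not dividing \<open>l\<close>, \<open>l'\<close>: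
  \<open>p ^ j\<close> divides \<open>(k l' - k' l) (k l' + k' l)\<close>, hence one of the factors, and the Brahmagupta
  identity leaves only \<open>(k', l') = (k, l)\<close> or \<open>(l, k)\<close>.\<close>

lemma two_squares_prime_power:
  fixes k l k' l' :: int and p :: nat
  assumes p: "prime p" "odd p" and j: "j > 0"
    and e: "int p ^ j = k\<^sup>2 + l\<^sup>2" "int p ^ j = k'\<^sup>2 + l'\<^sup>2"
    and nn: "k \<ge> 0" "k' \<ge> 0" "l > 0" "l' > 0"
    and nd: "\<not> int p dvd l" "\<not> int p dvd l'"
  shows "l' = l \<or> l' = k"
proof -
  define n where "n = int p ^ j"
  have pp: "prime (int p)" using p by simp
  have pn: "int p dvd n" using j by (simp add: n_def dvd_power)
  have n0: "n > 0" using p by (simp add: n_def prime_gt_0_nat)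
  have e: "k\<^sup>2 = n - l\<^sup>2" "k'\<^sup>2 = n - l'\<^sup>2" using e by (auto simp: n_def)
  have "(k * l' - k' * l) * (k * l' + k' * l) = k\<^sup>2 * l'\<^sup>2 - k'\<^sup>2 * l\<^sup>2"
    by (simp add: power2_eq_square algebra_simps)
  also have "\<dots> = n * (l'\<^sup>2 - l\<^sup>2)" unfolding e by (simp add: algebra_simps)
  finally have prod: "(k * l' - k' * l) * (k * l' + k' * l) = n * (l'\<^sup>2 - l\<^sup>2)" .
  then have dprod: "int p ^ j dvd (k * l' - k' * l) * (k * l' + k' * l)" by (simp add: n_def)
  \<comment> \<open>If \<open>p\<close> divided both factors it would divide their sum
    \<open>2 * k * l'\<close>, hence \<open>k\<close>, hence \<open>l\<close>.\<close>
  have notboth: "\<not> (int p dvd k * l' - k' * l \<and> int p dvd k * l' + k' * l)"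
  proof
    assume "int p dvd k * l' - k' * l \<and> int p dvd k * l' + k' * l"
    then have "int p dvd (k * l' - k' * l) + (k * l' + k' * l)" using dvd_add by blast
    then have d: "int p dvd 2 * (k * l')" by (simp add: algebra_simps)
    have "\<not> int p dvd 2"
    proof
      assume "int p dvd 2"
      then have "p \<le> 2" using zdvd_imp_le by fastforce
      then show False using p prime_ge_2_nat[of p] by auto
    qed
    then have "int p dvd k" using d nd pp by (simp add: prime_dvd_mult_iff)
    then have "int p dvd k\<^sup>2" by (simp add: power2_eq_square)
    then have "int p dvd n - k\<^sup>2" using pn by (rule dvd_diff[rotated])
    then have "int p dvd l\<^sup>2" using e by simp
    then show False using nd pp prime_dvd_power by blast
  qed
  have cop: "coprime (int p ^ j) x" if "\<not> int p dvd x" for x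
    using that pp by (simp add: prime_imp_coprime)
  consider (minus) "n dvd k * l' - k' * l" | (plus) "n dvd k * l' + k' * l"
    using notboth dprod cop unfolding n_def by (metis coprime_dvd_mult_left_iff coprime_dvd_mult_right_iff)
  then show ?thesis
  proof cases
    case minus
    have id: "(k * k' + l * l')\<^sup>2 + (k * l' - k' * l)\<^sup>2 = n\<^sup>2"
    proof -
      have "(k * k' + l * l')\<^sup>2 + (k * l' - k' * l)\<^sup>2 = (k\<^sup>2 + l\<^sup>2) * (k'\<^sup>2 + l'\<^sup>2)"
        by (simp add: power2_eq_square algebra_simps)
      then show ?thesis using e by (simp add: power2_eq_square)
    qed
    \<comment> \<open>A positive first square in the identity leaves
      \<open>\<bar>k * l' - k' * l\<bar> < n\<close>, so divisibility by \<open>n\<close> forces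
      0.\<close>
    have "k * k' + l * l' > 0" using nn by (simp add: add_nonneg_pos)
    then have "(k * k' + l * l')\<^sup>2 > 0" by simp
    then have "(k * l' - k' * l)\<^sup>2 < n\<^sup>2" using id by linarith
    then have "\<bar>k * l' - k' * l\<bar> < n" using n0 by (metis abs_le_square_iff abs_of_pos not_le)
    then have "k * l' - k' * l = 0" using minus by (metis dvd_imp_le_int not_le abs_of_pos n0)
    then have "n * (l'\<^sup>2 - l\<^sup>2) = 0" using prod by simp
    then have "l'\<^sup>2 = l\<^sup>2" using n0 by simp
    then show ?thesis using nn by (simp add: power2_eq_iff_nonneg)
  next
    case plus
    have id: "(k * k' - l * l')\<^sup>2 + (k * l' + k' * l)\<^sup>2 = n\<^sup>2"
    proof -
      have "(k * k' - l * l')\<^sup>2 + (k * l' + k' * l)\<^sup>2 = (k\<^sup>2 + l\<^sup>2) * (k'\<^sup>2 + l'\<^sup>2)"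
        by (simp add: power2_eq_square algebra_simps)
      then show ?thesis using e by (simp add: power2_eq_square)
    qed
    have nonneg: "k * l' + k' * l \<ge> 0" using nn by simp
    have "(k * k' - l * l')\<^sup>2 \<ge> 0" by simp
    then have "(k * l' + k' * l)\<^sup>2 \<le> n\<^sup>2" using id by linarith
    then have le: "k * l' + k' * l \<le> n" using n0 by (simp add: power2_le_iff_abs_le)
    show ?thesis
    proof (cases "k * l' + k' * l = 0")
      case True
      then have "n * (l'\<^sup>2 - l\<^sup>2) = 0" using prod by simp
      then have "l'\<^sup>2 = l\<^sup>2" using n0 by simp
      then show ?thesis using nn by (simp add: power2_eq_iff_nonneg)
    next
      case False
      then have "k * l' + k' * l = n" using le nonneg plus zdvd_imp_le by fastforce
      \<comment> \<open>The left side expands to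
        \<open>2 * n - 2 * (k * l' + k' * l)\<close>.\<close>
      then have "(l' - k)\<^sup>2 + (k' - l)\<^sup>2 = 0"
        using e by (simp add: power2_eq_square algebra_simps)
      then show ?thesis by (simp add: sum_power2_eq_zero_iff)
    qed
  qed
qed

lemma card_two_le:
  assumes "\<And>x y. x \<in> A \<Longrightarrow> y \<in> A \<Longrightarrow> y = x \<or> y = h x"
  shows "finite A \<and> card A \<le> 2"
proof (cases "A = {}")
  case False
  then obtain x where "x \<in> A" by blast
  then have sub: "A \<subseteq> {x, h x}" using assms by blast
  then have "card A \<le> card {x, h x}" by (intro card_mono) auto
  also have "\<dots> \<le> 2" by (cases "x = h x") auto
  finally show ?thesis using sub finite_subset by blast
qed auto

text \<open>Sort the possible \<open>l\<close> by divisibility by \<open>p\<close>. Among prime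
  powers the multiples of \<open>p\<close> are \<open>p ^ i\<close> with
  \<open>1 \<le> i \<le> j\<close>; the others take at most two values. The remaining factor 2 is
  the sign of \<open>k\<close>.\<close>

lemma card_FI_reps_primepow:
  assumes p: "prime p" and j: "j > 0"
  shows "card {(k, l). (k, l) \<in> FI_reps (p ^ j) \<and> primepow l} \<le> 2 * (j + 2)"
proof -
  let ?n = "p ^ j"
  define Lset where "Lset = {l. \<exists>k. (k, l) \<in> FI_reps ?n \<and> primepow l}"
  define A where "A = {l \<in> Lset. \<not> p dvd l}"
  define B where "B = {l \<in> Lset. p dvd l}"
  have A: "finite A \<and> card A \<le> 2"
  proof (cases "p = 2")
    case False
    then have odd: "odd p" using p primes_dvd_imp_eq two_is_prime_nat by blast
    show ?thesis
    proof (rule card_two_le[of A "\<lambda>l. nat (SOME k. k \<ge> 0 \<and> (k, l) \<in> FI_reps ?n)"])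
      fix l l' assume l: "l \<in> A" and l': "l' \<in> A"
      have ex: "\<exists>k\<ge>0. (k, l) \<in> FI_reps ?n" if "l \<in> A" for l
      proof -
        obtain k where "(k, l) \<in> FI_reps ?n" using \<open>l \<in> A\<close> by (auto simp: A_def Lset_def)
        then have "(\<bar>k\<bar>, l) \<in> FI_reps ?n" by (auto simp: FI_reps_def)
        then show ?thesis by (intro exI[of _ "\<bar>k\<bar>"]) auto
      qed
      define k where "k = (SOME k. k \<ge> 0 \<and> (k, l) \<in> FI_reps ?n)"
      have k: "k \<ge> 0 \<and> (k, l) \<in> FI_reps ?n" unfolding k_def by (rule someI_ex[OF ex[OF l]])
      obtain k' where k': "k' \<ge> 0" "(k', l') \<in> FI_reps ?n" using ex[OF l'] by blast
      have "int l' = int l \<or> int l' = k"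
      proof (rule two_squares_prime_power[OF p odd j])
        show "int p ^ j = k\<^sup>2 + (int l)\<^sup>2" "int p ^ j = k'\<^sup>2 + (int l')\<^sup>2"
          using FI_reps_bounds(6)[of k l ?n] FI_reps_bounds(6)[of k' l' ?n] k k' by auto
        show "\<not> int p dvd int l" "\<not> int p dvd int l'" using l l' by (auto simp: A_def)
      qed (use k k' FI_reps_bounds(5) in auto)
      then show "l' = l \<or> l' = nat (SOME k. k \<ge> 0 \<and> (k, l) \<in> FI_reps ?n)"
        unfolding k_def[symmetric] by auto
    qed
  next
    \<comment> \<open>For \<open>p = 2\<close> and \<open>l\<close> odd,
      \<open>k\<^sup>2 + l\<^sup>2\<close> is 1 or 2 modulo 4, so \<open>j = 1\<close> and
      \<open>l = 1\<close>.\<close>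
    case True
    have "l = 1" if "l \<in> A" for l
    proof -
      from that have "l \<in> Lset" by (simp add: A_def)
      then obtain k where k: "(k, l) \<in> FI_reps ?n" unfolding Lset_def by blast
      have ol: "odd l" using that True by (auto simp: A_def)
      have e: "int ?n = k\<^sup>2 + (int l)\<^sup>2" by (rule FI_reps_bounds(6)[OF k])
      have "(int l)\<^sup>2 mod 4 = 1"
      proof -
        obtain m where "l = 2 * m + 1" using ol by (auto elim: oddE)
        then have "(int l)\<^sup>2 = 4 * (int m * int m + int m) + 1" by (simp add: power2_eq_square algebra_simps)
        then show ?thesis by presburger
      qed
      moreover have "k\<^sup>2 mod 4 = 0 \<or> k\<^sup>2 mod 4 = 1"
      proof (cases "even k")
        case True
        then obtain m where "k = 2 * m" by blast
        then have "k\<^sup>2 = 4 * (m * m)" by (simp add: power2_eq_square)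
        then show ?thesis by presburger
      next
        case False
        then obtain m where "k = 2 * m + 1" by (auto elim: oddE)
        then have "k\<^sup>2 = 4 * (m * m + m) + 1" by (simp add: power2_eq_square algebra_simps)
        then show ?thesis by presburger
      qed
      ultimately have "int ?n mod 4 \<noteq> 0" unfolding e by presburger
      moreover have "int ?n mod 4 = 0" if "j \<ge> 2"
      proof -
        have "(2::nat) ^ 2 dvd 2 ^ j" using that by (rule le_imp_power_dvd)
        then have "4 dvd ?n" using True by simp
        then show ?thesis by presburger
      qed
      ultimately have "j = 1" using j by fastforce
      then have "int ?n = 2" using True by simp
      then have "(int l)\<^sup>2 \<le> 2" using e by (smt (verit) zero_le_power2)
      then have "l * l \<le> 2" by (metis of_nat_le_iff of_nat_numeral of_nat_power power2_eq_square)
      moreover have "l \<ge> 2 \<Longrightarrow> 4 \<le> l * l" using mult_le_mono[of 2 l 2 l] by simp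
      ultimately show ?thesis using ol by (cases "l \<ge> 2") (auto simp: not_le less_2_cases_iff)
    qed
    then have "A \<subseteq> {1}" by auto
    then show ?thesis using card_mono[of "{1}" A] finite_subset by fastforce
  qed
  have B: "finite B \<and> card B \<le> j"
  proof -
    have "B \<subseteq> (\<lambda>i. p ^ i) ` {1..j}"
    proof
      fix l assume "l \<in> B"
      then obtain k where k: "(k, l) \<in> FI_reps ?n" "primepow l" "p dvd l" by (auto simp: B_def Lset_def)
      then obtain r i where r: "prime r" "i > 0" "l = r ^ i" by (auto simp: primepow_def)
      have "p = r" using k(3) r p by (metis prime_dvd_power primes_dvd_imp_eq)
      have "p ^ i \<le> p ^ j" using FI_reps_bounds(4)[OF k(1)] r \<open>p = r\<close> by simp
      then have "i \<le> j" using p prime_gt_1_nat power_increasing_iff by blast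
      then show "l \<in> (\<lambda>i. p ^ i) ` {1..j}" using r \<open>p = r\<close> by auto
    qed
    then have "finite B" "card B \<le> card ((\<lambda>i. p ^ i) ` {1..j})"
      by (auto intro: finite_subset card_mono)
    moreover have "card ((\<lambda>i. p ^ i) ` {1..j}) \<le> j" using card_image_le[of "{1..j}" "\<lambda>i. p ^ i"] by simp
    ultimately show ?thesis by simp
  qed
  have L: "finite Lset" "card Lset \<le> j + 2"
  proof -
    have "Lset = A \<union> B" by (auto simp: A_def B_def)
    then show "finite Lset" "card Lset \<le> j + 2" using A B card_Un_le[of A B] by auto
  qed
  let ?R = "{(k, l). (k, l) \<in> FI_reps ?n \<and> primepow l}"
  have "card ?R \<le> card (Lset \<times> {True, False})"
  proof (rule card_inj_on_le[of "\<lambda>(k, l). (l, k \<ge> 0)"])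
    show "inj_on (\<lambda>(k, l). (l, k \<ge> 0)) ?R"
    proof (rule inj_onI, clarsimp)
      fix k k' :: int and l
      assume k: "(k, l) \<in> FI_reps ?n" "(k', l) \<in> FI_reps ?n" "(0 \<le> k) = (0 \<le> k')"
      then have "k\<^sup>2 = k'\<^sup>2" by (auto simp: FI_reps_def)
      then have "\<bar>k\<bar> = \<bar>k'\<bar>" by (simp add: power2_eq_iff abs_eq_iff)
      then show "k = k'" using k(3) by auto
    qed
    show "(\<lambda>(k, l). (l, k \<ge> 0)) ` ?R \<subseteq> Lset \<times> {True, False}" by (auto simp: Lset_def)
  qed (use L in auto)
  also have "\<dots> = card Lset * 2" by (simp add: card_cartesian_product)
  also have "\<dots> \<le> 2 * (j + 2)" using L by simp
  finally show ?thesis .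
qed

section \<open>Size of the weights, of the exceptional set and of \<open>W\<close>\<close>

lemma ln_2_ge_half: "ln 2 \<ge> (1/2 :: real)"
  using ln_le_minus_one[of "1/2::real"] by (simp add: ln_div)

text \<open>The factors \<open>mangoldt n\<close> and \<open>mangoldt l\<close> are each at most
  \<open>ln n\<close>, and for \<open>n = p ^ j\<close> the exponent \<open>j\<close> is at most
  \<open>2 * ln n\<close>, which bounds the number of representations with nonzero weight.\<close>

lemma Lambda_Lambda_le:
  assumes "n \<ge> 1"
  shows "Lambda_Lambda n \<le> (ln n)\<^sup>2 * (4 * ln n + 4)"
proof (cases "primepow n")
  case False
  then have "Lambda_Lambda n = 0" by (simp add: Lambda_Lambda_reps mangoldt_def)
  then show ?thesis using assms by simp
next
  case True
  then obtain p j where p: "prime p" "j > 0" "n = p ^ j" by (auto simp: primepow_def)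
  let ?R = "{(k, l). (k, l) \<in> FI_reps n \<and> primepow l}"
  have lnn: "ln n \<ge> 0" using assms by simp
  have jle: "real j \<le> 2 * ln n"
  proof -
    have "ln 2 \<le> ln (real p)" using prime_ge_2_nat[OF p(1)] by simp
    then have "1/2 \<le> ln (real p)" using ln_2_ge_half by linarith
    then have "real j * (1/2) \<le> real j * ln p" by (intro mult_left_mono) auto
    also have "\<dots> = ln n" using p prime_gt_0_nat[OF p(1)] by (simp add: ln_realpow)
    finally show ?thesis by simp
  qed
  have "(\<Sum>(k, l)\<in>FI_reps n. mangoldt l :: real) = (\<Sum>(k, l)\<in>?R. mangoldt l)"
    by (intro sum.mono_neutral_right finite_FI_reps) (auto simp: mangoldt_def split: if_splits)
  also have "\<dots> \<le> (\<Sum>(k, l)\<in>?R. ln n)"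
  proof (rule sum_mono, clarify)
    fix k l assume k: "(k, l) \<in> FI_reps n"
    have "mangoldt l \<le> ln (real l)" using FI_reps_bounds(5)[OF k] by (intro mangoldt_le) auto
    also have "\<dots> \<le> ln n" using FI_reps_bounds(4,5)[OF k] by simp
    finally show "mangoldt l \<le> ln n" .
  qed
  also have "\<dots> = real (card ?R) * ln n" by (simp add: case_prod_unfold)
  also have "\<dots> \<le> (4 * ln n + 4) * ln n"
  proof (rule mult_right_mono[OF _ lnn])
    have "real (card ?R) \<le> real (2 * (j + 2))" using card_FI_reps_primepow[OF p(1,2)] unfolding p(3) by (simp only: of_nat_le_iff)
    also have "\<dots> \<le> 4 * ln n + 4" using jle by simp
    finally show "real (card ?R) \<le> 4 * ln n + 4" .
  qed
  finally have "(\<Sum>(k, l)\<in>FI_reps n. mangoldt l :: real) \<le> (4 * ln n + 4) * ln n" .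
  moreover have "mangoldt n \<le> ln n" using assms by (intro mangoldt_le) auto
  moreover have "0 \<le> (\<Sum>(k, l)\<in>FI_reps n. mangoldt l :: real)" by (intro sum_nonneg) (auto simp: mangoldt_nonneg)
  ultimately have "Lambda_Lambda n \<le> ln n * ((4 * ln n + 4) * ln n)"
    unfolding Lambda_Lambda_reps using lnn by (intro mult_mono) auto
  then show ?thesis by (simp add: power2_eq_square mult_ac)
qed

definition proper_prime_powers :: "real \<Rightarrow> nat set" where
  "proper_prime_powers y = {m. real m \<le> y \<and> primepow m \<and> \<not> prime m}"

text \<open>An exponent at least 2 makes the base at most \<open>sqrt y\<close>; a base at least 2
  makes the exponent at most \<open>2 * ln y\<close>, as \<open>ln 2 \<ge> 1/2\<close>.\<close>

lemma proper_prime_powers_card: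
  assumes y: "y \<ge> 1"
  shows "finite (proper_prime_powers y)" "real (card (proper_prime_powers y)) \<le> sqrt y * (2 * ln y)"
proof -
  define s where "s = nat \<lfloor>sqrt y\<rfloor>"
  define t where "t = nat \<lfloor>2 * ln y\<rfloor>"
  have sub: "proper_prime_powers y \<subseteq> (\<lambda>(p, j). p ^ j) ` ({1..s} \<times> {1..t})"
  proof
    fix m assume "m \<in> proper_prime_powers y"
    then obtain p j where m: "prime p" "j > 0" "m = p ^ j" "real m \<le> y" "\<not> prime m"
      by (auto simp: proper_prime_powers_def primepow_def)
    have j2: "j \<ge> 2" using m by (cases "j = 1") auto
    have p2: "p \<ge> 2" using m(1) by (rule prime_ge_2_nat)
    have "p ^ 2 \<le> p ^ j" using j2 p2 by (intro power_increasing) auto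
    then have "real (p ^ 2) \<le> y" using m by (metis of_nat_le_iff order_trans)
    then have "real p \<le> sqrt y" by (intro real_le_rsqrt) simp
    then have ps: "p \<le> s" unfolding s_def by (simp add: le_nat_floor)
    have "(2::nat) ^ j \<le> p ^ j" using p2 by (intro power_mono) auto
    then have "real (2 ^ j) \<le> y" using m by (metis of_nat_le_iff order_trans)
    then have "ln (2 ^ j) \<le> ln y" using y by simp
    then have "real j * ln 2 \<le> ln y" by (simp add: ln_realpow)
    moreover have "real j * (1/2) \<le> real j * ln 2" using ln_2_ge_half by (intro mult_left_mono) auto
    ultimately have "real j \<le> 2 * ln y" by linarith
    then have "j \<le> t" unfolding t_def by (simp add: le_nat_floor)
    then show "m \<in> (\<lambda>(p, j). p ^ j) ` ({1..s} \<times> {1..t})" using ps p2 j2 m by auto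
  qed
  have fin: "finite ((\<lambda>(p::nat, j). p ^ j) ` ({1..s} \<times> {1..t}))" by auto
  show "finite (proper_prime_powers y)" by (rule finite_subset[OF sub fin])
  have "card (proper_prime_powers y) \<le> card ((\<lambda>(p::nat, j). p ^ j) ` ({1..s} \<times> {1..t}))"
    by (rule card_mono[OF fin sub])
  also have "\<dots> \<le> card ({1..s} \<times> {1..t})" by (rule card_image_le) auto
  also have "\<dots> = s * t" by simp
  finally have "real (card (proper_prime_powers y)) \<le> real s * real t" by (metis of_nat_le_iff of_nat_mult)
  also have "\<dots> \<le> sqrt y * (2 * ln y)"
    using y unfolding s_def t_def by (intro mult_mono of_nat_floor) auto
  finally show "real (card (proper_prime_powers y)) \<le> sqrt y * (2 * ln y)" .
qed

definition exceptional :: "nat \<Rightarrow> nat set" where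
  "exceptional x = {n \<in> {1..x}. Lambda_Lambda n \<noteq> 0 \<and> \<not> FI_prime n}"

text \<open>If \<open>n\<close> is not a proper prime power it is a prime
  \<open>k\<^sup>2 + l\<^sup>2\<close> with \<open>l\<close> a proper prime power up to
  \<open>sqrt x\<close>. This second kind dominates: about \<open>x powr (1/2)\<close> choices of
  \<open>k\<close> and \<open>x powr (1/4)\<close> of \<open>l\<close>, up to logarithms.\<close>

lemma exceptional_card:
  assumes x: "x \<ge> 1"
  shows "real (card (exceptional x)) \<le> 5 * real x powr (3/4) * ln x"
proof -
  define y where "y = sqrt (real x)"
  define r where "r = \<lfloor>y\<rfloor>"
  have y1: "y \<ge> 1" using x by (simp add: y_def)
  have r0: "r \<ge> 0" "real_of_int r \<le> y" using y1 by (auto simp: r_def)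
  let ?B = "proper_prime_powers (real x)" and ?B' = "proper_prime_powers y"
  note c = proper_prime_powers_card[of "real x"] proper_prime_powers_card[OF y1]
  have x1: "real x \<ge> 1" using x by simp
  let ?I = "(\<lambda>(k::int, l). nat (k\<^sup>2 + (int l)\<^sup>2)) ` ({-r..r} \<times> ?B')"
  have sub: "exceptional x \<subseteq> ?B \<union> ?I"
  proof
    fix n assume n: "n \<in> exceptional x"
    then have "Lambda_Lambda n \<noteq> 0" by (simp add: exceptional_def)
    then obtain k l where kl: "primepow n" "primepow l" "(k, l) \<in> FI_reps n"
      by (rule Lambda_Lambda_nonzeroD)
    show "n \<in> ?B \<union> ?I"
    proof (cases "prime n")
      case False
      then show ?thesis using n kl by (auto simp: exceptional_def proper_prime_powers_def)
    next
      case True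
      note b = FI_reps_bounds[OF kl(3)]
      have npl: "\<not> prime l"
      proof
        assume "prime l"
        then have "FI_prime n" using True b(6) unfolding FI_prime_def by blast
        then show False using n by (simp add: exceptional_def)
      qed
      have nx: "n \<le> x" using n by (simp add: exceptional_def)
      have "real l \<le> y" unfolding y_def
      proof (rule real_le_rsqrt)
        have "l\<^sup>2 \<le> x" using b(2) nx by linarith
        then show "(real l)\<^sup>2 \<le> real x" by (metis of_nat_le_iff of_nat_power)
      qed
      then have l: "l \<in> ?B'" using kl npl by (simp add: proper_prime_powers_def)
      have "\<bar>real_of_int k\<bar> \<le> y" unfolding y_def
      proof (rule real_le_rsqrt)
        have "k\<^sup>2 \<le> int x" using b(1) nx by linarith
        then have "real_of_int (k\<^sup>2) \<le> real_of_int (int x)" by (simp only: of_int_le_iff)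
        then show "\<bar>real_of_int k\<bar>\<^sup>2 \<le> real x" by simp
      qed
      then have "\<bar>k\<bar> \<le> r" unfolding r_def by (simp add: le_floor_iff)
      then have k: "k \<in> {-r..r}" by auto
      have "n = nat (k\<^sup>2 + (int l)\<^sup>2)" using b(6) by (metis nat_int)
      then show ?thesis using k l by (intro UnI2 image_eqI[of _ _ "(k, l)"]) auto
    qed
  qed
  have finI: "finite ?I" using c(3) by auto
  have cI: "real (card ?I) \<le> (2 * y + 1) * (sqrt y * (2 * ln y))"
  proof -
    have "card ?I \<le> card ({-r..r} \<times> ?B')" using c(3) by (intro card_image_le) auto
    also have "\<dots> = nat (2 * r + 1) * card ?B'" by (simp add: card_cartesian_product)
    finally have "real (card ?I) \<le> real (nat (2 * r + 1)) * real (card ?B')" by (metis of_nat_le_iff of_nat_mult)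
    also have "\<dots> \<le> (2 * y + 1) * (sqrt y * (2 * ln y))"
      using r0 c(4) y1 by (intro mult_mono) auto
    finally show ?thesis .
  qed
  have "card (exceptional x) \<le> card ?B + card ?I"
    using card_mono[OF _ sub] card_Un_le[of ?B ?I] c(1)[OF x1] finI by (meson finite_UnI order_trans)
  then have "real (card (exceptional x)) \<le> y * (2 * ln x) + (2 * y + 1) * (sqrt y * (2 * ln y))"
    using c(2)[OF x1] cI unfolding y_def by linarith
  also have "ln y = ln x / 2" using x by (simp add: y_def ln_sqrt)
  also have "y * (2 * ln x) + (2 * y + 1) * (sqrt y * (2 * (ln x / 2))) \<le> y * sqrt y * (2 * ln x) + (2 * y + y) * (sqrt y * (2 * (ln x / 2)))"
    using y1 x by (intro add_mono mult_right_mono) (auto simp: mult_le_cancel_left1)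
  also have "\<dots> = 5 * (y * sqrt y) * ln x" by (simp add: algebra_simps)
  also have "y * sqrt y = real x powr (3/4)"
    using x by (simp add: y_def powr_half_sqrt[symmetric] powr_powr powr_add[symmetric])
  finally show ?thesis .
qed

text \<open>At most \<open>w\<close> primes, each at most \<open>w\<close>, have product at most
  \<open>w powr w\<close>. With \<open>w = ln (ln x) / 10\<close> this crude bound is already below
  every positive power of large \<open>x\<close>.\<close>

lemma W_of_le:
  assumes x: "ln (ln (real x)) / 10 \<ge> 1"
  shows "real (W_of x) \<le> 2 * exp (ln (ln x) / 10 * ln (ln (ln x) / 10))"
proof -
  define w where "w = ln (ln (real x)) / 10"
  define P where "P = {p::nat. prime p \<and> real p \<le> w}"
  have sub: "P \<subseteq> {1..nat \<lfloor>w\<rfloor>}"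
    using prime_ge_1_nat by (auto simp: P_def le_nat_floor)
  have "real (\<Prod>p\<in>P. p) = (\<Prod>p\<in>P. real p)" by simp
  also have "\<dots> \<le> (\<Prod>p\<in>P. w)" by (intro prod_mono) (auto simp: P_def)
  also have "\<dots> = w ^ card P" by simp
  also have "\<dots> \<le> w ^ nat \<lfloor>w\<rfloor>"
    using x card_mono[OF _ sub] by (intro power_increasing) (auto simp: w_def)
  also have "\<dots> = w powr real (nat \<lfloor>w\<rfloor>)" using x by (subst powr_realpow) (auto simp: w_def)
  also have "\<dots> \<le> w powr w"
    using x by (intro powr_mono of_nat_floor) (auto simp: w_def)
  also have "\<dots> = exp (w * ln w)" using x by (simp add: powr_def w_def)
  finally show ?thesis by (simp add: W_of_def P_def w_def)
qed

text \<open>The inequality behind the final contradiction: of the exponent 7, six come from the cube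
  of the weight bound and one from \<open>x \<le> 2 * W * N\<close>. The next factor bounds the
  exceptional set, the last the pointwise size of \<open>Lambda_Lambda\<close>. It holds since
  \<open>3/4 < 1\<close>.\<close>

lemma eventually_large:
  fixes C :: real
  shows "eventually (\<lambda>x::real. C * (2 * exp (ln (ln x) / 10 * ln (ln (ln x) / 10)))^7
      * (5 * x powr (3/4) * ln x) * ((ln x)\<^sup>2 * (4 * ln x + 4))^3 < x) at_top"
  by real_asymp

lemma eventually_large2:
  "eventually (\<lambda>x::real. 100 * (2 * exp (ln (ln x) / 10 * ln (ln (ln x) / 10)))^4 \<le> x \<and> ln (ln x) / 10 \<ge> 5) at_top"
proof -
  have 1: "eventually (\<lambda>x::real. 100 * (2 * exp (ln (ln x) / 10 * ln (ln (ln x) / 10)))^4 \<le> x) at_top" by real_asymp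
  have 2: "eventually (\<lambda>x::real. ln (ln x) / 10 \<ge> 5) at_top" by real_asymp
  show ?thesis using eventually_conj[OF 1 2] by simp
qed

section \<open>Residue classes and the normalising factors\<close>

lemma W_of_props:
  assumes x: "ln (ln (real x)) / 10 \<ge> 2"
  shows "4 dvd W_of x" "W_of x > 0" "(\<Prod>p\<in>prime_factors (W_of x). p) dvd W_of x"
proof -
  define P where "P = {p::nat. prime p \<and> real p \<le> ln (ln (real x)) / 10}"
  have "P \<subseteq> {..nat \<lfloor>ln (ln (real x)) / 10\<rfloor>}" by (auto simp: P_def le_nat_floor)
  then have fin: "finite P" by (rule finite_subset) simp
  have "2 \<in> P" using x by (simp add: P_def)
  then have "2 dvd (\<Prod>p\<in>P. p)" using fin by (rule dvd_prodI[rotated])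
  then have "2 * 2 dvd 2 * (\<Prod>p\<in>P. p)" by (rule mult_dvd_mono[OF dvd_refl])
  then show "4 dvd W_of x" by (simp add: W_of_def P_def)
  have "(\<Prod>p\<in>P. p) > 0" by (intro prod_pos) (auto simp: P_def prime_gt_0_nat)
  then show pos: "W_of x > 0" by (simp add: W_of_def P_def)
  show "(\<Prod>p\<in>prime_factors (W_of x). p) dvd W_of x"
  proof -
    let ?W = "W_of x"
    have "(\<Prod>p\<in>prime_factors ?W. p) dvd (\<Prod>p\<in>prime_factors ?W. p ^ multiplicity p ?W)"
      by (intro prod_dvd_prod dvd_power) (auto simp: prime_factors_multiplicity)
    then show ?thesis using prod_prime_factors[of ?W] pos by simp
  qed
qed

lemma coprime_natI:
  assumes "\<And>p::nat. prime p \<Longrightarrow> p dvd a \<Longrightarrow> \<not> p dvd b"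
  shows "coprime a b"
proof (rule ccontr)
  assume "\<not> coprime a b"
  then have "gcd a b \<noteq> 1" by (metis coprime_iff_gcd_eq_1)
  then obtain p where "prime p" "p dvd gcd a b" using prime_factor_nat by blast
  then have "p dvd a" "p dvd b" by (auto dest: dvd_trans)
  then show False using assms \<open>prime p\<close> by blast
qed

text \<open>Take \<open>b \<equiv> 1\<close> or \<open>b \<equiv> 2\<close> modulo each odd prime \<open>p\<close>, whichever makes \<open>x - 2 b\<close> a unit.\<close>

lemma residue_selection:
  fixes x W :: nat
  assumes W: "4 dvd W" "W > 0" and x: "[x = 3] (mod 4)"
  obtains b b' where "b \<in> {1..W}" "coprime b W" "[b = 1] (mod 4)"
    "b' \<in> {1..W}" "coprime b' W" "[b' = 1] (mod 4)" "int W dvd int x - 2 * int b - int b'"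
proof -
  \<comment> \<open>Working modulo 4 at the prime 2 forces \<open>b\<close> to be 1 modulo 4, and
    then \<open>b'\<close> is \<open>3 - 2 = 1\<close> modulo 4 as well.\<close>
  define m :: "nat \<Rightarrow> nat" where "m p = (if p = 2 then 4 else p)" for p
  define u :: "nat \<Rightarrow> nat" where "u p = (if p = 2 then 1 else if [x = 2] (mod p) then 2 else 1)" for p
  have "\<exists>y. \<forall>i\<in>prime_factors W. [y = u i] (mod m i)"
  proof (rule chinese_remainder_nat)
    show "\<forall>i\<in>prime_factors W. \<forall>j\<in>prime_factors W. i \<noteq> j \<longrightarrow> coprime (m i) (m j)"
    proof (intro ballI impI)
      fix i j assume ij: "i \<in> prime_factors W" "j \<in> prime_factors W" "i \<noteq> j"
      then have "coprime i j" by (auto intro: primes_coprime)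
      then have "coprime (i ^ 2) (j ^ 2)" by simp
      moreover have "m i dvd i ^ 2" "m j dvd j ^ 2" by (auto simp: m_def power2_eq_square)
      ultimately show "coprime (m i) (m j)" by (rule coprime_divisors[rotated 2])
    qed
  qed simp
  then obtain y where y: "\<And>p. p \<in> prime_factors W \<Longrightarrow> [y = u p] (mod m p)" by blast
  have two: "2 \<in> prime_factors W"
  proof -
    have "2 dvd W" using W(1) by (rule dvd_trans[rotated]) simp
    then show ?thesis using W(2) by (simp add: prime_factors_dvd)
  qed
  define b where "b = y mod W"
  define b' where "b' = nat ((int x - 2 * int b) mod int W)"
  have b_cong: "[b = u p] (mod m p)" if p: "p \<in> prime_factors W" for p
  proof -
    have "m p dvd W" using p W by (auto simp: m_def)
    then have "[b = y] (mod m p)" unfolding b_def cong_def by (simp add: mod_mod_cancel)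
    then show ?thesis using y[OF p] cong_trans by blast
  qed
  have b4: "[b = 1] (mod 4)" using b_cong[OF two] by (simp add: u_def m_def)
  have b'int: "int b' = (int x - 2 * int b) mod int W" using W by (simp add: b'_def)
  have b'_cong: "[int b' = int x - 2 * int b] (mod d)" if "d dvd int W" for d
    unfolding b'int cong_def using that by (simp add: mod_mod_cancel)
  have b'4: "[b' = 1] (mod 4)"
  proof -
    have "[int b' = int x - 2 * int b] (mod 4)" using W(1) by (intro b'_cong) presburger
    moreover have "x mod 4 = 3" "b mod 4 = 1" using x b4 by (auto simp: cong_def)
    then have "(int x - 2 * int b) mod 4 = 1" by presburger
    ultimately have "int b' mod 4 = 1" by (simp add: cong_def)
    then show ?thesis unfolding cong_def by presburger
  qed
  have odd2: "odd p" if "prime p" "p \<noteq> 2" for p :: nat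
    using that primes_dvd_imp_eq two_is_prime_nat by blast
  have ndb: "\<not> p dvd b" if p: "prime p" "p dvd W" for p
  proof (cases "p = 2")
    case True
    then show ?thesis using b4 by (auto simp: cong_def) presburger
  next
    case False
    have pf: "p \<in> prime_factors W" using p W by (simp add: prime_factors_dvd)
    have c: "[b = u p] (mod p)" using b_cong[OF pf] False by (simp add: m_def)
    have p3: "p \<ge> 3" using False prime_ge_2_nat[OF p(1)] by simp
    have "u p = 1 \<or> u p = 2" by (simp add: u_def)
    then have "\<not> p dvd u p" using p3 by (auto dest: dvd_imp_le)
    then show ?thesis using c cong_dvd_iff by blast
  qed
  have ndb': "\<not> p dvd b'" if p: "prime p" "p dvd W" for p
  proof (cases "p = 2")
    case True
    then show ?thesis using b'4 by (auto simp: cong_def) presburger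
  next
    case False
    have pf: "p \<in> prime_factors W" using p W by (simp add: prime_factors_dvd)
    have c: "[b = u p] (mod p)" using b_cong[OF pf] False by (simp add: m_def)
    have p3: "p \<ge> 3" using False prime_ge_2_nat[OF p(1)] by simp
    have po: "odd p" using odd2 p False by blast
    have c': "[int b = int (u p)] (mod int p)" using c by (simp add: cong_int_iff)
    have "[int b' = int x - 2 * int b] (mod int p)" using p by (intro b'_cong) simp
    also have "[int x - 2 * int b = int x - 2 * int (u p)] (mod int p)"
      using c' by (intro cong_diff cong_mult cong_refl)
    finally have b'x: "[int b' = int x - 2 * int (u p)] (mod int p)" .
    \<comment> \<open>If \<open>x\<close> is 2 modulo \<open>p\<close>, then \<open>u p = 2\<close>
      makes the residue \<open>2 - 4\<close>, nonzero since \<open>p\<close> is odd; otherwise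
      \<open>u p = 1\<close> leaves \<open>x - 2\<close>, nonzero by the case assumption.\<close>
    have "\<not> int p dvd int x - 2 * int (u p)"
    proof (cases "[x = 2] (mod p)")
      case True
      then have xp: "[int x = 2] (mod int p)" by (metis cong_int_iff of_nat_numeral)
      have up: "u p = 2" using True False by (simp add: u_def)
      show ?thesis
      proof
        assume "int p dvd int x - 2 * int (u p)"
        then have "[int x = 4] (mod int p)" by (simp add: up cong_iff_dvd_diff)
        then have "[2 = 4] (mod int p)" using xp cong_sym cong_trans by blast
        then have "int p dvd 2" by (simp add: cong_iff_dvd_diff)
        then show False using p3 zdvd_imp_le by fastforce
      qed
    next
      case F: False
      then have up: "u p = 1" using False by (simp add: u_def)
      show ?thesis
      proof
        assume "int p dvd int x - 2 * int (u p)"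
        then have "[int x = int 2] (mod int p)" by (simp add: up cong_iff_dvd_diff)
        then show False using F cong_int_iff by blast
      qed
    qed
    then have "\<not> int p dvd int b'" using b'x cong_dvd_iff by blast
    then show ?thesis by simp
  qed
  show ?thesis
  proof (rule that[of b b'])
    have "b < W" "b' < W" using W b'int by (auto simp: b_def nat_less_iff b'_def)
    moreover have "b \<noteq> 0" "b' \<noteq> 0" using b4 b'4 by (auto simp: cong_def)
    ultimately show "b \<in> {1..W}" "b' \<in> {1..W}" by auto
    show "coprime b W" "coprime b' W" using ndb ndb' by (auto intro!: coprime_natI)
    show "[b = 1] (mod 4)" "[b' = 1] (mod 4)" by fact+
    show "int W dvd int x - 2 * int b - int b'"
      using b'_cong[of "int W"] by (simp add: cong_iff_dvd_diff dvd_diff_commute)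
  qed
qed

text \<open>Every factor \<open>1 - chi4 p / (p - 1)\<close> lies between 1/2 and 2, so its inverse
  is at least \<open>1/2 \<ge> 1 / p\<close>; the product of the primes dividing \<open>W\<close> is
  at most \<open>W\<close>.\<close>

lemma psi'_bounds:
  assumes W: "W > 0" "(\<Prod>p\<in>prime_factors W. p) dvd W"
  shows "psi' W \<ge> 1 / real W"
proof -
  have "(\<Prod>p\<in>prime_factors W. 1 / real p) \<le> psi' W"
    unfolding psi'_def
  proof (rule prod_mono)
    fix p assume "p \<in> prime_factors W"
    then have p: "prime p" by auto
    have p2: "p \<ge> 2" using p by (rule prime_ge_2_nat)
    let ?t = "1 - chi4 p / (real p - 1)"
    have "\<bar>chi4 p / (real p - 1)\<bar> \<le> 1/2"
    proof (cases "p = 2")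
      case True
      then show ?thesis by (simp add: chi4_def)
    next
      case False
      then have "real p \<ge> 3" using p2 by simp
      have "\<bar>chi4 p / (real p - 1)\<bar> = \<bar>chi4 p\<bar> / (real p - 1)" using \<open>real p \<ge> 3\<close> by (simp add: abs_divide)
      also have "\<dots> \<le> 1 / 2" using \<open>real p \<ge> 3\<close> by (intro frac_le) (auto simp: chi4_def)
      finally show ?thesis .
    qed
    then have t: "1/2 \<le> ?t" "?t \<le> 2" by linarith+
    have "1 / real p \<le> 1 / 2" using p2 by (intro divide_left_mono) auto
    also have "1 / 2 \<le> inverse ?t" using le_imp_inverse_le[of ?t 2] t by simp
    finally show "0 \<le> 1 / real p \<and> 1 / real p \<le> inverse ?t" by simp
  qed
  moreover have "(\<Prod>p\<in>prime_factors W. 1 / real p) = 1 / real (\<Prod>p\<in>prime_factors W. p)"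
    by (simp add: prod_dividef)
  moreover have "1 / real (\<Prod>p\<in>prime_factors W. p) \<ge> 1 / real W"
  proof -
    have le: "(\<Prod>p\<in>prime_factors W. p) \<le> W" using W by (intro dvd_imp_le) auto
    have "(\<Prod>p\<in>prime_factors W. p) > 0" by (intro prod_pos) (auto intro: prime_gt_0_nat)
    then show ?thesis using le W by (intro divide_left_mono mult_pos_pos) (simp_all del: of_nat_prod)
  qed
  ultimately show ?thesis by linarith
qed

section \<open>The coefficient of the W-tricked weights, and an upper bound for their
  density\<close>

definition wt_coeff :: "nat \<Rightarrow> nat \<Rightarrow> real" where
  "wt_coeff W b = real (totient W) / (Xi W b * real W * H_const)"

text \<open>Positivity of the coefficient, which will come from (III), settles the sign of
  \<open>H_const\<close> without evaluating the infinite product. \<open>R\<close> is a natural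
  number, so it is at least 1 once \<open>Xi W b\<close> is nonzero.\<close>

lemma wt_coeff_bound:
  assumes W: "W > 0" "(\<Prod>p\<in>prime_factors W. p) dvd W" and pos: "wt_coeff W b > 0"
  shows "H_const > 0" "wt_coeff W b \<le> (real W)\<^sup>2 / H_const"
proof -
  define R where "R = (\<Sum>c \<in> {c \<in> {0..<W}. coprime c W}. rho c W b)"
  have tW: "real (totient W) > 0" "real (totient W) \<le> real W"
    using W totient_le[of W] by simp_all
  have Xi: "Xi W b = (if coprime b W then psi' W / real (totient W) * real R else 0)"
    by (simp add: Xi_def R_def)
  have psi: "psi' W \<ge> 1 / real W" by (rule psi'_bounds[OF W])
  have "1 / real W > 0" using W by simp
  then have psi0: "psi' W > 0" using psi by linarith
  have "Xi W b \<ge> 0" using psi0 by (simp add: Xi)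
  moreover have Xi0: "Xi W b \<noteq> 0" "H_const \<noteq> 0" using pos by (auto simp: wt_coeff_def)
  ultimately have Xip: "Xi W b > 0" by linarith
  have "Xi W b * real W * H_const > 0"
    using pos tW by (simp add: wt_coeff_def zero_less_divide_iff)
  moreover have "Xi W b * real W > 0" using Xip W by simp
  ultimately show H: "H_const > 0" using zero_less_mult_pos by blast
  have R1: "R \<ge> 1" "coprime b W" using Xi0(1) unfolding Xi by (auto split: if_splits)
  have "Xi W b \<ge> 1 / real W / real (totient W) * 1"
    unfolding Xi using R1 psi psi0 tW by (simp only: if_True) (intro mult_mono divide_right_mono; simp)
  then have X: "Xi W b * real W \<ge> 1 / real (totient W)" using W by (simp add: field_simps)
  have "wt_coeff W b \<le> real (totient W) / (1 / real (totient W) * H_const)"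
    unfolding wt_coeff_def using X H tW Xip W
    by (intro divide_left_mono mult_right_mono mult_pos_pos) auto
  also have "\<dots> = (real (totient W))\<^sup>2 / H_const" by (simp add: power2_eq_square)
  also have "\<dots> \<le> (real W)\<^sup>2 / H_const" using tW H by (intro divide_right_mono power_mono) auto
  finally show "wt_coeff W b \<le> (real W)\<^sup>2 / H_const" .
qed

lemma W_trick_eq:
  "W_trick x W b f n = wt_coeff W b * (if W * n + b \<in> {1..x} then f (W * n + b) else 0)"
  for f :: "nat \<Rightarrow> real"
  by (simp add: W_trick_def wt_coeff_def)

definition lift :: "nat \<Rightarrow> (nat \<Rightarrow> real) \<Rightarrow> int \<Rightarrow> real" where
  "lift N u n = (if n \<in> {1..int N} then u (nat n) else 0)"

lemma sum_lift: "(\<Sum>n\<in>{1..int N}. \<phi> n) = (\<Sum>n\<in>{1..N}. \<phi> (int n))"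
  by (rule sum.reindex_bij_witness[of _ int nat]) auto

lemma ft_lift: "ft (lift N u) \<gamma> = (\<Sum>n\<in>{1..N}. of_real (u n) * add_char (\<gamma> * real n))"
proof -
  have "ft (lift N u) \<gamma> = (\<Sum>n\<in>{1..int N}. of_real (lift N u n) * add_char (\<gamma> * of_int n))"
    by (rule ft_eq_sum) (auto simp: lift_def)
  then show ?thesis by (simp add: sum_lift lift_def)
qed

text \<open>For \<open>0 \<le> \<gamma> \<le> 1 / (6 * N)\<close> all phases have cosine at least
  1/2, so the transform is at least \<open>\<alpha> * N / 2\<close> on an interval of length
  \<open>1 / (6 * N)\<close>; the L^q bound then gives
  \<open>(\<alpha> / 2) powr q \<le> 6 * K\<close>.\<close>

lemma density_upper_bound:
  fixes \<alpha> q K :: real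
  assumes f: "\<And>n. n \<in> {1..N} \<Longrightarrow> u n \<ge> 0" and N: "N \<ge> 1" and q: "q \<ge> 1" and \<alpha>: "\<alpha> > 0"
    and mass: "(\<Sum>n\<in>{1..N}. u n) \<ge> \<alpha> * real N"
    and Lq: "integral {0..1} (\<lambda>\<gamma>. cmod (ft (lift N u) \<gamma>) powr q) \<le> K * real N powr (q - 1)"
  shows "\<alpha> \<le> 2 * max 1 (6 * K)"
proof -
  let ?\<phi> = "\<lambda>\<gamma>. cmod (ft (lift N u) \<gamma>) powr q" and ?r = "1 / (6 * real N)"
  have cont: "continuous_on S ?\<phi>" for S
    using q by (intro continuous_intros continuous_on_powr') auto
  have big: "cmod (ft (lift N u) \<gamma>) \<ge> \<alpha> * real N / 2" if g: "\<gamma> \<in> {0..?r}" for \<gamma>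
  proof -
    have "(\<Sum>n\<in>{1..N}. u n * (1/2)) \<le> (\<Sum>n\<in>{1..N}. u n * cos (2 * pi * (\<gamma> * real n)))"
    proof (intro sum_mono mult_left_mono f)
      fix n assume n: "n \<in> {1..N}"
      have "\<gamma> * real n \<le> ?r * real N" using g n by (intro mult_mono) auto
      then have "2 * pi * (\<gamma> * real n) \<le> 2 * pi * (1/6)" using N by (intro mult_left_mono) auto
      then have "cos (pi / 3) \<le> cos (2 * pi * (\<gamma> * real n))"
        using g by (intro cos_monotone_0_pi_le) auto
      then show "1/2 \<le> cos (2 * pi * (\<gamma> * real n))" by (simp add: cos_60)
    qed
    also have "\<dots> = Re (ft (lift N u) \<gamma>)" by (simp add: ft_lift add_char_cis)
    also have "\<dots> \<le> cmod (ft (lift N u) \<gamma>)" by (rule complex_Re_le_cmod)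
    finally have "(\<Sum>n\<in>{1..N}. u n) * (1/2) \<le> cmod (ft (lift N u) \<gamma>)" by (simp only: sum_distrib_right)
    then show ?thesis using mass by linarith
  qed
  have "?r * (\<alpha> * real N / 2) powr q = integral {0..?r} (\<lambda>_. (\<alpha> * real N / 2) powr q)" by simp
  also have "\<dots> \<le> integral {0..?r} ?\<phi>"
    using big q \<alpha> by (intro integral_le powr_mono2 integrable_continuous_real cont) auto
  also have "\<dots> \<le> integral {0..1} ?\<phi>"
    using N by (intro integral_subset_le integrable_continuous_real cont) auto
  also have "\<dots> \<le> K * real N powr (q - 1)" by (rule Lq)
  finally have main: "?r * (\<alpha> * real N / 2) powr q \<le> K * real N powr (q - 1)" .
  have "(\<alpha> * real N / 2) powr q = (\<alpha> / 2) powr q * (real N powr (q - 1) * real N)"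
  proof -
    have "(\<alpha> * real N / 2) powr q = (\<alpha> / 2 * real N) powr q" by simp
    also have "\<dots> = (\<alpha> / 2) powr q * real N powr q" by (rule powr_mult)
    also have "real N powr q = real N powr (q - 1) * real N" using N by (simp add: powr_diff)
    finally show ?thesis .
  qed
  then have "(\<alpha> / 2) powr q * real N powr (q - 1) \<le> 6 * K * real N powr (q - 1)"
    using main N by (simp add: field_simps)
  then have le: "(\<alpha> / 2) powr q \<le> 6 * K" using N by (subst (asm) mult_le_cancel_right) auto
  show ?thesis
  proof (cases "\<alpha> / 2 \<le> 1")
    case True
    then show ?thesis by simp
  next
    case False
    then have "(\<alpha> / 2) powr 1 \<le> (\<alpha> / 2) powr q" using q by (intro powr_mono) auto
    then show ?thesis using le \<alpha> by simp
  qed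
qed

section \<open>From the weights to Fouvry--Iwaniec primes\<close>

text \<open>Division by \<open>\<alpha>p\<close> gives the majorant density 1 and the weight density
  \<open>\<alpha>m / \<alpha>p = 1/3 + \<delta> / (3 * \<alpha>p)\<close>. Since
  \<open>\<alpha>p < 3 * \<alpha>m \<le> A\<close>, the surplus is at least
  \<open>\<delta> / (3 * A)\<close>, which does not involve \<open>\<alpha>p\<close> any
  more.\<close>

lemma residue_class_data:
  fixes q K \<alpha>p \<alpha>m \<eta> \<eta>T \<delta> A :: real and x W N b :: nat and \<Lambda>p :: "nat \<Rightarrow> real"
  assumes q: "2 < q" and W: "W > 0" and N: "N \<ge> 1"
    and le: "\<And>n. n \<in> {1..x} \<Longrightarrow> Lambda_Lambda n \<le> \<Lambda>p n"
    and \<alpha>: "\<alpha>p > 0" "\<alpha>m > 0" and \<eta>: "0 < \<eta>" "\<eta> \<le> 1" "\<eta> \<le> \<eta>T"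
    and \<delta>: "\<delta> = 3 * \<alpha>m - \<alpha>p" "\<delta> > 0" and A: "A = 6 * max 1 (6 * K)"
    and I: "\<And>\<gamma>::real. cmod ((\<Sum>n\<in>{1..N}. of_real (W_trick x W b \<Lambda>p n) * add_char (\<gamma> * real n))
                   - of_real \<alpha>p * (\<Sum>n\<in>{1..N}. add_char (\<gamma> * real n))) \<le> \<alpha>p * \<eta> * real N"
    and II: "integral {0..1} (\<lambda>\<gamma>::real.
             cmod (\<Sum>n\<in>{1..N}. of_real (W_trick x W b Lambda_Lambda n) * add_char (\<gamma> * real n))
               powr q) \<le> K * real N powr (q - 1)"
    and III: "\<And>P. P \<subseteq> {1..N} \<Longrightarrow> arith_prog P \<Longrightarrow> real (card P) \<ge> \<eta> * real N \<Longrightarrow>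
             (\<Sum>n\<in>P. W_trick x W b Lambda_Lambda n) \<ge> \<alpha>m * real (card P)"
  shows "wt_coeff W b > 0" "\<alpha>p \<ge> \<delta> / 6"
    "transference_data q (K * (6 / \<delta>) powr q) (\<delta> / (3 * A)) \<eta>T N
       (\<lambda>n. inverse \<alpha>p * lift N (W_trick x W b Lambda_Lambda) n) (\<lambda>n. inverse \<alpha>p * lift N (W_trick x W b \<Lambda>p) n)"
proof -
  define u where "u = W_trick x W b Lambda_Lambda"
  define v where "v = W_trick x W b \<Lambda>p"
  \<comment> \<open>(III) on the whole interval gives the mass bound from which the sign of the
    coefficient, the cap on \<open>\<alpha>m\<close> and
    \<open>\<alpha>m \<le> 2 * \<alpha>p\<close> all follow.\<close>
  have full: "(\<Sum>n\<in>{1..N}. u n) \<ge> \<alpha>m * real N"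
  proof -
    have "arith_prog {1..N}"
      unfolding arith_prog_def
    proof (intro exI conjI)
      show "(0::nat) < 1" by simp
      have "n \<in> {1 + j * 1 |j. j < N}" if "n \<in> {1..N}" for n
        using that by (intro CollectI exI[of _ "n - 1"]) auto
      then show "{1..N} = {1 + j * 1 |j. j < N}" by auto
    qed
    moreover have "\<eta> * real N \<le> real N" using \<eta> by (simp add: mult_left_le_one_le)
    ultimately show ?thesis using III[of "{1..N}"] by (simp add: u_def)
  qed
  have Npos: "real N > 0" using N by simp
  show wt: "wt_coeff W b > 0"
  proof (rule ccontr)
    assume "\<not> wt_coeff W b > 0"
    then have "u n \<le> 0" for n
      using Lambda_Lambda_nonneg by (simp add: u_def W_trick_eq mult_nonpos_nonneg)
    then have "(\<Sum>n\<in>{1..N}. u n) \<le> 0" by (intro sum_nonpos)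
    moreover have "\<alpha>m * real N > 0" using \<alpha> Npos by simp
    ultimately show False using full by linarith
  qed
  have u0: "u n \<ge> 0" for n using wt Lambda_Lambda_nonneg by (simp add: u_def W_trick_eq)
  have uv: "u n \<le> v n" for n
    using wt le by (auto simp: u_def v_def W_trick_eq intro!: mult_left_mono)
  have IIu: "integral {0..1} (\<lambda>\<gamma>. cmod (ft (lift N u) \<gamma>) powr q) \<le> K * real N powr (q - 1)"
    using II by (simp add: ft_lift u_def)
  have "\<alpha>m \<le> 2 * max 1 (6 * K)"
    by (rule density_upper_bound[OF u0 N _ \<alpha>(2) full IIu]) (use q in auto)
  then have \<alpha>A: "\<alpha>p \<le> A" using \<delta> by (simp add: A)
  have A0: "A > 0" by (simp add: A)
  have Iv: "cmod (ft (lift N v) \<gamma> - of_real \<alpha>p * ft (ind N) \<gamma>) \<le> \<alpha>p * \<eta> * real N" for \<gamma>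
  proof -
    have "ind N = lift N (\<lambda>_. 1)" by (auto simp: ind_def lift_def)
    then have "ft (ind N) \<gamma> = (\<Sum>n\<in>{1..N}. add_char (\<gamma> * real n))" by (simp add: ft_lift)
    then show ?thesis using I[of \<gamma>] by (simp add: ft_lift v_def)
  qed
  \<comment> \<open>Frequency 0 in (I), with \<open>\<eta> \<le> 1\<close>.\<close>
  have "(\<Sum>n\<in>{1..N}. v n) \<le> 2 * \<alpha>p * real N"
  proof -
    have "ft (ind N) 0 = of_real (real N)"
      by (subst ft_eq_sum[of "{1..int N}"]) (auto simp: ind_def)
    then have "ft (lift N v) 0 - of_real \<alpha>p * ft (ind N) 0 = of_real ((\<Sum>n\<in>{1..N}. v n) - \<alpha>p * real N)"
      by (simp add: ft_lift)
    then have "\<bar>(\<Sum>n\<in>{1..N}. v n) - \<alpha>p * real N\<bar> \<le> \<alpha>p * \<eta> * real N"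
      using Iv[of 0] by (simp only: norm_of_real)
    moreover have "\<alpha>p * \<eta> * real N \<le> \<alpha>p * 1 * real N"
      using \<eta> \<alpha> by (intro mult_right_mono mult_left_mono) auto
    ultimately show ?thesis by linarith
  qed
  moreover have "(\<Sum>n\<in>{1..N}. u n) \<le> (\<Sum>n\<in>{1..N}. v n)" by (intro sum_mono uv)
  ultimately have "\<alpha>m * real N \<le> (2 * \<alpha>p) * real N" using full by linarith
  then have "\<alpha>m \<le> 2 * \<alpha>p" using Npos by (subst (asm) mult_le_cancel_right) auto
  then show \<alpha>p6: "\<alpha>p \<ge> \<delta> / 6" using \<delta> \<alpha> by simp
  show "transference_data q (K * (6 / \<delta>) powr q) (\<delta> / (3 * A)) \<eta>T N
       (\<lambda>n. inverse \<alpha>p * lift N (W_trick x W b Lambda_Lambda) n) (\<lambda>n. inverse \<alpha>p * lift N (W_trick x W b \<Lambda>p) n)"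
    unfolding transference_data_def u_def[symmetric] v_def[symmetric]
  proof (intro conjI allI impI)
    fix n :: int
    show "0 \<le> inverse \<alpha>p * lift N u n" using u0 \<alpha> by (simp add: lift_def)
    show "inverse \<alpha>p * lift N u n \<le> inverse \<alpha>p * lift N v n"
      using uv \<alpha> by (intro mult_left_mono) (auto simp: lift_def)
    show "n \<notin> {1..int N} \<Longrightarrow> inverse \<alpha>p * lift N v n = 0" by (simp only: lift_def if_False mult_zero_right)
  next
    fix \<gamma> :: real
    have "ft (\<lambda>n. inverse \<alpha>p * lift N v n) \<gamma> - ft (ind N) \<gamma>
        = of_real (inverse \<alpha>p) * (ft (lift N v) \<gamma> - of_real \<alpha>p * ft (ind N) \<gamma>)"
      using \<alpha> by (simp add: ft_cmult right_diff_distrib)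
    also have "cmod \<dots> = inverse \<alpha>p * cmod (ft (lift N v) \<gamma> - of_real \<alpha>p * ft (ind N) \<gamma>)"
      using \<alpha> by (simp add: norm_mult norm_inverse)
    also have "\<dots> \<le> inverse \<alpha>p * (\<alpha>p * \<eta> * real N)" using \<alpha> by (intro mult_left_mono Iv) auto
    also have "\<dots> = \<eta> * real N" using \<alpha> by simp
    also have "\<dots> \<le> \<eta>T * real N" using \<eta> by (intro mult_right_mono) auto
    finally show "cmod (ft (\<lambda>n. inverse \<alpha>p * lift N v n) \<gamma> - ft (ind N) \<gamma>) \<le> \<eta>T * real N" .
  next
    have K0: "0 \<le> K * real N powr (q - 1)"
    proof -
      have "0 \<le> integral {0..1} (\<lambda>\<gamma>. cmod (ft (lift N u) \<gamma>) powr q)"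
        using q by (intro integral_nonneg integrable_continuous_real continuous_intros continuous_on_powr') auto
      then show ?thesis using IIu by linarith
    qed
    have "(\<lambda>\<gamma>. cmod (ft (\<lambda>n. inverse \<alpha>p * lift N u n) \<gamma>) powr q)
        = (\<lambda>\<gamma>. inverse \<alpha>p powr q * cmod (ft (lift N u) \<gamma>) powr q)"
      using \<alpha> by (auto simp: ft_cmult norm_mult norm_inverse powr_mult)
    then have "integral {0..1} (\<lambda>\<gamma>. cmod (ft (\<lambda>n. inverse \<alpha>p * lift N u n) \<gamma>) powr q)
        = inverse \<alpha>p powr q * integral {0..1} (\<lambda>\<gamma>. cmod (ft (lift N u) \<gamma>) powr q)" by simp
    also have "\<dots> \<le> inverse \<alpha>p powr q * (K * real N powr (q - 1))"
      by (intro mult_left_mono IIu) auto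
    also have "\<dots> \<le> (6 / \<delta>) powr q * (K * real N powr (q - 1))"
    proof (intro mult_right_mono powr_mono2 K0)
      show "inverse \<alpha>p \<le> 6 / \<delta>"
        using \<alpha>p6 \<alpha> \<delta>(2) by (simp add: field_simps)
    qed (use q \<alpha> in auto)
    finally show "integral {0..1} (\<lambda>\<gamma>. cmod (ft (\<lambda>n. inverse \<alpha>p * lift N u n) \<gamma>) powr q)
        \<le> K * (6 / \<delta>) powr q * real N powr (q - 1)" by (simp add: mult_ac)
  next
    fix a d :: int and m :: nat
    assume d: "0 < d" and a: "1 \<le> a" "a + d * (int m - 1) \<le> int N" and m: "\<eta>T * real N \<le> real m"
    have jb: "1 \<le> a + d * int j" "a + d * int j \<le> int N" if "j < m" for j
    proof -
      show "1 \<le> a + d * int j" using a d by (simp add: add_increasing2)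
      have "d * int j \<le> d * (int m - 1)" using that d by (intro mult_left_mono) auto
      then show "a + d * int j \<le> int N" using a by linarith
    qed
    define P where "P = (\<lambda>j. nat (a + d * int j)) ` {..<m}"
    have inj: "inj_on (\<lambda>j. nat (a + d * int j)) {..<m}"
    proof (rule inj_onI)
      fix i j assume ij: "i \<in> {..<m}" "j \<in> {..<m}" "nat (a + d * int i) = nat (a + d * int j)"
      then have "a + d * int i = a + d * int j" using jb[of i] jb[of j] by (auto simp: nat_eq_iff)
      then show "i = j" using d by simp
    qed
    have Psub: "P \<subseteq> {1..N}"
    proof
      fix n assume "n \<in> P"
      then obtain j where "j < m" "n = nat (a + d * int j)" by (auto simp: P_def)
      then show "n \<in> {1..N}" using jb[of j] by (simp add: nat_le_iff Suc_le_eq)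
    qed
    have Pap: "arith_prog P"
      unfolding arith_prog_def
    proof (intro exI conjI)
      show "nat d > 0" using d by simp
      have "nat (a + d * int j) = nat a + j * nat d" for j
        using a d by (simp add: nat_add_distrib nat_mult_distrib mult.commute)
      then show "P = {nat a + j * nat d |j. j < m}" by (auto simp: P_def)
    qed
    have cP: "card P = m" unfolding P_def by (simp add: card_image[OF inj])
    have "\<eta> * real N \<le> \<eta>T * real N" using \<eta> by (intro mult_right_mono) auto
    then have "\<alpha>m * real m \<le> (\<Sum>n\<in>P. u n)" using III[OF Psub Pap] m by (simp add: cP u_def)
    also have "(\<Sum>n\<in>P. u n) = (\<Sum>j<m. lift N u (a + d * int j))"
      unfolding P_def sum.reindex[OF inj] using jb by (intro sum.cong) (auto simp: lift_def)
    finally have s: "\<alpha>m * real m \<le> (\<Sum>j<m. lift N u (a + d * int j))" .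
    have "1 / 3 + \<delta> / (3 * A) \<le> inverse \<alpha>p * \<alpha>m"
    proof -
      have "\<delta> / (3 * A) \<le> \<delta> / (3 * \<alpha>p)" using \<alpha>A \<alpha> \<delta> A0 by (intro divide_left_mono) auto
      also have "1 / 3 + \<delta> / (3 * \<alpha>p) = inverse \<alpha>p * \<alpha>m" using \<alpha> by (simp add: \<delta>(1) field_simps)
      finally show ?thesis by simp
    qed
    then have "(1 / 3 + \<delta> / (3 * A)) * real m \<le> inverse \<alpha>p * \<alpha>m * real m" by (intro mult_right_mono) auto
    also have "\<dots> = inverse \<alpha>p * (\<alpha>m * real m)" by simp
    also have "\<dots> \<le> inverse \<alpha>p * (\<Sum>j<m. lift N u (a + d * int j))" using s \<alpha> by (intro mult_left_mono) auto
    finally show "(1 / 3 + \<delta> / (3 * A)) * real m \<le> (\<Sum>j<m. inverse \<alpha>p * lift N u (a + d * int j))"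
      by (simp add: sum_distrib_left)
  qed
qed

text \<open>Union bound: a contributing triple has an exceptional entry in one of three places;
  fixing that entry leaves one free coordinate with \<open>N\<close> values, and each triple weighs
  at most \<open>F^3\<close>.\<close>

lemma exceptional_count:
  fixes u :: "nat \<Rightarrow> int \<Rightarrow> real" and b :: "nat \<Rightarrow> nat" and x W N :: nat and M :: int and F :: real
  assumes W: "W > 0"
    and u0: "\<And>i n. i \<in> {1,2,3} \<Longrightarrow> 0 \<le> u i n" "\<And>i n. i \<in> {1,2,3} \<Longrightarrow> u i n \<le> F"
    and supp: "\<And>i n. i \<in> {1,2,3} \<Longrightarrow> n \<notin> {1..int N} \<Longrightarrow> u i n = 0"
    and Ex: "\<And>y z. u 1 y \<noteq> 0 \<Longrightarrow> u 2 z \<noteq> 0 \<Longrightarrow> u 3 (M - y - z) \<noteq> 0 \<Longrightarrow>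
       nat (int W * y + int (b 1)) \<in> exceptional x \<or> nat (int W * z + int (b 2)) \<in> exceptional x
       \<or> nat (int W * (M - y - z) + int (b 3)) \<in> exceptional x"
  shows "conv (u 1) (conv (u 2) (u 3)) M \<le> 3 * real (card (exceptional x)) * real N * F^3"
proof -
  define Z where "Z i = {n \<in> {1..int N}. nat (int W * n + int (b i)) \<in> exceptional x}" for i
  let ?E = "real (card (exceptional x))"
  have F0: "F \<ge> 0" using u0[of 1 0] by simp
  have finE: "finite (exceptional x)" by (simp add: exceptional_def)
  have finZ: "finite (Z i)" for i by (rule finite_subset[of _ "{1..int N}"]) (auto simp: Z_def)
  have cZ: "real (card (Z i)) \<le> ?E" for i
  proof -
    have "card (Z i) \<le> card (exceptional x)"
    proof (rule card_inj_on_le[of "\<lambda>n. nat (int W * n + int (b i))"])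
      show "inj_on (\<lambda>n. nat (int W * n + int (b i))) (Z i)"
      proof (rule inj_onI)
        fix m n assume mn: "m \<in> Z i" "n \<in> Z i" "nat (int W * m + int (b i)) = nat (int W * n + int (b i))"
        have "0 \<le> int W * m + int (b i)" "0 \<le> int W * n + int (b i)" using mn by (auto simp: Z_def)
        then have "int W * m = int W * n" using mn(3) by linarith
        then show "m = n" using W by simp
      qed
    qed (use finE in \<open>auto simp: Z_def\<close>)
    then show ?thesis by simp
  qed
  define \<iota> where "\<iota> i n = (if n \<in> Z i then 1 else 0 :: real)" for i n
  have s\<iota>: "(\<Sum>n\<in>{1..int N}. \<iota> i n) \<le> ?E" for i
  proof -
    have "(\<Sum>n\<in>{1..int N}. \<iota> i n) = real (card ({1..int N} \<inter> Z i))"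
      unfolding \<iota>_def by (subst sum.inter_restrict[symmetric]) auto
    also have "{1..int N} \<inter> Z i = Z i" by (auto simp: Z_def)
    finally show ?thesis using cZ by simp
  qed
  \<comment> \<open>With \<open>y\<close> fixed, the third entry is an injective function of
    \<open>z\<close>.\<close>
  have s\<iota>3: "(\<Sum>z\<in>{1..int N}. \<iota> 3 (M - y - z)) \<le> ?E" for y
  proof -
    have "(\<Sum>z\<in>{1..int N}. \<iota> 3 (M - y - z)) = real (card ({1..int N} \<inter> {z. M - y - z \<in> Z 3}))"
      using sum.inter_restrict[of "{1..int N}" "\<lambda>_. 1 :: real" "{z. M - y - z \<in> Z 3}"] by (simp add: \<iota>_def)
    also have "card ({1..int N} \<inter> {z. M - y - z \<in> Z 3}) \<le> card (Z 3)"
      by (rule card_inj_on_le[of "\<lambda>z. M - y - z"]) (auto simp: inj_on_def finZ)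
    finally show ?thesis using cZ[of 3] by simp
  qed
  have "conv (u 1) (conv (u 2) (u 3)) M = (\<Sum>y\<in>{1..int N}. \<Sum>z\<in>{1..int N}. u 1 y * u 2 z * u 3 (M - y - z))"
    by (rule conv3_eq_sum) (auto simp: supp)
  also have "\<dots> \<le> (\<Sum>y\<in>{1..int N}. \<Sum>z\<in>{1..int N}. F^3 * (\<iota> 1 y + \<iota> 2 z + \<iota> 3 (M - y - z)))"
  proof (intro sum_mono)
    fix y z assume yz: "y \<in> {1..int N}" "z \<in> {1..int N}"
    show "u 1 y * u 2 z * u 3 (M - y - z) \<le> F^3 * (\<iota> 1 y + \<iota> 2 z + \<iota> 3 (M - y - z))"
    proof (cases "u 1 y * u 2 z * u 3 (M - y - z) = 0")
      case True
      then show ?thesis using F0 by (simp only:) (simp add: \<iota>_def)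
    next
      case False
      then have nz: "u 1 y \<noteq> 0" "u 2 z \<noteq> 0" "u 3 (M - y - z) \<noteq> 0" by auto
      then have M3: "M - y - z \<in> {1..int N}" using supp[of 3] by blast
      have "y \<in> Z 1 \<or> z \<in> Z 2 \<or> M - y - z \<in> Z 3" using Ex[OF nz] yz M3 by (auto simp: Z_def)
      then have 1: "1 \<le> \<iota> 1 y + \<iota> 2 z + \<iota> 3 (M - y - z)" by (auto simp: \<iota>_def)
      have "u 1 y * u 2 z * u 3 (M - y - z) \<le> F * F * F"
        using u0 F0 by (intro mult_mono mult_nonneg_nonneg) auto
      also have "\<dots> = F^3 * 1" by (simp add: power3_eq_cube)
      also have "\<dots> \<le> F^3 * (\<iota> 1 y + \<iota> 2 z + \<iota> 3 (M - y - z))" using 1 F0 by (intro mult_left_mono) auto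
      finally show ?thesis .
    qed
  qed
  also have "\<dots> = F^3 * (real N * (\<Sum>y\<in>{1..int N}. \<iota> 1 y) + real N * (\<Sum>z\<in>{1..int N}. \<iota> 2 z)
      + (\<Sum>y\<in>{1..int N}. \<Sum>z\<in>{1..int N}. \<iota> 3 (M - y - z)))"
    by (simp add: sum_distrib_left[symmetric] sum.distrib sum_distrib_right)
  also have "\<dots> \<le> F^3 * (real N * ?E + real N * ?E + real N * ?E)"
  proof (intro mult_left_mono add_mono s\<iota>)
    have "(\<Sum>y\<in>{1..int N}. \<Sum>z\<in>{1..int N}. \<iota> 3 (M - y - z)) \<le> (\<Sum>y\<in>{1..int N}. ?E)"
      by (intro sum_mono s\<iota>3)
    then show "(\<Sum>y\<in>{1..int N}. \<Sum>z\<in>{1..int N}. \<iota> 3 (M - y - z)) \<le> real N * ?E" by simp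
  qed (use F0 in auto)
  finally show ?thesis by (simp add: algebra_simps)
qed

lemma conv3_scale:
  fixes c :: real
  assumes "c \<noteq> 0"
  shows "conv (\<lambda>n. c * u n) (conv (\<lambda>n. c * v n) (\<lambda>n. c * w n)) M = c^3 * conv u (conv v w) M"
  using assms by (simp add: conv_def sum_distrib_left power3_eq_cube mult_ac)

lemma not_primepow_coprime_mult:
  assumes "coprime a b" "a > 1" "b > (1::nat)"
  shows "\<not> primepow (a * b)"
proof
  assume "primepow (a * b)"
  then obtain p k where p: "prime p" "k > 0" "a * b = p ^ k" by (auto simp: primepow_def)
  obtain r where r: "prime r" "r dvd a" using assms prime_factor_nat[of a] by auto
  obtain s where s: "prime s" "s dvd b" using assms prime_factor_nat[of b] by auto
  have "r dvd p ^ k" "s dvd p ^ k" using r s p(3) by (metis dvd_mult dvd_mult2)+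
  then have "r = p" "s = p" using r s p by (metis prime_dvd_power primes_dvd_imp_eq)+
  then show False using r s assms(1) p(1) by (metis coprime_common_divisor_nat not_prime_1)
qed

theorem theorem1p5:
  fixes q K :: real
  assumes "2 < q" and "q < 3" and "K > 0"
  shows "\<exists>(x\<^sub>0 :: nat) (\<eta>\<^sub>0 :: real \<Rightarrow> real).
    (\<forall>\<delta>>0. \<eta>\<^sub>0 \<delta> > 0) \<and>
    (\<forall>(x :: nat) (\<Lambda>p :: nat \<Rightarrow> real) (\<alpha>p :: real) (\<alpha>m :: real) (\<eta> :: real) (W :: nat) (N :: nat).
       x \<ge> x\<^sub>0 \<longrightarrow> [x = 3] (mod 4) \<longrightarrow>
       (\<forall>n\<in>{1..x}. Lambda_Lambda n \<le> \<Lambda>p n) \<longrightarrow>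
       \<alpha>p > 0 \<longrightarrow> \<alpha>m > 0 \<longrightarrow> \<eta> > 0 \<longrightarrow>
       W = W_of x \<longrightarrow> N = x div W \<longrightarrow>
       (\<forall>b\<in>{1..W}. coprime b W \<and> [b = 1] (mod 4) \<longrightarrow>
          (\<forall>\<gamma>::real.
             cmod ((\<Sum>n\<in>{1..N}. of_real (W_trick x W b \<Lambda>p n) * add_char (\<gamma> * real n))
                   - of_real \<alpha>p * (\<Sum>n\<in>{1..N}. add_char (\<gamma> * real n)))
             \<le> \<alpha>p * \<eta> * real N) \<and>
          integral {0..1} (\<lambda>\<gamma>::real.
             cmod (\<Sum>n\<in>{1..N}. of_real (W_trick x W b Lambda_Lambda n) * add_char (\<gamma> * real n))
               powr q)
             \<le> K * real N powr (q - 1) \<and>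
          (\<forall>P. P \<subseteq> {1..N} \<and> arith_prog P \<and> real (card P) \<ge> \<eta> * real N \<longrightarrow>
             (\<Sum>n\<in>P. W_trick x W b Lambda_Lambda n) \<ge> \<alpha>m * real (card P))) \<longrightarrow>
       \<alpha>p < 3 * \<alpha>m \<longrightarrow> \<eta> \<le> \<eta>\<^sub>0 (3 * \<alpha>m - \<alpha>p) \<longrightarrow>
       (\<exists>p\<^sub>1 p\<^sub>2 p\<^sub>3. FI_prime p\<^sub>1 \<and> FI_prime p\<^sub>2 \<and> FI_prime p\<^sub>3 \<and> x = p\<^sub>1 + p\<^sub>2 + p\<^sub>3))"
proof -
  define A where "A = 6 * max 1 (6 * K)"
  have A0: "A > 0" by (simp add: A_def)
  define E where "E x = 2 * exp (ln (ln x) / 10 * ln (ln (ln x) / 10))" for x :: real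
  define L where "L x = (ln x)\<^sup>2 * (4 * ln x + 4)" for x :: real
  \<comment> \<open>The implication sits inside the existentials so that \<open>\<eta>T\<close>,
    \<open>c\<close> and \<open>N0\<close> become total functions of \<open>\<delta>\<close> by
    choice.\<close>
  have "\<exists>\<eta> c N0. 0 < \<delta> \<longrightarrow> (\<eta> > 0 \<and> c > 0 \<and> (\<forall>N\<ge>N0. \<forall>f \<nu> M. int N - 3 \<le> M \<longrightarrow> M \<le> int N \<longrightarrow>
    (\<forall>i\<in>{1,2,3::nat}. transference_data q (K * (6 / \<delta>) powr q) (\<delta> / (3 * A)) \<eta> N (f i) (\<nu> i)) \<longrightarrow>
    conv (f 1) (conv (f 2) (f 3)) M \<ge> c * (real N)\<^sup>2))" for \<delta> :: real
  proof (cases "\<delta> > 0")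
    case True
    have "K * (6 / \<delta>) powr q > 0" "\<delta> / (3 * A) > 0" using True assms A0 by simp_all
    from transference[OF assms(1,2) this] show ?thesis by blast
  qed auto
  then obtain \<eta>T c N0 where T: "\<And>\<delta>::real. 0 < \<delta> \<Longrightarrow> \<eta>T \<delta> > 0" "\<And>\<delta>. 0 < \<delta> \<Longrightarrow> c \<delta> > (0::real)"
    "\<And>\<delta> N f \<nu> M. 0 < \<delta> \<Longrightarrow> N0 \<delta> \<le> N \<Longrightarrow> int N - 3 \<le> M \<Longrightarrow> M \<le> int N \<Longrightarrow>
    (\<forall>i\<in>{1,2,3::nat}. transference_data q (K * (6 / \<delta>) powr q) (\<delta> / (3 * A)) (\<eta>T \<delta>) N (f i) (\<nu> i)) \<Longrightarrow>
    conv (f 1) (conv (f 2) (f 3)) M \<ge> c \<delta> * (real N)\<^sup>2"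
    by metis
  \<comment> \<open>\<open>X \<delta>\<close> below exists for every real value of this constant;
    that \<open>H_const\<close> is positive becomes known only later, through (III).\<close>
  define C where "C \<delta> = 6 / (H_const^3 * (c \<delta> * (\<delta> / 6)^3))" for \<delta>
  have "\<exists>X. \<forall>x\<ge>X. C \<delta> * E x ^ 7 * (5 * x powr (3/4) * ln x) * L x ^ 3 < x" for \<delta>
    using eventually_large[of "C \<delta>"] unfolding eventually_at_top_linorder E_def L_def .
  then obtain X where X: "\<And>\<delta> x. x \<ge> X \<delta> \<Longrightarrow> C \<delta> * E x ^ 7 * (5 * x powr (3/4) * ln x) * L x ^ 3 < x"
    by metis
  obtain X2 where X2: "\<And>x. x \<ge> X2 \<Longrightarrow> 100 * E x ^ 4 \<le> x \<and> ln (ln x) / 10 \<ge> 5"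
    using eventually_large2 unfolding eventually_at_top_linorder E_def by blast
  \<comment> \<open>Once \<open>\<eta> * N > 1\<close> is known, the last bound forces
    \<open>N > max 1 (X \<delta>) + N0 \<delta>\<close>.\<close>
  define \<eta>0 where "\<eta>0 \<delta> = min (min 1 (\<eta>T \<delta>)) (1 / (max 1 (X \<delta>) + real (N0 \<delta>)))" for \<delta>
  \<comment> \<open>Only the absolute threshold \<open>X2\<close> enters here; all that depends on
    \<open>\<delta>\<close> is charged to \<open>\<eta>0\<close>.\<close>
  define x0 where "x0 = nat \<lceil>max 1 X2\<rceil>"
  show ?thesis
  proof (rule exI[of _ x0], rule exI[of _ \<eta>0], intro conjI allI impI)
    fix \<delta> :: real assume "\<delta> > 0"
    moreover have "max 1 (X \<delta>) + real (N0 \<delta>) > 0" by (simp add: add_pos_nonneg)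
    ultimately show "\<eta>0 \<delta> > 0" using T(1) by (simp add: \<eta>0_def)
  next
    fix x :: nat and \<Lambda>p :: "nat \<Rightarrow> real" and \<alpha>p \<alpha>m \<eta> :: real and W N :: nat
    assume xx0: "x0 \<le> x" and x3: "[x = 3] (mod 4)"
      and le: "\<forall>n\<in>{1..x}. Lambda_Lambda n \<le> \<Lambda>p n"
      and \<alpha>: "\<alpha>p > 0" "\<alpha>m > 0" and \<eta>: "\<eta> > 0" and Wd: "W = W_of x" and Nd: "N = x div W"
      and H: "\<forall>b\<in>{1..W}. coprime b W \<and> [b = 1] (mod 4) \<longrightarrow>
          (\<forall>\<gamma>::real.
             cmod ((\<Sum>n\<in>{1..N}. of_real (W_trick x W b \<Lambda>p n) * add_char (\<gamma> * real n))
                   - of_real \<alpha>p * (\<Sum>n\<in>{1..N}. add_char (\<gamma> * real n)))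
             \<le> \<alpha>p * \<eta> * real N) \<and>
          integral {0..1} (\<lambda>\<gamma>::real.
             cmod (\<Sum>n\<in>{1..N}. of_real (W_trick x W b Lambda_Lambda n) * add_char (\<gamma> * real n))
               powr q)
             \<le> K * real N powr (q - 1) \<and>
          (\<forall>P. P \<subseteq> {1..N} \<and> arith_prog P \<and> real (card P) \<ge> \<eta> * real N \<longrightarrow>
             (\<Sum>n\<in>P. W_trick x W b Lambda_Lambda n) \<ge> \<alpha>m * real (card P))"
      and lt: "\<alpha>p < 3 * \<alpha>m" and \<eta>le: "\<eta> \<le> \<eta>0 (3 * \<alpha>m - \<alpha>p)"
    define \<delta> where "\<delta> = 3 * \<alpha>m - \<alpha>p"
    have \<delta>: "\<delta> > 0" using lt by (simp add: \<delta>_def)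
    have \<eta>': "\<eta> \<le> 1" "\<eta> \<le> \<eta>T \<delta>" "\<eta> \<le> 1 / (max 1 (X \<delta>) + real (N0 \<delta>))"
      using \<eta>le by (auto simp: \<eta>0_def \<delta>_def[symmetric])
    have "max 1 X2 \<le> real x0" unfolding x0_def by (rule real_nat_ceiling_ge)
    then have xX2: "real x \<ge> X2" "real x \<ge> 1" using xx0 by auto
    have x100: "100 * E x ^ 4 \<le> x" and w5: "ln (ln (real x)) / 10 \<ge> 5" using X2[OF xX2(1)] by auto
    have lnx: "ln (real x) \<ge> 0" using xX2 by simp
    have WE: "real W \<le> E x" using W_of_le[of x] w5 by (simp add: Wd E_def)
    have W: "4 dvd W" "W > 0" "(\<Prod>p\<in>prime_factors W. p) dvd W"
      using W_of_props[of x] w5 by (simp_all add: Wd)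
    have W4: "W \<ge> 4" using W(1,2) by (rule dvd_imp_le)
    \<comment> \<open>Room for the singleton \<open>{2 * W + 3}\<close> used below.\<close>
    have Nbig: "N \<ge> 2 * W + 3"
    proof -
      have "real (100 * W ^ 4) \<le> 100 * E x ^ 4" using WE by (simp add: power_mono)
      then have "real (100 * W ^ 4) \<le> real x" using x100 by linarith
      then have "100 * W ^ 4 \<le> x" by (simp only: of_nat_le_iff)
      moreover have "(2 * W + 3) * W \<le> 100 * W ^ 4"
      proof -
        have "W ^ 2 \<le> W ^ 4" "W ^ 1 \<le> W ^ 4" using W4 by (intro power_increasing; simp)+
        then show ?thesis by (simp add: power2_eq_square algebra_simps)
      qed
      ultimately have "(2 * W + 3) * W \<le> x" by linarith
      then show ?thesis unfolding Nd using W by (simp add: less_eq_div_iff_mult_less_eq)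
    qed
    have N1: "N \<ge> 1" using Nbig by simp
    have H1: "cmod ((\<Sum>n\<in>{1..N}. of_real (W_trick x W b \<Lambda>p n) * add_char (\<gamma> * real n))
                   - of_real \<alpha>p * (\<Sum>n\<in>{1..N}. add_char (\<gamma> * real n))) \<le> \<alpha>p * \<eta> * real N"
      and H2: "integral {0..1} (\<lambda>\<gamma>::real.
             cmod (\<Sum>n\<in>{1..N}. of_real (W_trick x W b Lambda_Lambda n) * add_char (\<gamma> * real n))
               powr q) \<le> K * real N powr (q - 1)"
      and H3: "P \<subseteq> {1..N} \<Longrightarrow> arith_prog P \<Longrightarrow> real (card P) \<ge> \<eta> * real N \<Longrightarrow>
             (\<Sum>n\<in>P. W_trick x W b Lambda_Lambda n) \<ge> \<alpha>m * real (card P)"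
      if "b \<in> {1..W}" "coprime b W" "[b = 1] (mod 4)" for b \<gamma> P
      using H[rule_format, OF that(1) conjI[OF that(2,3)]] by blast+
    have \<eta>N: "\<eta> * real N > 1"
    \<comment> \<open>Otherwise (III) applies to singletons, while \<open>W (2 W + 3) + 1 = (W + 1) (2 W + 1)\<close> is not a prime power.\<close>
    proof (rule ccontr)
      assume "\<not> \<eta> * real N > 1"
      then have small: "\<eta> * real N \<le> 1" by simp
      have ap: "arith_prog {2 * W + 3}"
        unfolding arith_prog_def by (intro exI[of _ "2 * W + 3"] exI[of _ 1]) auto
      have "\<alpha>m * real (card {2 * W + 3}) \<le> (\<Sum>n\<in>{2 * W + 3}. W_trick x W 1 Lambda_Lambda n)"
        by (rule H3) (use W4 Nbig ap small in auto)
      moreover have "W_trick x W 1 Lambda_Lambda (2 * W + 3) = 0"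
      proof -
        have e: "W * (2 * W + 3) + 1 = (W + 1) * (2 * W + 1)" by (simp add: algebra_simps)
        have "coprime (W + 1) (2 * W + 1)"
        proof (rule coprime_natI)
          fix p :: nat assume p: "prime p" "p dvd W + 1"
          show "\<not> p dvd 2 * W + 1"
          proof
            assume "p dvd 2 * W + 1"
            moreover have "p dvd 2 * (W + 1)" using p(2) by (rule dvd_mult)
            ultimately have "p dvd 2 * (W + 1) - (2 * W + 1)" by (rule dvd_diff_nat[rotated])
            then show False using p(1) by simp
          qed
        qed
        then have "\<not> primepow ((W + 1) * (2 * W + 1))"
          using W4 by (intro not_primepow_coprime_mult) auto
        then have "Lambda_Lambda (W * (2 * W + 3) + 1) = 0"
          unfolding e by (simp add: Lambda_Lambda_def mangoldt_def)
        then show ?thesis by (simp add: W_trick_eq)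
      qed
      ultimately show False using \<alpha> by simp
    qed
    have Nlarge: "real N > max 1 (X \<delta>) + real (N0 \<delta>)"
    proof -
      let ?m = "max 1 (X \<delta>) + real (N0 \<delta>)"
      have m: "?m > 0" by (simp add: add_pos_nonneg)
      have "\<eta> * ?m \<le> 1" using \<eta>'(3) m by (simp add: pos_le_divide_eq)
      then have "\<eta> * ?m < \<eta> * real N" using \<eta>N by linarith
      then show ?thesis using \<eta> by simp
    qed
    have Nx: "N \<le> x" by (simp add: Nd)
    have NN0: "N0 \<delta> \<le> N" using Nlarge by linarith
    have xX: "real x \<ge> X \<delta>" using Nlarge Nx by linarith
    obtain b b' where b: "b \<in> {1..W}" "coprime b W" "[b = 1] (mod 4)"
      and b': "b' \<in> {1..W}" "coprime b' W" "[b' = 1] (mod 4)" and dv: "int W dvd int x - 2 * int b - int b'"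
      using residue_selection[OF W(1,2) x3] by metis
    \<comment> \<open>Two numbers \<open>W * n + b\<close> and one \<open>W * n + b'\<close> sum to
      \<open>x\<close> exactly when their three \<open>n\<close> sum to \<open>M\<close>. As
      \<open>b\<close> and \<open>b'\<close> lie in \<open>{1..W}\<close>, \<open>M\<close> is
      between \<open>N - 3\<close> and \<open>N\<close>.\<close>
    obtain M where M: "int x - 2 * int b - int b' = int W * M" using dv by blast
    have xN: "W * N \<le> x" "x < W * (N + 1)"
      using W by (simp_all add: Nd dividend_less_times_div)
    have M1: "int N - 3 \<le> M"
    proof -
      have "int W * N \<le> int x" using xN(1) by (simp flip: of_nat_mult)
      then have "int W * (int N - 3) \<le> int W * M" using M b b' by (simp add: algebra_simps)
      then show ?thesis using W by simp
    qed
    have M2: "M \<le> int N"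
    proof -
      have "int x < int (W * (N + 1))" using xN(2) by (simp only: of_nat_less_iff)
      then have "int W * M < int W * (int N + 1)" using M b b' by (simp add: algebra_simps)
      then show ?thesis using W by simp
    qed
    define bb where "bb i = (if i = 3 then b' else b)" for i :: nat
    have bb: "bb i \<in> {1..W}" "coprime (bb i) W" "[bb i = 1] (mod 4)" for i using b b' by (auto simp: bb_def)
    define u where "u i = lift N (W_trick x W (bb i) Lambda_Lambda)" for i
    note data = residue_class_data[OF assms(1) W(2) N1 _ \<alpha> \<eta> \<eta>'(1,2) \<delta>_def \<delta> A_def
        H1[OF bb] H2[OF bb] H3[OF bb]]
    have wt: "wt_coeff W (bb i) > 0" for i by (rule data(1)) (use le in auto)
    have \<alpha>p6: "\<alpha>p \<ge> \<delta> / 6" by (rule data(2)) (use le in auto)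
    have lower: "c \<delta> * (real N)\<^sup>2 \<le> conv (\<lambda>n. inverse \<alpha>p * u 1 n) (conv (\<lambda>n. inverse \<alpha>p * u 2 n) (\<lambda>n. inverse \<alpha>p * u 3 n)) M"
      unfolding u_def
    proof (rule T(3)[where f = "\<lambda>i n. inverse \<alpha>p * lift N (W_trick x W (bb i) Lambda_Lambda) n"
          and \<nu> = "\<lambda>i n. inverse \<alpha>p * lift N (W_trick x W (bb i) \<Lambda>p) n", OF \<delta> NN0 M1 M2], intro ballI)
      fix i :: nat
      show "transference_data q (K * (6 / \<delta>) powr q) (\<delta> / (3 * A)) (\<eta>T \<delta>) N
         (\<lambda>n. inverse \<alpha>p * lift N (W_trick x W (bb i) Lambda_Lambda) n) (\<lambda>n. inverse \<alpha>p * lift N (W_trick x W (bb i) \<Lambda>p) n)"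
        by (rule data(3)) (use le in auto)
    qed
    have Hpos: "H_const > 0" by (rule wt_coeff_bound(1)[OF W(2,3) wt])
    define F where "F = (real W)\<^sup>2 / H_const * L x"
    have L0: "L x \<ge> 0" using lnx by (simp add: L_def)
    have F0: "F \<ge> 0" using Hpos L0 by (simp add: F_def)
    have LLle: "Lambda_Lambda n \<le> L x" if "n \<in> {1..x}" for n
    proof -
      have n1: "n \<ge> 1" and ln: "ln (real n) \<le> ln (real x)" "0 \<le> ln (real n)" using that by auto
      have "Lambda_Lambda n \<le> (ln n)\<^sup>2 * (4 * ln n + 4)" by (rule Lambda_Lambda_le[OF n1])
      also have "\<dots> \<le> L x" unfolding L_def using ln by (intro mult_mono power_mono) auto
      finally show ?thesis .
    qed
    have u0: "0 \<le> u i n" for i n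
      using wt[of i] Lambda_Lambda_nonneg by (simp add: u_def lift_def W_trick_eq)
    have uF: "u i n \<le> F" for i n
    proof -
      have "W_trick x W (bb i) Lambda_Lambda m \<le> F" for m
        unfolding W_trick_eq F_def using wt_coeff_bound(2)[OF W(2,3) wt] wt LLle L0 Hpos Lambda_Lambda_nonneg
        by (intro mult_mono) (auto intro: less_imp_le)
      then show ?thesis using F0 by (simp add: u_def lift_def)
    qed
    show "\<exists>p\<^sub>1 p\<^sub>2 p\<^sub>3. FI_prime p\<^sub>1 \<and> FI_prime p\<^sub>2 \<and> FI_prime p\<^sub>3 \<and> x = p\<^sub>1 + p\<^sub>2 + p\<^sub>3"
    \<comment> \<open>With no representation of \<open>x\<close>, every contributing triple contains
      an exceptional integer, so the count is at most
      \<open>3 * card (exceptional x) * N * F^3\<close>, against a lower bound of order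
      \<open>N\<^sup>2\<close>.\<close>
    proof (rule ccontr)
      assume none: "\<not> (\<exists>p\<^sub>1 p\<^sub>2 p\<^sub>3. FI_prime p\<^sub>1 \<and> FI_prime p\<^sub>2 \<and> FI_prime p\<^sub>3 \<and> x = p\<^sub>1 + p\<^sub>2 + p\<^sub>3)"
      have unz: "n \<in> {1..int N} \<and> (FI_prime (nat (int W * n + int (bb i))) \<or> nat (int W * n + int (bb i)) \<in> exceptional x)"
        if "u i n \<noteq> 0" for i n
      proof -
        have n: "n \<in> {1..int N}" using that by (auto simp: u_def lift_def split: if_splits)
        then have "W_trick x W (bb i) Lambda_Lambda (nat n) \<noteq> 0" using that by (simp add: u_def lift_def)
        then have *: "W * nat n + bb i \<in> {1..x}" "Lambda_Lambda (W * nat n + bb i) \<noteq> 0"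
          by (auto simp: W_trick_eq split: if_splits)
        have "nat (int W * n + int (bb i)) = W * nat n + bb i"
          using n by (simp add: nat_add_distrib nat_mult_distrib)
        then show ?thesis using * n by (auto simp: exceptional_def)
      qed
      have "conv (u 1) (conv (u 2) (u 3)) M \<le> 3 * real (card (exceptional x)) * real N * F^3"
      proof (rule exceptional_count[OF W(2), where b = bb])
        show "n \<notin> {1..int N} \<Longrightarrow> u i n = 0" for i n using unz by blast
        fix y z assume nz: "u 1 y \<noteq> 0" "u 2 z \<noteq> 0" "u 3 (M - y - z) \<noteq> 0"
        let ?p = "\<lambda>i n. nat (int W * n + int (bb i))"
        have "x = ?p 1 y + ?p 2 z + ?p 3 (M - y - z)"
        proof -
          have "0 \<le> int W * y" "0 \<le> int W * z" "0 \<le> int W * (M - y - z)" using unz[OF nz(1)] unz[OF nz(2)] unz[OF nz(3)] by auto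
          then have "int (?p 1 y + ?p 2 z + ?p 3 (M - y - z))
              = int W * y + int b + (int W * z + int b) + (int W * (M - y - z) + int b')"
            by (simp add: bb_def)
          also have "\<dots> = int W * M + 2 * int b + int b'" by (simp add: algebra_simps)
          also have "\<dots> = int x" using M by linarith
          finally show ?thesis by linarith
        qed
        then show "?p 1 y \<in> exceptional x \<or> ?p 2 z \<in> exceptional x \<or> ?p 3 (M - y - z) \<in> exceptional x"
          using unz[OF nz(1)] unz[OF nz(2)] unz[OF nz(3)] none by blast
      qed (use u0 uF in auto)
      moreover have "c \<delta> * (real N)\<^sup>2 \<le> inverse \<alpha>p ^ 3 * conv (u 1) (conv (u 2) (u 3)) M"
        using lower conv3_scale[of "inverse \<alpha>p" "u 1" "u 2" "u 3" M] \<alpha> by simp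
      ultimately have "c \<delta> * (real N)\<^sup>2 \<le> inverse \<alpha>p ^ 3 * (3 * real (card (exceptional x)) * real N * F^3)"
        using \<alpha> by (meson inverse_nonnegative_iff_nonnegative less_imp_le mult_left_mono order_trans zero_le_power)
      then have "\<alpha>p ^ 3 * (c \<delta> * (real N)\<^sup>2) \<le> \<alpha>p ^ 3 * (inverse \<alpha>p ^ 3 * (3 * real (card (exceptional x)) * real N * F^3))"
        using \<alpha> by (intro mult_left_mono) auto
      also have "\<dots> = 3 * real (card (exceptional x)) * real N * F^3"
        using \<alpha> by (simp add: power_inverse)
      finally have "(\<alpha>p ^ 3 * (c \<delta> * real N)) * real N \<le> (3 * real (card (exceptional x)) * F^3) * real N"
        by (simp add: power2_eq_square mult_ac)
      then have "\<alpha>p ^ 3 * (c \<delta> * real N) \<le> 3 * real (card (exceptional x)) * F^3"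
        using N1 by (subst (asm) mult_le_cancel_right) auto
      moreover have "(\<delta> / 6) ^ 3 * (c \<delta> * real N) \<le> \<alpha>p ^ 3 * (c \<delta> * real N)"
        using \<alpha>p6 \<delta> T(2)[OF \<delta>] by (intro mult_right_mono power_mono) auto
      ultimately have up: "(\<delta> / 6) ^ 3 * (c \<delta> * real N) \<le> 3 * real (card (exceptional x)) * F^3" by linarith
      define G where "G = c \<delta> * (\<delta> / 6)^3"
      have G: "G > 0" using \<delta> T(2)[OF \<delta>] by (simp add: G_def)
      \<comment> \<open>\<open>N\<close> is turned back into \<open>x\<close> at the cost of one
        more factor \<open>W\<close>.\<close>
      have x2: "real x \<le> 2 * real W * real N"
      proof -
        have "x < W * (N + 1)" by (rule xN)
        also have "\<dots> \<le> W * (2 * N)" using N1 by (intro mult_le_mono2) simp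
        finally have "real x \<le> real (W * (2 * N))" by (simp only: of_nat_le_iff)
        then show ?thesis by simp
      qed
      have "G * real x \<le> G * (2 * real W * real N)" using G x2 by (intro mult_left_mono) auto
      also have "\<dots> = 2 * real W * ((\<delta> / 6) ^ 3 * (c \<delta> * real N))" by (simp add: G_def)
      also have "\<dots> \<le> 2 * real W * (3 * real (card (exceptional x)) * F^3)" using up by (intro mult_left_mono) auto
      also have "\<dots> = 6 / H_const^3 * (real W ^ 7 * real (card (exceptional x)) * L x ^ 3)"
        by (simp add: F_def power_mult_distrib power_divide eval_nat_numeral)
      also have "\<dots> \<le> 6 / H_const^3 * (E x ^ 7 * (5 * real x powr (3/4) * ln x) * L x ^ 3)"
        using exceptional_card[of x] xX2 WE Hpos L0
        by (intro mult_left_mono mult_mono power_mono mult_nonneg_nonneg) auto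
      finally have "G * real x \<le> 6 / H_const^3 * (E x ^ 7 * (5 * real x powr (3/4) * ln x) * L x ^ 3)" .
      moreover have "y \<le> B / G" if "G * y \<le> B" for y B
        using G that by (simp add: pos_le_divide_eq mult.commute)
      ultimately have "real x \<le> 6 / H_const^3 * (E x ^ 7 * (5 * real x powr (3/4) * ln x) * L x ^ 3) / G"
        by blast
      also have "\<dots> = C \<delta> * E x ^ 7 * (5 * real x powr (3/4) * ln x) * L x ^ 3"
        by (simp add: C_def G_def)
      also have "\<dots> < real x" by (rule X[OF xX])
      finally show False by simp
    qed
  qed
qed

end
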